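(* Assume (A1)-(A2) (see context) and that $\gamma$ is sufficiently large (i.e. $\gamma\ge\gamma_0$ for some $\gamma_0>0$ depending only on the data $A,B_c,C,D_c,E,Q_1,R_c,G_1,T$). Let $(u_c^*,v^* )$ be the open-loop Nash equilibrium, i.e. $$u_c^*=-R_c^{-1}[B_c^\top\bar y+D_c^\top\bar z],\qquad v^*=\gamma^{-2}E^\top\bar y,$$ where $(\bar x,\bar y,\bar z)$ is the (unique) adapted square-integrable solution of the FBSDE $$\begin{cases}d\bar x=[A\bar x-(B_cR_c^{-1}B_c^\top-\gamma^{-2}EE^\top)\bar y-B_cR_c^{-1}D_c^\top\bar z]dt+[C\bar x-D_cR_c^{-1}B_c^\top\bar y-D_cR_c^{-1}D_c^\top\bar z]dW,\\ d\bar y=-[A^\top\bar y+C^\top\bar z+Q_1\bar x]dt+\bar z\,dW,\\ \bar x(0)=x_0,\quad\bar y(T)=G_1\bar x(T).\end{cases}$$ Suppose that the equation $$\begin{cases}\dot P+PA+A^\top P-P(B_cR_c^{-1}B_c^\top-\gamma^{-2}EE^\top)P+Q_1\\ \quad+(C-D_cR_c^{-1}B_c^\top P)^\top(I+PD_cR_c^{-1}D_c^\top)^{-1}P(C-D_cR_c^{-1}B_c^\top P)=0,\\ P(T)=G_1\end{cases}$$ admits a solution $P(\cdot)$ on $[0,T]$ such that $I+PD_cR_c^{-1}D_c^\top$ is invertible. Then $$u_c^*(t)=-R_c^{-1}\big[B_c^\top P+D_c^\top(I+PD_cR_c^{-1}D_c^\top)^{-1}P(C-D_cR_c^{-1}B_c^\top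 P)\big]\bar x(t),\qquad v^*(t)=\gamma^{-2}E^\top P\bar x(t).$$
   Context: $T>0$ is fixed; $W$ is a one-dimensional Brownian motion on $(\Omega,\mathcal F,\mathbb F,\mathbb P)$, $\mathbb F$ its augmented natural filtration. Consider the controlled system $$dx=[Ax+B_cu_c+Ev]dt+[Cx+D_cu_c]dW,\quad x(0)=x_0\in\mathbb R^n,$$ with deterministic bounded coefficients on $[0,T]$, control $u_c$ and disturbance $v$ both $\mathbb F$-progressively measurable and square-integrable ($\mathbb E\int_0^T|\cdot|^2dt<\infty$), and $$J^1(u_c,v;x_0)=\mathbb E\Big\{\int_0^T[\langle Q_1x,x\rangle+\langle R_cu_c,u_c\rangle]dt+\langle G_1x(T),x(T)\rangle\Big\},$$ $$J_v(u_c,v;x_0)=\mathbb E\Big\{\int_0^T[\gamma^2|v|^2-\langle Q_1x,x\rangle-\langle R_cu_c,u_c\rangle]dt-\langle G_1x(T),x(T)\rangle\Big\},$$ where $\gamma>0$ is the disturbance attenuation level. Here $u_c=\mathrm{col}[u_{11},u_{12},u_{211},u_{212},u_{213},u_{221},u_{222},u_{223},u_{311},u_{312},u_{321},u_{322},u_{331},u_{332}]$ stacks the controls of all players of the three levels, $B_c=[B_{11},B_{12},B_{211},\dots,B_{223},B_{311},\dots,B_{332}]$ and $D_c=[D_{11},D_{12},D_{211},\dots,D_{223},D_{311},\dots,D_{332}]$ are the corresponding stacked coefficients, and $R_c=\mathrm{blockdiag}(R_1,R_2,R_{111},R_{112},R_{113},R_{121},R_{122},R_{123},\bar R_{111},\bar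 R_{112},\bar R_{121},\bar R_{122},\bar R_{131},\bar R_{132})$, all weights being deterministic, bounded and symmetric. (A1) (relevant part) $Q_1(\cdot)\ge0$, $G_1\ge0$. (A2) (relevant part) all diagonal blocks of $R_c$ are $\ge\delta I$ for some $\delta>0$. $(u_c^*,v^* )$ is an open-loop Nash equilibrium if $J^1(u_c^*,v^*;x_0)\le J^1(u_c,v^*;x_0)$ and $J_v(u_c^*,v^*;x_0)\le J_v(u_c^*,v;x_0)$ for all square-integrable adapted $u_c,v$. *)

theory Defs
  imports "HOL-Probability.Probability"
begin

section \<open>Brownian motion and its augmented natural filtration\<close>

definition natural_filtration :: "'w measure \<Rightarrow> (real \<Rightarrow> 'w \<Rightarrow> real) \<Rightarrow> real \<Rightarrow> 'w measure" where
  "natural_filtration M W t =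
     sigma (space M) (\<Union>s\<in>{0..t}. {W s -` B \<inter> space M | B. B \<in> sets borel})"

definition brownian_motion :: "'w measure \<Rightarrow> (real \<Rightarrow> 'w \<Rightarrow> real) \<Rightarrow> bool" where
  "brownian_motion M W \<longleftrightarrow>
     prob_space M \<and>
     (\<forall>t\<ge>0. W t \<in> borel_measurable M) \<and>
     (AE \<omega> in M. W 0 \<omega> = 0) \<and>
     (AE \<omega> in M. continuous_on {0..} (\<lambda>t. W t \<omega>)) \<and>
     (\<forall>s\<ge>0. \<forall>t>s.
        distributed M lborel (\<lambda>\<omega>. W t \<omega> - W s \<omega>) (normal_density 0 (sqrt (t - s))) \<and>
        prob_space.indep_set M (sets (natural_filtration M W s))
          {(\<lambda>\<omega>. W t \<omega> - W s \<omega>) -` B \<inter> space M | B. B \<in> sets borel})"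

(* If M is complete, null_sets M already contains every subset of a null set, so this is the
   usual augmentation; completeness of M is not needed elsewhere and is not required. *)
definition augmented_filtration :: "'w measure \<Rightarrow> (real \<Rightarrow> 'w \<Rightarrow> real) \<Rightarrow> real \<Rightarrow> 'w measure" where
  "augmented_filtration M W t =
     sigma (space M) (sets (natural_filtration M W t) \<union> null_sets M)"

section \<open>Processes on [0,T]\<close>

definition prog_measurable ::
    "'w measure \<Rightarrow> (real \<Rightarrow> 'w \<Rightarrow> real) \<Rightarrow> real \<Rightarrow> (real \<Rightarrow> 'w \<Rightarrow> 'v::euclidean_space) \<Rightarrow> bool" where
  "prog_measurable M W T X \<longleftrightarrow>
     (\<forall>t\<in>{0..T}. (\<lambda>(s, \<omega>). X s \<omega>)
        \<in> borel_measurable (restrict_space borel {0..t} \<Otimes>\<^sub>M augmented_filtration M W t))"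

definition L2norm_sq :: "'w measure \<Rightarrow> real \<Rightarrow> (real \<Rightarrow> 'w \<Rightarrow> 'v::euclidean_space) \<Rightarrow> ennreal" where
  "L2norm_sq M T X =
     (\<integral>\<^sup>+ \<omega>. (\<integral>\<^sup>+ t\<in>{0..T}. ennreal ((norm (X t \<omega>))\<^sup>2) \<partial>lborel) \<partial>M)"

definition L2_prog ::
    "'w measure \<Rightarrow> (real \<Rightarrow> 'w \<Rightarrow> real) \<Rightarrow> real \<Rightarrow> (real \<Rightarrow> 'w \<Rightarrow> 'v::euclidean_space) \<Rightarrow> bool" where
  "L2_prog M W T X \<longleftrightarrow> prog_measurable M W T X \<and> L2norm_sq M T X < \<infinity>"

text \<open>Equality of processes on [0,T], almost everywhere with respect to dt times P.\<close>

definition eq_process ::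
    "'w measure \<Rightarrow> real \<Rightarrow> (real \<Rightarrow> 'w \<Rightarrow> 'v) \<Rightarrow> (real \<Rightarrow> 'w \<Rightarrow> 'v) \<Rightarrow> bool" where
  "eq_process M T X Y \<longleftrightarrow>
     (AE (t, \<omega>) in restrict_space lborel {0..T} \<Otimes>\<^sub>M M. X t \<omega> = Y t \<omega>)"

section \<open>The Ito integral\<close>

definition simple_data ::
    "'w measure \<Rightarrow> (real \<Rightarrow> 'w \<Rightarrow> real) \<Rightarrow> real \<Rightarrow> nat \<Rightarrow> (nat \<Rightarrow> real) \<Rightarrow>
     (nat \<Rightarrow> 'w \<Rightarrow> 'v::euclidean_space) \<Rightarrow> bool" where
  "simple_data M W T k \<tau> \<xi> \<longleftrightarrow>
     0 \<le> \<tau> 0 \<and> (\<forall>i<k. \<tau> i \<le> \<tau> (Suc i)) \<and> \<tau> k \<le> T \<and>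
     (\<forall>i<k. \<xi> i \<in> borel_measurable (augmented_filtration M W (\<tau> i))) \<and>
     (\<exists>K. \<forall>i<k. \<forall>\<omega>\<in>space M. norm (\<xi> i \<omega>) \<le> K)"

definition simple_process ::
    "nat \<Rightarrow> (nat \<Rightarrow> real) \<Rightarrow> (nat \<Rightarrow> 'w \<Rightarrow> 'v::euclidean_space) \<Rightarrow> real \<Rightarrow> 'w \<Rightarrow> 'v" where
  "simple_process k \<tau> \<xi> t \<omega> = (\<Sum>i<k. indicator {\<tau> i<..\<tau> (Suc i)} t *\<^sub>R \<xi> i \<omega>)"

definition simple_ito ::
    "(real \<Rightarrow> 'w \<Rightarrow> real) \<Rightarrow> nat \<Rightarrow> (nat \<Rightarrow> real) \<Rightarrow> (nat \<Rightarrow> 'w \<Rightarrow> 'v::euclidean_space) \<Rightarrow>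
     real \<Rightarrow> 'w \<Rightarrow> 'v" where
  "simple_ito W k \<tau> \<xi> t \<omega> =
     (\<Sum>i<k. (W (min (\<tau> (Suc i)) t) \<omega> - W (min (\<tau> i) t) \<omega>) *\<^sub>R \<xi> i \<omega>)"

text \<open>The process Y is (a continuous version of) the Ito integral of Z on [0,T]: the L2-limit
  of the integrals of simple processes approximating Z.\<close>

definition has_ito_integral ::
    "'w measure \<Rightarrow> (real \<Rightarrow> 'w \<Rightarrow> real) \<Rightarrow> real \<Rightarrow> (real \<Rightarrow> 'w \<Rightarrow> 'v::euclidean_space) \<Rightarrow>
     (real \<Rightarrow> 'w \<Rightarrow> 'v) \<Rightarrow> bool" where
  "has_ito_integral M W T Z Y \<longleftrightarrow>
     L2_prog M W T Z \<and>
     prog_measurable M W T Y \<and>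
     (AE \<omega> in M. continuous_on {0..T} (\<lambda>t. Y t \<omega>)) \<and>
     (\<exists>k \<tau> \<xi>. (\<forall>j. simple_data M W T (k j) (\<tau> j) (\<xi> j)) \<and>
        ((\<lambda>j. L2norm_sq M T (\<lambda>t \<omega>. Z t \<omega> - simple_process (k j) (\<tau> j) (\<xi> j) t \<omega>))
           \<longlonglongrightarrow> 0) \<and>
        (\<forall>t\<in>{0..T}.
           (\<lambda>j. \<integral>\<^sup>+ \<omega>. ennreal ((norm (Y t \<omega> - simple_ito W (k j) (\<tau> j) (\<xi> j) t \<omega>))\<^sup>2) \<partial>M)
             \<longlonglongrightarrow> 0))"

text \<open>The stochastic differential relation dX = b dt + s dW on [0,T].\<close>

definition has_ito_differential ::
    "'w measure \<Rightarrow> (real \<Rightarrow> 'w \<Rightarrow> real) \<Rightarrow> real \<Rightarrow> (real \<Rightarrow> 'w \<Rightarrow> 'v::euclidean_space) \<Rightarrow>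
     (real \<Rightarrow> 'w \<Rightarrow> 'v) \<Rightarrow> (real \<Rightarrow> 'w \<Rightarrow> 'v) \<Rightarrow> bool" where
  "has_ito_differential M W T X b s \<longleftrightarrow>
     prog_measurable M W T X \<and>
     (AE \<omega> in M. continuous_on {0..T} (\<lambda>t. X t \<omega>)) \<and>
     L2_prog M W T b \<and>
     (\<exists>Y. has_ito_integral M W T s Y \<and>
        (AE \<omega> in M. \<forall>t\<in>{0..T}.
           X t \<omega> = X 0 \<omega> + (LINT r:{0..t}|lborel. b r \<omega>) + Y t \<omega>))"

section \<open>Coefficients\<close>

definition bounded_coeff :: "real \<Rightarrow> (real \<Rightarrow> 'v::euclidean_space) \<Rightarrow> bool" where
  "bounded_coeff T f \<longleftrightarrow>
     f \<in> borel_measurable (restrict_space borel {0..T}) \<and> bounded (f ` {0..T})"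

definition symmetric_matrix :: "real^'n^'n \<Rightarrow> bool" where
  "symmetric_matrix S \<longleftrightarrow> transpose S = S"

definition pos_semidef :: "real^'n^'n \<Rightarrow> bool" where
  "pos_semidef S \<longleftrightarrow> symmetric_matrix S \<and> (\<forall>\<xi>. 0 \<le> \<xi> \<bullet> (S *v \<xi>))"

text \<open>The players of the three levels, named after their controls. A map blk from the coordinates
  of the stacked control to the players says which coordinates form the control of which player.
  The columns of the stacked coefficients with blk j = k are then the coefficient of player k
  (so that any matrix with these columns is such a stack), and the entries of the stacked weight
  with blk i = blk j = k are the weight of player k.\<close>

datatype player =
    U11 | U12
  | U211 | U212 | U213 | U221 | U222 | U223
  | U311 | U312 | U321 | U322 | U331 | U332

definition block_diagonal :: "('m \<Rightarrow> player) \<Rightarrow> real^'m^'m \<Rightarrow> bool" where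
  "block_diagonal blk R \<longleftrightarrow> (\<forall>i j. blk i \<noteq> blk j \<longrightarrow> R $ i $ j = 0)"

(* Vectors supported on the coordinates of player k are exactly the vectors on which the
   k-th diagonal block acts. *)
definition diag_block_ge :: "('m \<Rightarrow> player) \<Rightarrow> player \<Rightarrow> real \<Rightarrow> real^'m^'m \<Rightarrow> bool" where
  "diag_block_ge blk k \<delta> R \<longleftrightarrow>
     (\<forall>\<xi>. (\<forall>i. blk i \<noteq> k \<longrightarrow> \<xi> $ i = 0) \<longrightarrow> \<delta> * (\<xi> \<bullet> \<xi>) \<le> \<xi> \<bullet> (R *v \<xi>))"

section \<open>The controlled system, the costs and open-loop Nash equilibria\<close>

definition state_process ::
    "'w measure \<Rightarrow> (real \<Rightarrow> 'w \<Rightarrow> real) \<Rightarrow> real \<Rightarrow>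
     (real \<Rightarrow> real^'n^'n) \<Rightarrow> (real \<Rightarrow> real^'m^'n) \<Rightarrow> (real \<Rightarrow> real^'n^'n) \<Rightarrow> (real \<Rightarrow> real^'m^'n) \<Rightarrow>
     (real \<Rightarrow> real^'p^'n) \<Rightarrow> real^'n \<Rightarrow>
     (real \<Rightarrow> 'w \<Rightarrow> real^'m) \<Rightarrow> (real \<Rightarrow> 'w \<Rightarrow> real^'p) \<Rightarrow> (real \<Rightarrow> 'w \<Rightarrow> real^'n) \<Rightarrow> bool" where
  "state_process M W T A Bc C Dc E x0 u v x \<longleftrightarrow>
     L2_prog M W T x \<and>
     (AE \<omega> in M. x 0 \<omega> = x0) \<and>
     has_ito_differential M W T x
       (\<lambda>t \<omega>. A t *v x t \<omega> + Bc t *v u t \<omega> + E t *v v t \<omega>)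
       (\<lambda>t \<omega>. C t *v x t \<omega> + Dc t *v u t \<omega>)"

definition J1 ::
    "'w measure \<Rightarrow> real \<Rightarrow> (real \<Rightarrow> real^'n^'n) \<Rightarrow> (real \<Rightarrow> real^'m^'m) \<Rightarrow> real^'n^'n \<Rightarrow>
     (real \<Rightarrow> 'w \<Rightarrow> real^'n) \<Rightarrow> (real \<Rightarrow> 'w \<Rightarrow> real^'m) \<Rightarrow> real" where
  "J1 M T Q1 Rc G1 x u =
     (\<integral>\<omega>. (LINT t:{0..T}|lborel. (Q1 t *v x t \<omega>) \<bullet> x t \<omega> + (Rc t *v u t \<omega>) \<bullet> u t \<omega>)
          + (G1 *v x T \<omega>) \<bullet> x T \<omega> \<partial>M)"

definition Jv ::
    "'w measure \<Rightarrow> real \<Rightarrow> (real \<Rightarrow> real^'n^'n) \<Rightarrow> (real \<Rightarrow> real^'m^'m) \<Rightarrow> real^'n^'n \<Rightarrow> real \<Rightarrow>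
     (real \<Rightarrow> 'w \<Rightarrow> real^'n) \<Rightarrow> (real \<Rightarrow> 'w \<Rightarrow> real^'m) \<Rightarrow> (real \<Rightarrow> 'w \<Rightarrow> real^'p) \<Rightarrow> real" where
  "Jv M T Q1 Rc G1 \<gamma> x u v =
     (\<integral>\<omega>. (LINT t:{0..T}|lborel.
             \<gamma>\<^sup>2 * (norm (v t \<omega>))\<^sup>2 - (Q1 t *v x t \<omega>) \<bullet> x t \<omega> - (Rc t *v u t \<omega>) \<bullet> u t \<omega>)
          - (G1 *v x T \<omega>) \<bullet> x T \<omega> \<partial>M)"

(* The costs take the state as an argument. For bounded coefficients the state process of given
   square-integrable inputs exists and is unique up to indistinguishability, so quantifying over
   state processes is the same as evaluating the costs at the inputs. *)
definition open_loop_nash ::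
    "'w measure \<Rightarrow> (real \<Rightarrow> 'w \<Rightarrow> real) \<Rightarrow> real \<Rightarrow>
     (real \<Rightarrow> real^'n^'n) \<Rightarrow> (real \<Rightarrow> real^'m^'n) \<Rightarrow> (real \<Rightarrow> real^'n^'n) \<Rightarrow> (real \<Rightarrow> real^'m^'n) \<Rightarrow>
     (real \<Rightarrow> real^'p^'n) \<Rightarrow> (real \<Rightarrow> real^'n^'n) \<Rightarrow> (real \<Rightarrow> real^'m^'m) \<Rightarrow> real^'n^'n \<Rightarrow>
     real \<Rightarrow> real^'n \<Rightarrow> (real \<Rightarrow> 'w \<Rightarrow> real^'m) \<Rightarrow> (real \<Rightarrow> 'w \<Rightarrow> real^'p) \<Rightarrow> bool" where
  "open_loop_nash M W T A Bc C Dc E Q1 Rc G1 \<gamma> x0 us vs \<longleftrightarrow>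
     L2_prog M W T us \<and> L2_prog M W T vs \<and>
     (\<exists>xs. state_process M W T A Bc C Dc E x0 us vs xs \<and>
        (\<forall>u x. L2_prog M W T u \<and> state_process M W T A Bc C Dc E x0 u vs x \<longrightarrow>
           J1 M T Q1 Rc G1 xs us \<le> J1 M T Q1 Rc G1 x u) \<and>
        (\<forall>v x. L2_prog M W T v \<and> state_process M W T A Bc C Dc E x0 us v x \<longrightarrow>
           Jv M T Q1 Rc G1 \<gamma> xs us vs \<le> Jv M T Q1 Rc G1 \<gamma> x us v))"

section \<open>The optimality system and the Riccati equation\<close>

definition fbsde_solution ::
    "'w measure \<Rightarrow> (real \<Rightarrow> 'w \<Rightarrow> real) \<Rightarrow> real \<Rightarrow>
     (real \<Rightarrow> real^'n^'n) \<Rightarrow> (real \<Rightarrow> real^'m^'n) \<Rightarrow> (real \<Rightarrow> real^'n^'n) \<Rightarrow> (real \<Rightarrow> real^'m^'n) \<Rightarrow>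
     (real \<Rightarrow> real^'p^'n) \<Rightarrow> (real \<Rightarrow> real^'n^'n) \<Rightarrow> (real \<Rightarrow> real^'m^'m) \<Rightarrow> real^'n^'n \<Rightarrow>
     real \<Rightarrow> real^'n \<Rightarrow>
     (real \<Rightarrow> 'w \<Rightarrow> real^'n) \<Rightarrow> (real \<Rightarrow> 'w \<Rightarrow> real^'n) \<Rightarrow> (real \<Rightarrow> 'w \<Rightarrow> real^'n) \<Rightarrow> bool" where
  "fbsde_solution M W T A Bc C Dc E Q1 Rc G1 \<gamma> x0 x y z \<longleftrightarrow>
     L2_prog M W T x \<and> L2_prog M W T y \<and> L2_prog M W T z \<and>
     has_ito_differential M W T x
       (\<lambda>t \<omega>. A t *v x t \<omega>
          - (Bc t ** matrix_inv (Rc t) ** transpose (Bc t)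
               - (1 / \<gamma>\<^sup>2) *\<^sub>R (E t ** transpose (E t))) *v y t \<omega>
          - (Bc t ** matrix_inv (Rc t) ** transpose (Dc t)) *v z t \<omega>)
       (\<lambda>t \<omega>. C t *v x t \<omega>
          - (Dc t ** matrix_inv (Rc t) ** transpose (Bc t)) *v y t \<omega>
          - (Dc t ** matrix_inv (Rc t) ** transpose (Dc t)) *v z t \<omega>) \<and>
     has_ito_differential M W T y
       (\<lambda>t \<omega>. - (transpose (A t) *v y t \<omega> + transpose (C t) *v z t \<omega> + Q1 t *v x t \<omega>))
       z \<and>
     (AE \<omega> in M. x 0 \<omega> = x0) \<and>
     (AE \<omega> in M. y T \<omega> = G1 *v x T \<omega>)"

text \<open>The matrix I + P D inv(R) D^T at a fixed time.\<close>

definition riccati_K :: "real^'m^'n \<Rightarrow> real^'m^'m \<Rightarrow> real^'n^'n \<Rightarrow> real^'n^'n" where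
  "riccati_K D R P = mat 1 + P ** D ** matrix_inv R ** transpose D"

(* The coefficients are only bounded and measurable in time, so the equation is understood in the
   sense of Caratheodory, i.e. in integrated form; the second component of the conjunction
   is P' + F(t,P) = 0, P(T) = G1 integrated over [t,T]. Symmetry of P is not required. *)
definition riccati_solution ::
    "real \<Rightarrow>
     (real \<Rightarrow> real^'n^'n) \<Rightarrow> (real \<Rightarrow> real^'m^'n) \<Rightarrow> (real \<Rightarrow> real^'n^'n) \<Rightarrow> (real \<Rightarrow> real^'m^'n) \<Rightarrow>
     (real \<Rightarrow> real^'p^'n) \<Rightarrow> (real \<Rightarrow> real^'n^'n) \<Rightarrow> (real \<Rightarrow> real^'m^'m) \<Rightarrow> real^'n^'n \<Rightarrow>
     real \<Rightarrow> (real \<Rightarrow> real^'n^'n) \<Rightarrow> bool" where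
  "riccati_solution T A Bc C Dc E Q1 Rc G1 \<gamma> P \<longleftrightarrow>
     (let F = (\<lambda>t.
        let H = C t - Dc t ** matrix_inv (Rc t) ** transpose (Bc t) ** P t
        in P t ** A t + transpose (A t) ** P t
           - P t ** (Bc t ** matrix_inv (Rc t) ** transpose (Bc t)
                       - (1 / \<gamma>\<^sup>2) *\<^sub>R (E t ** transpose (E t))) ** P t
           + Q1 t
           + transpose H ** matrix_inv (riccati_K (Dc t) (Rc t) (P t)) ** P t ** H)
      in set_integrable lborel {0..T} F \<and>
         (\<forall>t\<in>{0..T}. P t = G1 + (LINT s:{t..T}|lborel. F s)))"

end

theory Submission
  imports Defs
begin

text \<open>The idea is to show that \<open>\<eta> = y - P x\<close> and \<open>\<zeta> = z - P (C x - D R\<inverse> B\<^sup>T y - D R\<inverse> D\<^sup>T z)\<close>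
  vanish. Since \<open>P\<close> solves the Riccati equation, \<open>(\<eta>, \<zeta>)\<close> solves a linear backward equation
  \<open>d\<eta> = g dt + \<zeta> dW\<close>, \<open>\<eta>(T) = 0\<close>, with \<open>|g| \<le> \<kappa> (|\<eta>| + |\<zeta>|)\<close>, provided that \<open>P\<close> is symmetric and
  \<open>(I + P D R\<inverse> D\<^sup>T)\<inverse>\<close> is bounded in time.

  Neither property is assumed. Both follow once \<open>P\<close> is known to be symmetric and positive
  semidefinite, and this propagates backwards from \<open>P(T) = G \<ge> 0\<close>: left of a time at which it holds,
  the inverse stays bounded by continuity, so \<open>P - P\<^sup>T\<close> solves a linear equation and vanishes, and
  positivity is not lost by a perturbation argument. The argument works for every \<open>\<gamma> \<ge> 1\<close>,
  whence the witness \<open>\<gamma>\<^sub>0 = 1\<close>.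

  The linear backward equation is treated without Ito's formula. If \<open>\<eta>(t') = 0\<close>, then
  \<open>\<eta>(t) + \<integral>\<^sub>t\<^sup>t\<^sup>' \<zeta> dW = - \<integral>\<^sub>t\<^sup>t\<^sup>' g ds\<close>, the two terms on the left are orthogonal, and the Ito isometry
  and Cauchy-Schwarz give \<open>E|\<eta>(t)|\<^sup>2 + E \<integral> |\<zeta>|\<^sup>2 \<le> c (t' - t) E \<integral> (|\<eta>|\<^sup>2 + |\<zeta>|\<^sup>2)\<close>, so that both
  vanish on short intervals, hence on \<open>[0, T]\<close>. The product rule for \<open>P x\<close> is obtained by freezing
  \<open>P\<close> on the intervals of a partition.\<close>

section \<open>Matrices\<close>

text \<open>Positivity supplies one: for \<open>P \<ge> 0\<close> and
  \<open>L = D R^-1 D^T \<ge> 0\<close> the matrix \<open>I + P L\<close> is bounded below by a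
  constant depending only on the norms of \<open>P\<close> and \<open>D\<close> and the coercivity
  of \<open>R\<close>. The bound near a time thus needs positivity at that time, symmetry needs the
  bound, and positivity further left needs both; hence the order of the local facts. The term with
  \<open>\<gamma>\<close> may make the quadratic term \<open>P S P\<close> of the Riccati equation
  indefinite. This term is small on vectors that \<open>P\<close> nearly annihilates, so positivity
  survives; \<open>\<gamma>\<close> matters only through \<open>\<gamma>^-2 \<le> 1\<close>. The Ito
  integral is an L2 limit of elementary integrals. Constant matrices pass through such a limit at
  once, a matrix depending on time does not, which is why \<open>P\<close> is frozen. As
  \<open>P\<close> is Lipschitz, the accumulated error over \<open>n\<close> pieces has mean square
  of order \<open>1/n\<close>.\<close>

declare transpose_matrix_vector [simp del]

text \<open>\<open>norm\<close> on matrices is the Frobenius norm, so Cauchy-Schwarz is applied row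
  by row. This norm serves throughout; it is invariant under transposition and
  submultiplicative.\<close>

lemma norm_matrix_vector_le: "norm (A *v x) \<le> norm A * norm x" for A :: "real^'n^'m"
proof -
  have "norm (A *v x) = L2_set (\<lambda>i. \<bar>A $ i \<bullet> x\<bar>) UNIV"
    by (simp add: norm_vec_def matrix_vector_mul_component)
  also have "\<dots> \<le> L2_set (\<lambda>i. norm (A $ i) * norm x) UNIV"
    by (intro L2_set_mono Cauchy_Schwarz_ineq2) auto
  also have "\<dots> = norm A * norm x"
    by (simp add: norm_vec_def[of A] L2_set_left_distrib)
  finally show ?thesis .
qed

lemma norm_transpose [simp]: "norm (transpose A) = norm A" for A :: "real^'n^'m"
proof -
  have "transpose A \<bullet> transpose A = A \<bullet> A"
    by (simp add: inner_vec_def transpose_def) (rule sum.swap)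
  then show ?thesis by (simp add: norm_eq_sqrt_inner)
qed

text \<open>A row of the product is \<open>transpose B\<close> applied to the same row of
  \<open>A\<close>, which reduces the claim to the bound for vectors.\<close>

lemma norm_matrix_matrix_le: "norm (A ** B) \<le> norm A * norm B" for A :: "real^'k^'m" and B :: "real^'n^'k"
proof -
  have row: "(A ** B) $ i = transpose B *v (A $ i)" for i
    by (simp add: vec_eq_iff matrix_matrix_mult_def matrix_vector_mult_def transpose_def mult.commute)
  have le: "norm (transpose B *v (A $ i)) \<le> norm (A $ i) * norm B" for i
    using norm_matrix_vector_le[of "transpose B" "A $ i"] by (simp add: mult.commute)
  have "norm (A ** B) \<le> L2_set (\<lambda>i. norm (A $ i) * norm B) UNIV"
    unfolding norm_vec_def[of "A ** B"] row by (intro L2_set_mono le) auto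
  also have "\<dots> = norm A * norm B"
    by (simp add: norm_vec_def[of A] L2_set_left_distrib)
  finally show ?thesis .
qed

lemma norm_matrix_mult_le_bound:
  "norm A \<le> a \<Longrightarrow> norm B \<le> c \<Longrightarrow> norm (A ** B) \<le> a * c" for A :: "real^'k^'m" and B :: "real^'n^'k"
  using norm_matrix_matrix_le[of A B] mult_mono[of "norm A" a "norm B" c] order_trans[OF norm_ge_zero, of A a]
  by (auto intro: order_trans)

lemma norm_matrix_vector_le_bound:
  "norm A \<le> a \<Longrightarrow> norm x \<le> c \<Longrightarrow> norm (A *v x) \<le> a * c" for A :: "real^'n^'m"
  using norm_matrix_vector_le[of A x] mult_mono[of "norm A" a "norm x" c] order_trans[OF norm_ge_zero, of A a]
  by (auto intro: order_trans)

lemma norm_add_le_bound: "norm x \<le> a \<Longrightarrow> norm y \<le> c \<Longrightarrow> norm (x + y) \<le> a + c"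
  using norm_triangle_ineq[of x y] by linarith

lemma norm_diff_le_bound: "norm x \<le> a \<Longrightarrow> norm y \<le> c \<Longrightarrow> norm (x - y) \<le> a + c"
  using norm_triangle_ineq4[of x y] by linarith

text \<open>Columns are images of unit vectors, and the Frobenius norm is at most the sum of their
  norms. This is meant for inverses, which are controlled only through inequalities on vectors; the
  number of columns is the price of the change of norm.\<close>

lemma norm_le_of_vector_bound:
  fixes A :: "real^'n^'m"
  assumes "\<And>x. norm (A *v x) \<le> c * norm x"
  shows "norm A \<le> real CARD('n) * c"
proof -
  have "norm A = norm (transpose A)" by simp
  also have "\<dots> \<le> (\<Sum>j\<in>UNIV. norm (transpose A $ j))"
    unfolding norm_vec_def[of "transpose A"] by (rule L2_set_le_sum) simp
  also have "\<dots> \<le> (\<Sum>j\<in>(UNIV::'n set). c)"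
  proof (intro sum_mono)
    fix j :: 'n
    have "transpose A $ j = A *v axis j 1"
      by (simp add: matrix_vector_mult_basis column_def transpose_def vec_eq_iff)
    then show "norm (transpose A $ j) \<le> c" using assms[of "axis j 1"] by simp
  qed
  finally show ?thesis by simp
qed

lemma inner_transpose: "x \<bullet> (A *v y) = (transpose A *v x) \<bullet> y" for A :: "real^'n^'m"
  using dot_lmul_matrix[of x A y] by (simp add: transpose_matrix_vector)

lemma transpose_add: "transpose (A + B) = transpose A + transpose B"
  by (simp add: transpose_def vec_eq_iff)

lemma transpose_minus: "transpose (A - B) = transpose A - transpose B" for A :: "real^'n^'m"
  by (simp add: transpose_def vec_eq_iff)

lemma matrix_inv_mult:
  fixes A :: "real^'n^'n"
  assumes "invertible A"
  shows "A ** matrix_inv A = mat 1" "matrix_inv A ** A = mat 1"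
proof -
  have "\<exists>A'. A ** A' = mat 1 \<and> A' ** A = mat 1"
    using assms by (simp add: invertible_def)
  then have "A ** matrix_inv A = mat 1 \<and> matrix_inv A ** A = mat 1"
    unfolding matrix_inv_def by (rule someI_ex)
  then show "A ** matrix_inv A = mat 1" "matrix_inv A ** A = mat 1" by auto
qed

lemma matrix_inv_vector:
  fixes A :: "real^'n^'n"
  assumes "invertible A"
  shows "A *v (matrix_inv A *v v) = v" "matrix_inv A *v (A *v v) = v"
  using matrix_inv_mult[OF assms] by (simp_all add: matrix_vector_mul_assoc)

lemma matrix_mult_diff_distrib:
  fixes A A' :: "real^'k^'m" and B B' :: "real^'n^'k"
  shows "A ** (B - B') = A ** B - A ** B'" "(A - A') ** B = A ** B - A' ** B"
  by (simp_all add: matrix_matrix_mult_def vec_eq_iff algebra_simps sum_subtractf)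

lemma matrix_add_rdistrib: "(A + A') ** B = A ** B + A' ** B" for A A' :: "real^'k^'m"
  by (simp add: matrix_matrix_mult_def vec_eq_iff algebra_simps sum.distrib)

text \<open>The bound makes the kernel trivial, which suffices in finite dimension; putting
  \<open>v = matrix_inv A *v w\<close> turns it into a bound for the inverse with the same
  constant.\<close>

lemma invertible_of_lower_bound:
  fixes A :: "real^'n^'n"
  assumes "\<And>v. norm v \<le> c * norm (A *v v)"
  shows "invertible A" "norm (matrix_inv A *v w) \<le> c * norm w"
proof -
  have "v = 0" if "A *v v = 0" for v using assms[of v] that by simp
  then show inv: "invertible A"
    by (simp add: invertible_left_inverse matrix_left_invertible_ker)
  show "norm (matrix_inv A *v w) \<le> c * norm w"
    using assms[of "matrix_inv A *v w"] matrix_inv_vector[OF inv] by simp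
qed

lemma coercive_matrix_inv:
  fixes R :: "real^'m^'m"
  assumes "\<delta> > 0" and co: "\<And>\<xi>. \<delta> * (\<xi> \<bullet> \<xi>) \<le> \<xi> \<bullet> (R *v \<xi>)"
  shows "invertible R" "\<delta> * (norm (matrix_inv R *v v))\<^sup>2 \<le> (matrix_inv R *v v) \<bullet> v"
    "norm (matrix_inv R *v v) \<le> norm v / \<delta>"
proof -
  have lb: "norm \<xi> \<le> (1 / \<delta>) * norm (R *v \<xi>)" for \<xi>
  proof (cases "\<xi> = 0")
    case False
    have "\<delta> * (norm \<xi> * norm \<xi>) \<le> norm \<xi> * norm (R *v \<xi>)"
      using co[of \<xi>] norm_cauchy_schwarz[of \<xi> "R *v \<xi>"]
      by (simp add: dot_square_norm power2_eq_square)
    then have "\<delta> * norm \<xi> \<le> norm (R *v \<xi>)" using False by (simp add: mult.left_commute)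
    then show ?thesis using \<open>\<delta> > 0\<close> by (simp add: field_simps)
  qed simp
  show inv: "invertible R" by (rule invertible_of_lower_bound(1)[OF lb])
  show "\<delta> * (norm (matrix_inv R *v v))\<^sup>2 \<le> (matrix_inv R *v v) \<bullet> v"
    using co[of "matrix_inv R *v v"] by (simp add: matrix_inv_vector[OF inv] dot_square_norm)
  show "norm (matrix_inv R *v v) \<le> norm v / \<delta>"
    using invertible_of_lower_bound(2)[OF lb, of v] by simp
qed

lemma matrix_inv_symmetric:
  fixes R :: "real^'m^'m"
  assumes "invertible R" "transpose R = R"
  shows "transpose (matrix_inv R) = matrix_inv R"
proof -
  have "transpose (matrix_inv R) ** R = mat 1"
    using matrix_inv_mult(1)[OF assms(1)] assms(2) by (metis matrix_transpose_mul transpose_mat)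
  then have "transpose (matrix_inv R) ** R ** matrix_inv R = matrix_inv R" by simp
  then show ?thesis
    using matrix_inv_mult(1)[OF assms(1)] by (simp add: matrix_mul_assoc[symmetric])
qed

text \<open>The vector is split into its components in the control spaces of the players. Mixed
  terms vanish because the off-diagonal blocks do, so both quadratic forms are sums over the players
  and the block bounds add up with the same constant.\<close>

lemma block_diagonal_coercive:
  fixes R :: "real^'m^'m" and blk :: "'m \<Rightarrow> player"
  assumes bd: "block_diagonal blk R" and ge: "\<And>k. diag_block_ge blk k \<delta> R"
  shows "\<delta> * (\<xi> \<bullet> \<xi>) \<le> \<xi> \<bullet> (R *v \<xi>)"
proof -
  define \<xi>k where "\<xi>k k = (\<chi> i. if blk i = k then \<xi> $ i else 0)" for k
  \<comment> \<open>Each coordinate belongs to exactly one player, so the sum selects one term. Read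
    from right to left, this inserts the sum over the players.\<close>
  have ii: "(\<Sum>k\<in>range blk. if blk i = k then a else 0) = a" for i and a :: real
    by simp
  have "\<xi> \<bullet> \<xi> = (\<Sum>i\<in>UNIV. \<Sum>k\<in>range blk. if blk i = k then \<xi> $ i * \<xi> $ i else 0)"
    unfolding ii by (simp add: inner_vec_def)
  also have "\<dots> = (\<Sum>k\<in>range blk. \<xi>k k \<bullet> \<xi>k k)"
    unfolding inner_vec_def \<xi>k_def
    by (subst sum.swap) (auto intro!: sum.cong)
  finally have n: "\<xi> \<bullet> \<xi> = (\<Sum>k\<in>range blk. \<xi>k k \<bullet> \<xi>k k)" .
  have "\<xi> \<bullet> (R *v \<xi>) = (\<Sum>i\<in>UNIV. \<Sum>j\<in>UNIV. \<xi> $ i * (R $ i $ j * \<xi> $ j))"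
    by (simp add: inner_vec_def matrix_vector_mult_def sum_distrib_left)
  also have "\<dots> = (\<Sum>i\<in>UNIV. \<Sum>j\<in>UNIV. \<Sum>k\<in>range blk. \<xi>k k $ i * (R $ i $ j * \<xi>k k $ j))"
  proof (intro sum.cong refl)
    fix i j
    have "(\<Sum>k\<in>range blk. \<xi>k k $ i * (R $ i $ j * \<xi>k k $ j)) =
        (\<Sum>k\<in>range blk. if blk i = k then \<xi> $ i * (R $ i $ j * \<xi> $ j) else 0)"
    proof (intro sum.cong refl)
      fix k
      show "\<xi>k k $ i * (R $ i $ j * \<xi>k k $ j) = (if blk i = k then \<xi> $ i * (R $ i $ j * \<xi> $ j) else 0)"
        using bd by (auto simp: \<xi>k_def block_diagonal_def)
    qed
    then show "\<xi> $ i * (R $ i $ j * \<xi> $ j) = (\<Sum>k\<in>range blk. \<xi>k k $ i * (R $ i $ j * \<xi>k k $ j))"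
      by (simp only: ii)
  qed
  also have "\<dots> = (\<Sum>i\<in>UNIV. \<Sum>k\<in>range blk. \<Sum>j\<in>UNIV. \<xi>k k $ i * (R $ i $ j * \<xi>k k $ j))"
    by (intro sum.cong refl sum.swap)
  also have "\<dots> = (\<Sum>k\<in>range blk. \<Sum>i\<in>UNIV. \<Sum>j\<in>UNIV. \<xi>k k $ i * (R $ i $ j * \<xi>k k $ j))"
    by (rule sum.swap)
  also have "\<dots> = (\<Sum>k\<in>range blk. \<xi>k k \<bullet> (R *v \<xi>k k))"
    by (simp add: inner_vec_def matrix_vector_mult_def sum_distrib_left)
  also have "\<dots> \<ge> (\<Sum>k\<in>range blk. \<delta> * (\<xi>k k \<bullet> \<xi>k k))"
  proof (rule sum_mono)
    fix k
    show "\<delta> * (\<xi>k k \<bullet> \<xi>k k) \<le> \<xi>k k \<bullet> (R *v \<xi>k k)"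
      using ge[of k] by (auto simp: diag_block_ge_def \<xi>k_def)
  qed
  finally show ?thesis by (simp add: n sum_distrib_left)
qed

section \<open>Symmetric positive semidefinite matrices\<close>

definition sym_psd :: "real^'n^'n \<Rightarrow> bool" where
  "sym_psd p \<longleftrightarrow> transpose p = p \<and> (\<forall>\<xi>. 0 \<le> \<xi> \<bullet> (p *v \<xi>))"

lemma bounded_linear_quadratic: "bounded_linear (\<lambda>p :: real^'n^'n. \<xi> \<bullet> (p *v \<xi>))"
proof
  show "\<exists>K. \<forall>p::real^'n^'n. norm (\<xi> \<bullet> (p *v \<xi>)) \<le> norm p * K"
  proof (intro exI allI)
    fix p :: "real^'n^'n"
    have "norm (\<xi> \<bullet> (p *v \<xi>)) \<le> norm \<xi> * norm (p *v \<xi>)" by (simp add: Cauchy_Schwarz_ineq2)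
    also have "\<dots> \<le> norm \<xi> * (norm p * norm \<xi>)"
      by (intro mult_left_mono norm_matrix_vector_le) simp
    finally show "norm (\<xi> \<bullet> (p *v \<xi>)) \<le> norm p * (norm \<xi> * norm \<xi>)" by (simp add: mult_ac)
  qed
qed (simp_all add: matrix_vector_mult_add_rdistrib inner_add_right flip: scaleR_matrix_vector_assoc)

lemma bounded_linear_transpose: "bounded_linear (transpose :: real^'n^'m \<Rightarrow> real^'m^'n)"
proof
  show "\<exists>K. \<forall>p::real^'n^'m. norm (transpose p) \<le> norm p * K" by (rule exI[of _ 1]) simp
qed (simp_all add: transpose_add transpose_scalar)

lemma quadratic_perturb:
  fixes p q :: "real^'n^'n"
  shows "\<bar>\<xi> \<bullet> (p *v \<xi>) - \<xi> \<bullet> (q *v \<xi>)\<bar> \<le> norm (p - q) * (norm \<xi>)\<^sup>2"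
proof -
  have "\<xi> \<bullet> (p *v \<xi>) - \<xi> \<bullet> (q *v \<xi>) = \<xi> \<bullet> ((p - q) *v \<xi>)"
    by (simp add: matrix_vector_mult_diff_rdistrib inner_diff_right)
  also have "\<bar>\<dots>\<bar> \<le> norm \<xi> * norm ((p - q) *v \<xi>)" by (rule Cauchy_Schwarz_ineq2)
  also have "\<dots> \<le> norm \<xi> * (norm (p - q) * norm \<xi>)"
    by (intro mult_left_mono norm_matrix_vector_le) simp
  finally show ?thesis by (simp add: power2_eq_square mult_ac)
qed

lemma closed_sym_psd: "closed {p :: real^'n^'n. sym_psd p}"
proof -
  have "{p :: real^'n^'n. sym_psd p} = {p. transpose p = p} \<inter> (\<Inter>\<xi>. {p. 0 \<le> \<xi> \<bullet> (p *v \<xi>)})"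
    by (auto simp: sym_psd_def)
  moreover have "closed {p :: real^'n^'n. transpose p = p}"
    by (intro closed_Collect_eq bounded_linear.continuous_on[OF bounded_linear_transpose] continuous_intros)
  moreover have "closed {p :: real^'n^'n. 0 \<le> \<xi> \<bullet> (p *v \<xi>)}" for \<xi>
    by (intro closed_Collect_le bounded_linear.continuous_on[OF bounded_linear_quadratic] continuous_intros)
  ultimately show ?thesis by (auto intro!: closed_INT)
qed

text \<open>The cone is closed, so positivity passes from an open interval to its left end. It is
  applied at the supremum of a set of bad times, where positivity is at first known only strictly to
  the right.\<close>

lemma sym_psd_right_limit:
  fixes p :: "real \<Rightarrow> real^'n^'n"
  assumes cont: "continuous_on {u..v} p" and uv: "u < v"
    and psd: "\<And>s. s \<in> {u<..<v} \<Longrightarrow> sym_psd (p s)"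
  shows "sym_psd (p u)"
proof -
  have "closed ({u..v} \<inter> p -` {q. sym_psd q})"
    by (rule continuous_closed_preimage[OF cont closed_atLeastAtMost closed_sym_psd])
  moreover have "{u<..<v} \<subseteq> {u..v} \<inter> p -` {q. sym_psd q}" using psd by auto
  ultimately have "closure {u<..<v} \<subseteq> {u..v} \<inter> p -` {q. sym_psd q}"
    by (rule closure_minimal[rotated])
  moreover have "u \<in> closure {u<..<v}" using uv by (simp add: closure_greaterThanLessThan)
  ultimately show ?thesis by blast
qed

text \<open>A nonnegative form is minimal at \<open>\<xi>\<close>, so its gradient
  \<open>2 p \<xi>\<close> must vanish there. Concretely, a small step from \<open>\<xi>\<close> in
  the direction \<open>- p \<xi>\<close> would make the form negative.\<close>

lemma sym_psd_kernel:
  fixes p :: "real^'n^'n"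
  assumes "sym_psd p" "\<xi> \<bullet> (p *v \<xi>) = 0"
  shows "p *v \<xi> = 0"
proof (rule ccontr)
  assume ne: "p *v \<xi> \<noteq> 0"
  define v where "v = p *v \<xi>"
  define k where "k = v \<bullet> (p *v v)"
  have s: "\<xi> \<bullet> (p *v v) = v \<bullet> v"
    using inner_transpose[of \<xi> p v] assms(1) by (simp add: sym_psd_def v_def)
  have "0 < v \<bullet> v" using ne by (simp add: v_def)
  have k0: "k \<ge> 0" using assms(1) by (simp add: sym_psd_def k_def)
  \<comment> \<open>Any step length with \<open>0 < a\<close> and
    \<open>a * k < 2 * (v \<bullet> v)\<close> decreases the form below zero; the \<open>+ 1\<close>
    covers the case \<open>k = 0\<close>.\<close>
  define a where "a = (v \<bullet> v) / (k + 1)"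
  have a: "a > 0" "a * k < 2 * (v \<bullet> v)"
  proof -
    show pos: "a > 0" using k0 \<open>0 < v \<bullet> v\<close> by (simp add: a_def)
    have "a * (k + 1) = v \<bullet> v" using k0 by (simp add: a_def)
    then have "a * k = v \<bullet> v - a" by (simp add: algebra_simps)
    then show "a * k < 2 * (v \<bullet> v)" using pos \<open>0 < v \<bullet> v\<close> by linarith
  qed
  have "0 \<le> (\<xi> - a *\<^sub>R v) \<bullet> (p *v (\<xi> - a *\<^sub>R v))" using assms(1) by (simp add: sym_psd_def)
  also have "\<dots> = - 2 * a * (v \<bullet> v) + a * (a * k)"
    using assms(2) s by (simp add: matrix_vector_mult_diff_distrib matrix_vector_mult_scaleR
        inner_diff_left inner_diff_right k_def v_def[symmetric] inner_commute algebra_simps)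
  also have "\<dots> = a * (a * k - 2 * (v \<bullet> v))" by (simp add: algebra_simps)
  also have "\<dots> < 0" using a by (simp add: mult_pos_neg)
  finally show False by simp
qed

text \<open>Going backwards from \<open>v\<close>, the point \<open>s1\<close> is the supremum of
  the failures. Were \<open>p s1\<close> positive definite, positivity would persist in a
  neighbourhood, which contains failures; hence some unit vector gives a value at most 0. By
  closedness \<open>p s1\<close> is still semidefinite, so that value is exactly 0.\<close>

lemma psd_first_failure:
  fixes p :: "real \<Rightarrow> real^'n^'n"
  assumes cont: "continuous_on {u..v} p" and uv: "u \<le> v"
    and sym: "\<And>s. s \<in> {u..v} \<Longrightarrow> transpose (p s) = p s"
    and fin: "\<And>\<xi>. norm \<xi> = 1 \<Longrightarrow> 0 < \<xi> \<bullet> (p v *v \<xi>)"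
    and fail: "s0 \<in> {u..v}" "\<not> sym_psd (p s0)"
  obtains s1 \<xi> where "s1 \<in> {u..<v}" "norm \<xi> = 1" "\<xi> \<bullet> (p s1 *v \<xi>) = 0"
    "\<And>s. s \<in> {s1..v} \<Longrightarrow> sym_psd (p s)"
proof -
  define B where "B = {s \<in> {u..v}. \<not> sym_psd (p s)}"
  define s1 where "s1 = Sup B"
  have B: "B \<noteq> {}" "bdd_above B" "s0 \<in> B" using fail by (auto simp: B_def)
  have s1: "s1 \<in> {u..v}"
    using cSup_upper[OF B(3,2)] cSup_least[OF B(1), of v] fail by (auto simp: s1_def B_def)
  have right: "sym_psd (p s)" if "s \<in> {s1<..v}" for s
  proof (rule ccontr)
    assume "\<not> sym_psd (p s)"
    then have "s \<in> B" using that s1 by (simp add: B_def)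
    then show False using cSup_upper[OF _ B(2), of s] that by (simp add: s1_def)
  qed
  have near: "\<exists>\<xi>. norm \<xi> = 1 \<and> \<xi> \<bullet> (p s1 *v \<xi>) \<le> 0"
  proof (rule ccontr)
    assume "\<not> ?thesis"
    then have pos: "0 < \<xi> \<bullet> (p s1 *v \<xi>)" if "norm \<xi> = 1" for \<xi> using that by (meson not_le)
    have "continuous_on (sphere 0 1) (\<lambda>\<xi>. \<xi> \<bullet> (p s1 *v \<xi>))"
      by (intro continuous_intros linear_continuous_on matrix_vector_mul_bounded_linear)
    moreover have "sphere (0::real^'n) 1 \<noteq> {}" by simp
    ultimately obtain \<xi>0 where \<xi>0: "\<xi>0 \<in> sphere 0 1" "\<And>\<xi>. \<xi> \<in> sphere 0 1 \<Longrightarrow> \<xi>0 \<bullet> (p s1 *v \<xi>0) \<le> \<xi> \<bullet> (p s1 *v \<xi>)"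
      using continuous_attains_inf[OF compact_sphere, of 0 1 "\<lambda>\<xi>. \<xi> \<bullet> (p s1 *v \<xi>)"] by blast
    \<comment> \<open>The minimum of the form over the unit sphere. Compactness turns strict
      positivity at \<open>s1\<close> into a margin \<open>c\<close>, which absorbs every
      perturbation of \<open>p\<close> of norm less than \<open>c\<close>.\<close>
    define c where "c = \<xi>0 \<bullet> (p s1 *v \<xi>0)"
    have c: "c > 0" using pos[of \<xi>0] \<xi>0 by (simp add: c_def)
    have quad: "c * (norm \<xi>)\<^sup>2 \<le> \<xi> \<bullet> (p s1 *v \<xi>)" for \<xi>
    proof (cases "\<xi> = 0")
      case False
      have "c \<le> ((1 / norm \<xi>) *\<^sub>R \<xi>) \<bullet> (p s1 *v ((1 / norm \<xi>) *\<^sub>R \<xi>))"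
        unfolding c_def by (rule \<xi>0(2)) (use False in simp)
      also have "\<dots> = (\<xi> \<bullet> (p s1 *v \<xi>)) / (norm \<xi>)\<^sup>2"
        by (simp add: matrix_vector_mult_scaleR power2_eq_square)
      finally show ?thesis using False by (simp add: field_simps)
    qed simp
    obtain d where d: "d > 0" "\<And>s. s \<in> {u..v} \<Longrightarrow> dist s s1 < d \<Longrightarrow> dist (p s) (p s1) < c"
      using cont s1 c unfolding continuous_on_iff by metis
    have ok: "sym_psd (p s)" if "s \<in> {u..v}" "dist s s1 < d" for s
      unfolding sym_psd_def
    proof (intro conjI allI)
      fix \<xi> :: "real^'n"
      have "norm (p s - p s1) * (norm \<xi>)\<^sup>2 \<le> c * (norm \<xi>)\<^sup>2"
        using d(2)[OF that] by (intro mult_right_mono) (auto simp: dist_norm)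
      then show "0 \<le> \<xi> \<bullet> (p s *v \<xi>)"
        using quad[of \<xi>] quadratic_perturb[of \<xi> "p s" "p s1"] by linarith
    qed (rule sym[OF that(1)])
    obtain b where b: "b \<in> B" "s1 - d < b"
      using less_cSup_iff[OF B(1,2), of "s1 - d"] d(1) by (auto simp: s1_def)
    have "b \<le> s1" using cSup_upper[OF b(1) B(2)] by (simp add: s1_def)
    then have "sym_psd (p b)" using b by (intro ok) (auto simp: B_def dist_real_def)
    then show False using b by (simp add: B_def)
  qed
  then obtain \<xi> where \<xi>: "norm \<xi> = 1" "\<xi> \<bullet> (p s1 *v \<xi>) \<le> 0" by auto
  have "s1 \<noteq> v" using \<xi> fin by force
  then have lt: "s1 \<in> {u..<v}" using s1 by auto
  have "continuous_on {s1..v} p" by (rule continuous_on_subset[OF cont]) (use s1 in simp)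
  then have "sym_psd (p s1)" by (rule sym_psd_right_limit) (use lt right in auto)
  then have all: "sym_psd (p s)" if "s \<in> {s1..v}" for s
    using that right[of s] by (cases "s = s1") auto
  have "\<xi> \<bullet> (p s1 *v \<xi>) = 0" using \<xi>(2) \<open>sym_psd (p s1)\<close> by (simp add: sym_psd_def order_antisym)
  then show ?thesis using that[OF lt \<xi>(1)] all by blast
qed

section \<open>The Riccati equation\<close>

definition riccati_L :: "real^'m^'n \<Rightarrow> real^'m^'m \<Rightarrow> real^'n^'n" where
  "riccati_L D R = D ** matrix_inv R ** transpose D"

lemma riccati_K_L: "riccati_K D R P = mat 1 + P ** riccati_L D R"
  by (simp add: riccati_K_def riccati_L_def matrix_mul_assoc)

text \<open>With \<open>a = R^-1 D^T v\<close> the form equals \<open>a \<bullet> R a\<close>, and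
  coercivity of \<open>R\<close> applies. The quantitative version keeps \<open>a\<close> under
  control, which the lower bound on \<open>riccati_K\<close> needs beyond mere
  nonnegativity.\<close>

lemma riccati_L_inner:
  fixes D :: "real^'m^'n"
  assumes "\<delta> > 0" and co: "\<And>\<xi>. \<delta> * (\<xi> \<bullet> \<xi>) \<le> \<xi> \<bullet> (R *v \<xi>)"
  shows "\<delta> * (norm (matrix_inv R *v (transpose D *v v)))\<^sup>2 \<le> v \<bullet> (riccati_L D R *v v)"
    "0 \<le> v \<bullet> (riccati_L D R *v v)"
proof -
  have "v \<bullet> (riccati_L D R *v v) = (transpose D *v v) \<bullet> (matrix_inv R *v (transpose D *v v))"
    unfolding riccati_L_def matrix_vector_mul_assoc[symmetric] by (rule inner_transpose)
  then show 1: "\<delta> * (norm (matrix_inv R *v (transpose D *v v)))\<^sup>2 \<le> v \<bullet> (riccati_L D R *v v)"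
    using coercive_matrix_inv(2)[OF assms, of "transpose D *v v"] by (simp add: inner_commute)
  show "0 \<le> v \<bullet> (riccati_L D R *v v)" by (rule order_trans[OF _ 1]) (use \<open>\<delta> > 0\<close> in simp)
qed

text \<open>With \<open>w = K v\<close> and \<open>u = L v = D a\<close> one has
  \<open>w = v + p u\<close>. Pairing with \<open>u\<close> and dropping
  \<open>u \<bullet> p u \<ge> 0\<close> gives \<open>\<delta> |a|^2 \<le> v \<bullet> u \<le> u
  \<bullet> w = a \<bullet> D^T w\<close>. So \<open>a\<close> is bounded by \<open>w\<close>, and
  then \<open>v = w - p D a\<close> is as well.\<close>

lemma riccati_K_lower_bound_psd:
  fixes D :: "real^'m^'n"
  assumes \<delta>: "\<delta> > 0" and co: "\<And>\<xi>. \<delta> * (\<xi> \<bullet> \<xi>) \<le> \<xi> \<bullet> (R *v \<xi>)"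
    and p: "\<And>\<xi>. 0 \<le> \<xi> \<bullet> (p *v \<xi>)"
  shows "norm v \<le> (1 + norm p * norm D * norm D / \<delta>) * norm (riccati_K D R p *v v)"
proof -
  define w where "w = riccati_K D R p *v v"
  define u where "u = riccati_L D R *v v"
  define a where "a = matrix_inv R *v (transpose D *v v)"
  have u: "u = D *v a" by (simp add: u_def a_def riccati_L_def matrix_vector_mul_assoc matrix_mul_assoc)
  have w: "w = v + p *v u"
    by (simp add: w_def u_def riccati_K_L matrix_vector_mult_add_rdistrib matrix_vector_mul_assoc)
  have "\<delta> * (norm a)\<^sup>2 \<le> v \<bullet> u" unfolding a_def u_def by (rule riccati_L_inner(1)[OF \<delta> co])
  also have "\<dots> \<le> u \<bullet> w" using p[of u] by (simp add: w inner_add_right inner_commute)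
  also have "\<dots> = a \<bullet> (transpose D *v w)" by (simp add: u inner_commute[of "D *v a"] inner_transpose)
  also have "\<dots> \<le> norm a * (norm D * norm w)"
    using norm_matrix_vector_le[of "transpose D" w]
    by (intro order_trans[OF norm_cauchy_schwarz[of a "transpose D *v w"]] mult_left_mono) auto
  finally have *: "\<delta> * norm a * norm a \<le> norm a * (norm D * norm w)" by (simp add: power2_eq_square)
  have "\<delta> * norm a \<le> norm D * norm w"
  proof (cases "a = 0")
    case False
    then show ?thesis using * by (simp add: mult.commute)
  qed simp
  then have a: "norm a \<le> norm D * norm w / \<delta>" using \<delta> by (simp add: field_simps)
  have "norm (p *v u) \<le> norm p * (norm D * (norm D * norm w / \<delta>))"
    unfolding u by (intro norm_matrix_vector_le_bound a order_refl)
  moreover have "v = w - p *v u" by (simp add: w)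
  ultimately have "norm v \<le> norm w + norm p * (norm D * (norm D * norm w / \<delta>))"
    using norm_triangle_ineq4[of w "p *v u"] by simp
  then show ?thesis by (simp add: w_def[symmetric] algebra_simps)
qed

text \<open>A Neumann type perturbation: the change of \<open>K v\<close> is
  \<open>(p' - p) L v\<close>, and the smallness condition lets half of the norm of \<open>v\<close>
  absorb it. It carries the bound from a semidefinite \<open>p\<close> to a nearby \<open>p'\<close>
  whose sign is still unknown.\<close>

lemma riccati_K_lower_bound_near:
  fixes D :: "real^'m^'n"
  assumes c: "\<And>v. norm v \<le> c * norm (riccati_K D R p *v v)"
    and small: "c * norm (p' - p) * norm (riccati_L D R) \<le> 1 / 2" "c \<ge> 0"
  shows "norm v \<le> 2 * c * norm (riccati_K D R p' *v v)"
proof -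
  have "riccati_K D R p *v v = riccati_K D R p' *v v - (p' - p) *v (riccati_L D R *v v)"
    by (simp add: riccati_K_L matrix_vector_mult_add_rdistrib matrix_vector_mult_diff_rdistrib
        matrix_vector_mul_assoc matrix_mult_diff_distrib algebra_simps)
  then have "norm (riccati_K D R p *v v) \<le>
      norm (riccati_K D R p' *v v) + norm (p' - p) * (norm (riccati_L D R) * norm v)"
    by (simp only:) (intro norm_diff_le_bound norm_matrix_vector_le_bound order_refl)
  from mult_left_mono[OF this \<open>c \<ge> 0\<close>] c[of v]
  have "norm v \<le> c * norm (riccati_K D R p' *v v) + c * norm (p' - p) * norm (riccati_L D R) * norm v"
    by (simp add: algebra_simps)
  moreover have "c * norm (p' - p) * norm (riccati_L D R) * norm v \<le> 1 / 2 * norm v"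
    using small by (intro mult_right_mono) auto
  ultimately show ?thesis by simp
qed

definition riccati_H :: "real^'m^'n \<Rightarrow> real^'n^'n \<Rightarrow> real^'m^'n \<Rightarrow> real^'m^'m \<Rightarrow> real^'n^'n \<Rightarrow> real^'n^'n" where
  "riccati_H B C D R P = C - D ** matrix_inv R ** transpose B ** P"

definition riccati_S :: "real^'m^'n \<Rightarrow> real^'p^'n \<Rightarrow> real^'m^'m \<Rightarrow> real \<Rightarrow> real^'n^'n" where
  "riccati_S B E R \<gamma> = B ** matrix_inv R ** transpose B - (1 / \<gamma>\<^sup>2) *\<^sub>R (E ** transpose E)"

definition riccati_F where
  "riccati_F A B C D E Q R \<gamma> P = P ** A + transpose A ** P - P ** riccati_S B E R \<gamma> ** P + Q
     + transpose (riccati_H B C D R P) ** matrix_inv (riccati_K D R P) ** P ** riccati_H B C D R P"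

lemma norm_riccati_bounds:
  fixes A C Q P :: "real^'n^'n" and B D :: "real^'m^'n" and E :: "real^'p^'n" and R :: "real^'m^'m"
  assumes c: "norm A \<le> c" "norm B \<le> c" "norm C \<le> c" "norm D \<le> c" "norm E \<le> c" "norm Q \<le> c"
    "norm (matrix_inv R) \<le> c" "norm P \<le> c" and \<gamma>: "\<gamma> \<ge> 1"
  shows "norm (riccati_L D R) \<le> c * c * c"
    "norm (riccati_S B E R \<gamma>) \<le> c * c * c + c * c"
    "norm (riccati_H B C D R P) \<le> c + c * c * c * c"
    "norm (matrix_inv (riccati_K D R P)) \<le> c \<Longrightarrow> norm (riccati_F A B C D E Q R \<gamma> P) \<le>
       c * c + c * c + c * (c * c * c + c * c) * c + c + (c + c * c * c * c) * c * c * (c + c * c * c * c)"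
proof -
  show "norm (riccati_L D R) \<le> c * c * c"
    unfolding riccati_L_def using c by (intro norm_matrix_mult_le_bound) auto
  \<comment> \<open>Here \<open>\<gamma> \<ge> 1\<close> enters: the factor
    \<open>1 / \<gamma>^2\<close> is at most 1, so the bounds do not involve
    \<open>\<gamma>\<close>.\<close>
  have "norm ((1 / \<gamma>\<^sup>2) *\<^sub>R (E ** transpose E)) \<le> 1 * (c * c)"
    unfolding norm_scaleR using \<gamma> c
    by (intro mult_mono norm_matrix_mult_le_bound) auto
  then show S: "norm (riccati_S B E R \<gamma>) \<le> c * c * c + c * c"
    unfolding riccati_S_def using c by (intro norm_diff_le_bound norm_matrix_mult_le_bound) auto
  show H: "norm (riccati_H B C D R P) \<le> c + c * c * c * c"
    unfolding riccati_H_def using c by (intro norm_diff_le_bound norm_matrix_mult_le_bound) auto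
  assume K: "norm (matrix_inv (riccati_K D R P)) \<le> c"
  show "norm (riccati_F A B C D E Q R \<gamma> P) \<le>
       c * c + c * c + c * (c * c * c + c * c) * c + c + (c + c * c * c * c) * c * c * (c + c * c * c * c)"
    unfolding riccati_F_def using c S H K
    by (intro norm_add_le_bound norm_diff_le_bound norm_matrix_mult_le_bound) auto
qed

lemma riccati_L_symmetric:
  assumes "transpose (matrix_inv R) = matrix_inv R"
  shows "transpose (riccati_L D R) = riccati_L D R"
  unfolding riccati_L_def by (simp add: matrix_transpose_mul assms matrix_mul_assoc)

lemma riccati_S_symmetric:
  assumes "transpose (matrix_inv R) = matrix_inv R"
  shows "transpose (riccati_S B E R \<gamma>) = riccati_S B E R \<gamma>"
  unfolding riccati_S_def
  by (simp add: transpose_minus transpose_scalar matrix_transpose_mul assms matrix_mul_assoc)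

text \<open>The last term uses
  \<open>K\<inverse> P - (K\<inverse> P)\<^sup>T = K\<inverse> (P K\<^sup>T - K P\<^sup>T) K\<inverse>\<^sup>T = K\<inverse> (P - P\<^sup>T) K\<inverse>\<^sup>T\<close>.\<close>

lemma riccati_F_antisymmetric_part:
  fixes P :: "real^'n^'n" and D :: "real^'m^'n"
  assumes R: "transpose (matrix_inv R) = matrix_inv R" and Q: "transpose Q = Q"
    and K: "invertible (riccati_K D R P)"
  shows "riccati_F A B C D E Q R \<gamma> P - transpose (riccati_F A B C D E Q R \<gamma> P) =
    (P - transpose P) ** A + transpose A ** (P - transpose P)
    - ((P - transpose P) ** riccati_S B E R \<gamma> ** P + transpose P ** riccati_S B E R \<gamma> ** (P - transpose P))
    + transpose (riccati_H B C D R P) ** (matrix_inv (riccati_K D R P) ** (P - transpose P) **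
        transpose (matrix_inv (riccati_K D R P))) ** riccati_H B C D R P"
proof -
  define S H L Ki where "S = riccati_S B E R \<gamma>" and "H = riccati_H B C D R P"
    and "L = riccati_L D R" and "Ki = matrix_inv (riccati_K D R P)"
  have S: "transpose S = S" unfolding S_def by (rule riccati_S_symmetric[OF R])
  have L: "transpose L = L" unfolding L_def by (rule riccati_L_symmetric[OF R])
  have KK: "riccati_K D R P = mat 1 + P ** L" by (simp add: riccati_K_L L_def)
  have Ki: "Ki ** (mat 1 + P ** L) = mat 1" using matrix_inv_mult(2)[OF K] by (simp add: Ki_def KK)
  have Kt: "(mat 1 + L ** transpose P) ** transpose Ki = mat 1"
  proof -
    have "transpose (Ki ** (mat 1 + P ** L)) = mat 1" unfolding Ki by simp
    then show ?thesis by (simp add: matrix_transpose_mul transpose_add L)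
  qed
  have d: "P - transpose P = P ** (mat 1 + L ** transpose P) - (mat 1 + P ** L) ** transpose P"
    by (simp add: matrix_add_ldistrib matrix_add_rdistrib matrix_mul_assoc)
  have "Ki ** (P - transpose P) ** transpose Ki =
      Ki ** P ** ((mat 1 + L ** transpose P) ** transpose Ki) - (Ki ** (mat 1 + P ** L)) ** transpose P ** transpose Ki"
    unfolding d by (simp add: matrix_mult_diff_distrib matrix_mul_assoc)
  then have kk: "Ki ** (P - transpose P) ** transpose Ki = Ki ** P - transpose P ** transpose Ki"
    by (simp add: Ki Kt)
  have T: "transpose (riccati_F A B C D E Q R \<gamma> P) = transpose A ** transpose P + transpose P ** A
      - transpose P ** S ** transpose P + Q + transpose H ** transpose P ** transpose Ki ** H"
    unfolding riccati_F_def S_def[symmetric] H_def[symmetric] Ki_def[symmetric]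
    by (simp add: transpose_add transpose_minus matrix_transpose_mul S Q matrix_mul_assoc)
  have F: "riccati_F A B C D E Q R \<gamma> P = P ** A + transpose A ** P - P ** S ** P + Q + transpose H ** Ki ** P ** H"
    unfolding riccati_F_def S_def H_def Ki_def by simp
  show ?thesis
    unfolding T unfolding F unfolding S_def[symmetric] H_def[symmetric] Ki_def[symmetric] kk
    by (simp add: matrix_mult_diff_distrib matrix_mul_assoc algebra_simps)
qed

text \<open>Each term of the antisymmetric part contains the factor \<open>P - transpose P\<close>
  exactly once, so the bound is linear in \<open>d\<close>; this makes the equation for that
  difference linear and homogeneous.\<close>

lemma norm_riccati_F_antisymmetric_part:
  fixes A C Q P :: "real^'n^'n" and B D :: "real^'m^'n" and E :: "real^'p^'n" and R :: "real^'m^'m"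
  assumes c: "norm A \<le> c" "norm B \<le> c" "norm C \<le> c" "norm D \<le> c" "norm E \<le> c" "norm Q \<le> c"
    "norm (matrix_inv R) \<le> c" "norm P \<le> c" "norm (matrix_inv (riccati_K D R P)) \<le> c" and \<gamma>: "\<gamma> \<ge> 1"
    and sym: "transpose (matrix_inv R) = matrix_inv R" "transpose Q = Q" and K: "invertible (riccati_K D R P)"
    and d: "norm (P - transpose P) \<le> d"
  shows "norm (riccati_F A B C D E Q R \<gamma> P - transpose (riccati_F A B C D E Q R \<gamma> P)) \<le>
    (c + c + ((c * c * c + c * c) * c + c * (c * c * c + c * c)) + (c + c * c * c * c) * (c * c) * (c + c * c * c * c)) * d"
proof -
  note b = norm_riccati_bounds[OF c(1-8) \<gamma>]
  have "norm (riccati_F A B C D E Q R \<gamma> P - transpose (riccati_F A B C D E Q R \<gamma> P)) \<le>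
    d * c + c * d + (d * (c * c * c + c * c) * c + c * (c * c * c + c * c) * d) +
    (c + c * c * c * c) * (c * d * c) * (c + c * c * c * c)"
    unfolding riccati_F_antisymmetric_part[OF sym K] using c b d
    by (intro norm_add_le_bound norm_diff_le_bound norm_matrix_mult_le_bound) auto
  then show ?thesis by (simp add: algebra_simps)
qed

text \<open>With \<open>w = K\<inverse> P v\<close> and \<open>u = v - L w\<close> one has \<open>w = P u\<close>, so that
  \<open>v \<bullet> w = u \<bullet> P u + w \<bullet> L w\<close>.\<close>

lemma riccati_K_inv_inner_ge:
  fixes D :: "real^'m^'n"
  assumes \<delta>: "\<delta> > 0" and co: "\<And>\<xi>. \<delta> * (\<xi> \<bullet> \<xi>) \<le> \<xi> \<bullet> (R *v \<xi>)"
    and K: "invertible (riccati_K D R P)"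
    and L: "transpose (riccati_L D R) = riccati_L D R"
    and lb: "\<And>\<xi>. - m * (norm \<xi>)\<^sup>2 \<le> \<xi> \<bullet> (P *v \<xi>)" and m: "m \<ge> 0"
    and u: "norm (v - riccati_L D R *v (matrix_inv (riccati_K D R P) *v (P *v v))) \<le> k"
  shows "- m * k\<^sup>2 \<le> v \<bullet> (matrix_inv (riccati_K D R P) *v (P *v v))"
proof -
  define w where "w = matrix_inv (riccati_K D R P) *v (P *v v)"
  define u' where "u' = v - riccati_L D R *v w"
  have "riccati_K D R P *v w = P *v v" by (simp add: w_def matrix_inv_vector[OF K])
  then have "w + P *v (riccati_L D R *v w) = P *v v"
    by (simp add: riccati_K_L matrix_vector_mult_add_rdistrib matrix_vector_mul_assoc)
  then have w: "w = P *v u'" by (simp add: u'_def matrix_vector_mult_diff_distrib algebra_simps)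
  have "v \<bullet> w = u' \<bullet> w + w \<bullet> (riccati_L D R *v w)"
    by (simp add: u'_def inner_diff_left) (simp add: inner_commute)
  also have "u' \<bullet> w = u' \<bullet> (P *v u')" using w by simp
  finally have "v \<bullet> w \<ge> u' \<bullet> (P *v u')" using riccati_L_inner(2)[OF \<delta> co] by simp
  moreover have "m * (norm u')\<^sup>2 \<le> m * k\<^sup>2"
    using u m by (intro mult_left_mono power_mono) (auto simp: u'_def w_def)
  ultimately show ?thesis using lb[of u'] by (simp add: w_def)
qed

section \<open>Backward propagation of symmetry and positivity along the Riccati equation\<close>

locale riccati =
  fixes T :: real
    and A C Q :: "real \<Rightarrow> real^'n^'n" and B D :: "real \<Rightarrow> real^'m^'n" and E :: "real \<Rightarrow> real^'p^'n"
    and R :: "real \<Rightarrow> real^'m^'m" and G :: "real^'n^'n" and \<gamma> b \<delta> :: real and P :: "real \<Rightarrow> real^'n^'n"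
  assumes T_pos: "T > 0"
    and bnd: "\<And>t. t \<in> {0..T} \<Longrightarrow> norm (A t) \<le> b" "\<And>t. t \<in> {0..T} \<Longrightarrow> norm (B t) \<le> b"
      "\<And>t. t \<in> {0..T} \<Longrightarrow> norm (C t) \<le> b" "\<And>t. t \<in> {0..T} \<Longrightarrow> norm (D t) \<le> b"
      "\<And>t. t \<in> {0..T} \<Longrightarrow> norm (E t) \<le> b" "\<And>t. t \<in> {0..T} \<Longrightarrow> norm (Q t) \<le> b"
    and \<delta>_pos: "\<delta> > 0" and coercive: "\<And>t \<xi>. t \<in> {0..T} \<Longrightarrow> \<delta> * (\<xi> \<bullet> \<xi>) \<le> \<xi> \<bullet> (R t *v \<xi>)"
    and R_sym: "\<And>t. t \<in> {0..T} \<Longrightarrow> transpose (R t) = R t"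
    and Q_psd: "\<And>t. t \<in> {0..T} \<Longrightarrow> sym_psd (Q t)" and G_psd: "sym_psd G"
    and \<gamma>: "\<gamma> \<ge> 1"
    and solution: "riccati_solution T A B C D E Q R G \<gamma> P"
    and K_inv: "\<And>t. t \<in> {0..T} \<Longrightarrow> invertible (riccati_K (D t) (R t) (P t))"
begin

definition F where "F t = riccati_F (A t) (B t) (C t) (D t) (E t) (Q t) (R t) \<gamma> (P t)"
definition K where "K t = riccati_K (D t) (R t) (P t)"

lemma F_integrable: "set_integrable lborel {0..T} F"
  and P_eq: "t \<in> {0..T} \<Longrightarrow> P t = G + (LINT s:{t..T}|lborel. F s)"
  using solution
  unfolding riccati_solution_def Let_def F_def riccati_F_def riccati_H_def riccati_S_def by auto

lemma F_integrable_on: "0 \<le> s \<Longrightarrow> t \<le> T \<Longrightarrow> F integrable_on {s..t}"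
  using set_borel_integral_eq_integral(1)[OF set_integrable_subset[OF F_integrable, of "{s..t}"]] by auto

text \<open>The gauge integral takes over from here on: continuity of the indefinite integral,
  additivity over intervals and comparison of integrals are used in that form.\<close>

lemma P_eq_HK: "t \<in> {0..T} \<Longrightarrow> P t = G + integral {t..T} F"
  using P_eq[of t] set_borel_integral_eq_integral(2)[OF set_integrable_subset[OF F_integrable, of "{t..T}"]]
  by auto

lemma P_diff:
  assumes "0 \<le> s" "s \<le> t" "t \<le> T"
  shows "P s - P t = integral {s..t} F"
  using Henstock_Kurzweil_Integration.integral_combine[OF assms(2,3) F_integrable_on[OF assms(1) order_refl]]
    P_eq_HK[of s] P_eq_HK[of t] assms by (simp add: algebra_simps)

lemma P_T: "P T = G"
  using P_eq_HK[of T] T_pos by simp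

lemma P_continuous: "continuous_on {0..T} P"
proof -
  have "continuous_on {0..T} (\<lambda>t. G + integral {t..T} F)"
    using indefinite_integral_continuous_1'[OF F_integrable_on[of 0 T]] by (intro continuous_intros) auto
  then show ?thesis by (rule continuous_on_eq) (simp add: P_eq_HK)
qed

lemma R_inv_bound: "t \<in> {0..T} \<Longrightarrow> norm (matrix_inv (R t)) \<le> real CARD('m) * (1 / \<delta>)"
  using coercive_matrix_inv(3)[OF \<delta>_pos coercive] by (intro norm_le_of_vector_bound) (simp add: divide_inverse mult.commute)

lemma R_inv_sym: "t \<in> {0..T} \<Longrightarrow> transpose (matrix_inv (R t)) = matrix_inv (R t)"
  using matrix_inv_symmetric coercive_matrix_inv(1)[OF \<delta>_pos coercive] R_sym by blast

text \<open>One constant for all matrices at one time, including the inverse of \<open>K\<close>.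
  The predicate is local in time because on a short interval the bound must be at hand before it is
  known on all of \<open>[0, T]\<close>.\<close>

definition bounded_at :: "real \<Rightarrow> real \<Rightarrow> bool" where
  "bounded_at c t \<longleftrightarrow> norm (A t) \<le> c \<and> norm (B t) \<le> c \<and> norm (C t) \<le> c \<and> norm (D t) \<le> c \<and>
     norm (E t) \<le> c \<and> norm (Q t) \<le> c \<and> norm (matrix_inv (R t)) \<le> c \<and> norm (P t) \<le> c \<and>
     norm (matrix_inv (K t)) \<le> c"

lemma P_bounded: "\<exists>c. \<forall>t\<in>{0..T}. norm (P t) \<le> c"
  using compact_imp_bounded[OF compact_continuous_image[OF P_continuous compact_Icc]]
  unfolding bounded_iff by auto

lemma bounded_at_obtain:
  assumes S: "S \<subseteq> {0..T}" and K: "\<And>t v. t \<in> S \<Longrightarrow> norm v \<le> k * norm (K t *v v)"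
  shows "\<exists>c\<ge>1. \<forall>t\<in>S. bounded_at c t"
proof -
  obtain p where p: "\<And>t. t \<in> {0..T} \<Longrightarrow> norm (P t) \<le> p" using P_bounded by blast
  define c where "c = Max {1, b, p, real CARD('m) * (1 / \<delta>), real CARD('n) * k}"
  have c: "1 \<le> c" "b \<le> c" "p \<le> c" "real CARD('m) * (1 / \<delta>) \<le> c" "real CARD('n) * k \<le> c"
    by (simp_all add: c_def)
  have "norm (matrix_inv (K t)) \<le> real CARD('n) * k" if "t \<in> S" for t
    using invertible_of_lower_bound(2)[OF K[OF that]] by (intro norm_le_of_vector_bound) auto
  then have "bounded_at c t" if "t \<in> S" for t
    unfolding bounded_at_def using c bnd p R_inv_bound that S by (meson order_trans subsetD)
  then show ?thesis using c(1) by blast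
qed

text \<open>The matrix \<open>p\<close> is decoupled from the time \<open>t\<close> on purpose: it
  is applied both to \<open>p = P t\<close> and to the value of \<open>P\<close> at another, frozen
  time.\<close>

lemma K_lower_bound_psd:
  assumes "t \<in> {0..T}" "\<And>\<xi>. 0 \<le> \<xi> \<bullet> (p *v \<xi>)" "norm p \<le> c"
  shows "norm v \<le> (1 + c * b * b / \<delta>) * norm (riccati_K (D t) (R t) p *v v)"
proof -
  have "norm p * norm (D t) * norm (D t) \<le> c * b * b"
    using assms(3) bnd(4)[OF assms(1)] order_trans[OF norm_ge_zero bnd(4)[OF assms(1)]] order_trans[OF norm_ge_zero assms(3)]
    by (intro mult_mono) auto
  then have "(1 + norm p * norm (D t) * norm (D t) / \<delta>) * norm (riccati_K (D t) (R t) p *v v) \<le>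
      (1 + c * b * b / \<delta>) * norm (riccati_K (D t) (R t) p *v v)"
    using \<delta>_pos by (intro mult_right_mono add_left_mono divide_right_mono) auto
  then show ?thesis
    using riccati_K_lower_bound_psd[OF \<delta>_pos coercive[OF assms(1)] assms(2), of v "D t"] by linarith
qed

text \<open>\<open>P\<close> is continuous but the coefficients may jump. So \<open>P\<close> is
  frozen at \<open>t\<close>, where it is semidefinite, which gives a lower bound for all
  coefficients at once; only then is \<open>P t\<close> replaced by the nearby
  \<open>P s\<close>.\<close>

lemma local_bound:
  assumes t: "t \<in> {0<..T}" and psd: "sym_psd (P t)"
  shows "\<exists>\<epsilon>>0. \<epsilon> \<le> t \<and> (\<exists>c\<ge>1. \<forall>s\<in>{t - \<epsilon>..t}. bounded_at c s)"
proof -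
  define k where "k = 1 + norm (P t) * b * b / \<delta>"
  have b0: "b \<ge> 0" using order_trans[OF norm_ge_zero bnd(1)[of t]] t by auto
  have k: "k \<ge> 1" using \<delta>_pos b0 by (simp add: k_def)
  define l where "l = b * (real CARD('m) * (1 / \<delta>)) * b"
  have l0: "l \<ge> 0" using b0 \<delta>_pos by (simp add: l_def)
  have l: "norm (riccati_L (D s) (R s)) \<le> l" if "s \<in> {0..T}" for s
    unfolding riccati_L_def l_def using bnd(4)[OF that] R_inv_bound[OF that]
    by (intro norm_matrix_mult_le_bound) auto
  \<comment> \<open>The admissible distance between \<open>P s\<close> and \<open>P t\<close>: it
    makes \<open>k * e * l \<le> 1/2\<close>, as the perturbation lemma requires, and the
    \<open>+ 1\<close> avoids division by zero.\<close>
  define e where "e = 1 / (2 * k * (l + 1))"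
  have e: "e > 0" using k l0 by (simp add: e_def)
  obtain d where d: "d > 0" "\<And>s. s \<in> {0..T} \<Longrightarrow> dist s t < d \<Longrightarrow> dist (P s) (P t) < e"
    using P_continuous t e unfolding continuous_on_iff by (metis greaterThanAtMost_iff atLeastAtMost_iff less_imp_le)
  define \<epsilon> where "\<epsilon> = min t (d / 2)"
  have \<epsilon>: "\<epsilon> > 0" "\<epsilon> \<le> t" "\<epsilon> < d" using d t by (auto simp: \<epsilon>_def)
  have "norm v \<le> 2 * k * norm (K s *v v)" if s: "s \<in> {t - \<epsilon>..t}" for s v
    unfolding K_def
  proof (rule riccati_K_lower_bound_near)
    have sT: "s \<in> {0..T}" using s \<epsilon> t by auto
    show "norm v \<le> k * norm (riccati_K (D s) (R s) (P t) *v v)" for v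
      unfolding k_def using psd by (intro K_lower_bound_psd[OF sT]) (auto simp: sym_psd_def)
    have "norm (P s - P t) \<le> e" using d(2)[OF sT] s \<epsilon> by (auto simp: dist_norm)
    then have "k * norm (P s - P t) * norm (riccati_L (D s) (R s)) \<le> k * e * l"
      using k l[OF sT] e by (intro mult_mono) auto
    also have "k * e = 1 / (2 * (l + 1))" using k by (simp add: e_def)
    also have "1 / (2 * (l + 1)) * l \<le> 1 / 2" using l0 by (simp add: field_simps)
    finally show "k * norm (P s - P t) * norm (riccati_L (D s) (R s)) \<le> 1 / 2" .
  qed (use k in simp)
  then have "\<exists>c\<ge>1. \<forall>s\<in>{t - \<epsilon>..t}. bounded_at c s"
    using \<epsilon> t by (intro bounded_at_obtain) auto
  then show ?thesis using \<epsilon> by blast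
qed

lemma F_bound: "\<exists>L. \<forall>t\<in>{0..T}. bounded_at c t \<longrightarrow> norm (F t) \<le> L"
proof (rule exI, intro ballI impI)
  fix t assume "bounded_at c t"
  note bd = this[unfolded bounded_at_def K_def]
  show "norm (F t) \<le> c * c + c * c + c * (c * c * c + c * c) * c + c + (c + c * c * c * c) * c * c * (c + c * c * c * c)"
    unfolding F_def by (rule norm_riccati_bounds(4)) (use bd \<gamma> in auto)
qed

lemma P_lipschitz:
  assumes "0 \<le> s" "s \<le> t" "t \<le> T" "\<And>r. r \<in> {s..t} \<Longrightarrow> norm (F r) \<le> L"
  shows "norm (P s - P t) \<le> L * (t - s)"
proof -
  have "0 \<le> L" using assms(4)[of s] assms(2) order_trans[OF norm_ge_zero] by auto
  then show ?thesis
    using has_integral_bound[of L F "integral {s..t} F" s t] integrable_integral[OF F_integrable_on[OF assms(1,3)]]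
      assms P_diff[OF assms(1-3)] by (auto simp: cbox_interval)
qed

text \<open>On a short interval the antisymmetric part of \<open>P\<close> is bounded by half of its own maximum.\<close>

lemma local_symmetric:
  assumes t: "t \<in> {0..T}" and sym: "transpose (P t) = P t"
    and \<epsilon>: "\<epsilon> > 0" "\<epsilon> \<le> t" and c: "c \<ge> 1" "\<And>s. s \<in> {t - \<epsilon>..t} \<Longrightarrow> bounded_at c s"
  shows "\<exists>\<epsilon>'>0. \<epsilon>' \<le> \<epsilon> \<and> (\<forall>s\<in>{t - \<epsilon>'..t}. transpose (P s) = P s)"
proof -
  define k where "k = c + c + ((c * c * c + c * c) * c + c * (c * c * c + c * c)) + (c + c * c * c * c) * (c * c) * (c + c * c * c * c)"
  have k: "k > 0" unfolding k_def using c(1) by (intro add_pos_pos mult_pos_pos) auto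
  define \<epsilon>' where "\<epsilon>' = min \<epsilon> (1 / (2 * k))"
  have \<epsilon>': "\<epsilon>' > 0" "\<epsilon>' \<le> \<epsilon>" "\<epsilon>' * k \<le> 1 / 2" using \<epsilon> k by (auto simp: \<epsilon>'_def min_def field_simps)
  define \<Delta> where "\<Delta> s = P s - transpose (P s)" for s
  have "continuous_on {t - \<epsilon>'..t} \<Delta>"
    unfolding \<Delta>_def using \<epsilon> \<epsilon>' t
    by (intro continuous_intros bounded_linear.continuous_on[OF bounded_linear_transpose]
        continuous_on_subset[OF P_continuous]) auto
  then have "continuous_on {t - \<epsilon>'..t} (\<lambda>s. norm (\<Delta> s))" by (intro continuous_intros)
  moreover have "{t - \<epsilon>'..t} \<noteq> {}" using \<epsilon>' by simp
  ultimately obtain s0 where s0: "s0 \<in> {t - \<epsilon>'..t}" "\<And>s. s \<in> {t - \<epsilon>'..t} \<Longrightarrow> norm (\<Delta> s) \<le> norm (\<Delta> s0)"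
    using continuous_attains_sup[OF compact_Icc] by blast
  have i: "(F has_integral (P s0 - P t)) {s0..t}"
    using integrable_integral[OF F_integrable_on[of s0 t]] P_diff[of s0 t] s0 \<epsilon> \<epsilon>' t by auto
  have "((\<lambda>r. F r - transpose (F r)) has_integral ((P s0 - P t) - transpose (P s0 - P t))) {s0..t}"
    using has_integral_diff[OF i has_integral_linear[OF i bounded_linear_transpose]] by (simp add: comp_def)
  \<comment> \<open>The contribution of the right end drops out because \<open>P t\<close> is
    symmetric.\<close>
  moreover have "(P s0 - P t) - transpose (P s0 - P t) = \<Delta> s0"
    using sym by (simp add: \<Delta>_def transpose_minus)
  ultimately have i2: "((\<lambda>r. F r - transpose (F r)) has_integral \<Delta> s0) (cbox s0 t)" by (simp add: cbox_interval)
  have "norm (F r - transpose (F r)) \<le> k * norm (\<Delta> s0)" if "r \<in> cbox s0 t" for r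
  proof -
    have r: "r \<in> {t - \<epsilon>'..t}" "r \<in> {t - \<epsilon>..t}" "r \<in> {0..T}" using that s0 \<epsilon> \<epsilon>' t by (auto simp: cbox_interval)
    note bd = c(2)[OF r(2), unfolded bounded_at_def K_def]
    show ?thesis
      unfolding F_def k_def
      by (rule norm_riccati_F_antisymmetric_part)
        (use bd \<gamma> R_inv_sym[OF r(3)] Q_psd[OF r(3)] K_inv[OF r(3)] s0(2)[OF r(1)] in \<open>auto simp: sym_psd_def \<Delta>_def\<close>)
  qed
  then have "norm (\<Delta> s0) \<le> k * norm (\<Delta> s0) * (t - s0)"
    using has_integral_bound[OF _ i2, of "k * norm (\<Delta> s0)"] k s0 by (simp add: cbox_interval)
  also have "\<dots> \<le> k * norm (\<Delta> s0) * \<epsilon>'" using s0 k by (intro mult_left_mono) auto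
  also have "\<dots> \<le> 1 / 2 * norm (\<Delta> s0)" using mult_right_mono[OF \<epsilon>'(3), of "norm (\<Delta> s0)"] by (simp add: mult_ac)
  finally have "norm (\<Delta> s0) = 0" by simp
  then have "\<Delta> s = 0" if "s \<in> {t - \<epsilon>'..t}" for s using s0(2)[OF that] by simp
  then show ?thesis using \<epsilon>' by (intro exI[of _ \<epsilon>']) (auto simp: \<Delta>_def)
qed

text \<open>On a vector with \<open>P \<xi>\<close> of size \<open>d\<close> and with
  \<open>P \<ge> - m\<close>, every term of the form of \<open>F\<close> is at worst of order
  \<open>d\<close> or \<open>m\<close>: the terms with \<open>A\<close> and \<open>S\<close> contain
  \<open>P \<xi>\<close>, the term with \<open>Q\<close> is nonnegative, and the last one is bounded
  below through \<open>m\<close> by \<open>riccati_K_inv_inner_ge\<close>.\<close>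

lemma F_inner_ge:
  assumes t: "t \<in> {0..T}" and c: "bounded_at c t" "c \<ge> 1"
    and sym: "transpose (P t) = P t"
    and \<xi>: "norm \<xi> = 1" "norm (P t *v \<xi>) \<le> d" "d \<le> 3 * c"
    and lb: "\<And>v. - m * (norm v)\<^sup>2 \<le> v \<bullet> (P t *v v)" "m \<ge> 0"
  shows "- (2 * c + 3 * c * (c * c * c + c * c)) * d
      - m * (c + c * c * c * c + c * c * c * (c * (c * (c + c * c * c * c))))\<^sup>2 \<le> \<xi> \<bullet> (F t *v \<xi>)"
proof -
  define S H L Ki where "S = riccati_S (B t) (E t) (R t) \<gamma>"
    and "H = riccati_H (B t) (C t) (D t) (R t) (P t)"
    and "L = riccati_L (D t) (R t)" and "Ki = matrix_inv (K t)"
  note bd = c(1)[unfolded bounded_at_def]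
  have nb: "norm L \<le> c * c * c" "norm S \<le> c * c * c + c * c" "norm H \<le> c + c * c * c * c"
    unfolding L_def S_def H_def using norm_riccati_bounds(1-3)[of "A t" c "B t" "C t" "D t" "E t" "Q t" "R t" "P t" \<gamma>] bd \<gamma> by auto
  have Pt: "\<xi> \<bullet> (P t *v w) = (P t *v \<xi>) \<bullet> w" for w
    using inner_transpose[of \<xi> "P t" w] sym by simp
  have d0: "d \<ge> 0" using \<xi>(2) order_trans[OF norm_ge_zero] by blast
  have "norm (A t *v \<xi>) \<le> c"
    using norm_matrix_vector_le_bound[of "A t" c \<xi> 1] bd \<xi>(1) by simp
  then have "norm (P t *v \<xi>) * norm (A t *v \<xi>) \<le> d * c" using \<xi>(2) d0 by (intro mult_mono) auto
  then have a1: "- (d * c) \<le> (P t *v \<xi>) \<bullet> (A t *v \<xi>)"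
    using Cauchy_Schwarz_ineq2[of "P t *v \<xi>" "A t *v \<xi>"] by linarith
  \<comment> \<open>Of the two factors \<open>P \<xi>\<close> in the quadratic term one is estimated
    by \<open>3 * c\<close> and the other by \<open>d\<close>, so that the cost stays linear in
    \<open>d\<close>.\<close>
  have "norm (S *v (P t *v \<xi>)) \<le> (c * c * c + c * c) * (3 * c)"
    using nb(2) \<xi> by (intro norm_matrix_vector_le_bound[of S _ "P t *v \<xi>"]) auto
  then have "norm (P t *v \<xi>) * norm (S *v (P t *v \<xi>)) \<le> d * ((c * c * c + c * c) * (3 * c))"
    using \<xi>(2) d0 by (intro mult_mono) auto
  then have a2: "(P t *v \<xi>) \<bullet> (S *v (P t *v \<xi>)) \<le> d * ((c * c * c + c * c) * (3 * c))"
    using Cauchy_Schwarz_ineq2[of "P t *v \<xi>" "S *v (P t *v \<xi>)"] by linarith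
  have a3: "0 \<le> \<xi> \<bullet> (Q t *v \<xi>)" using Q_psd[OF t] by (simp add: sym_psd_def)
  have nH: "norm (H *v \<xi>) \<le> (c + c * c * c * c) * 1"
    using nb(3) \<xi>(1) by (intro norm_matrix_vector_le_bound) auto
  have "- m * (c + c * c * c * c + c * c * c * (c * (c * (c + c * c * c * c))))\<^sup>2 \<le> (H *v \<xi>) \<bullet> (Ki *v (P t *v (H *v \<xi>)))"
    unfolding Ki_def K_def
  proof (rule riccati_K_inv_inner_ge[OF \<delta>_pos coercive[OF t] K_inv[OF t] riccati_L_symmetric[OF R_inv_sym[OF t]] lb])
    show "norm (H *v \<xi> - riccati_L (D t) (R t) *v (matrix_inv (riccati_K (D t) (R t) (P t)) *v (P t *v (H *v \<xi>))))
        \<le> c + c * c * c * c + c * c * c * (c * (c * (c + c * c * c * c)))"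
      using nH nb(1) bd unfolding L_def[symmetric] K_def[symmetric]
      by (intro norm_diff_le_bound norm_matrix_vector_le_bound) auto
  qed
  moreover have "\<xi> \<bullet> (F t *v \<xi>) = 2 * ((P t *v \<xi>) \<bullet> (A t *v \<xi>)) - (P t *v \<xi>) \<bullet> (S *v (P t *v \<xi>))
      + \<xi> \<bullet> (Q t *v \<xi>) + (H *v \<xi>) \<bullet> (Ki *v (P t *v (H *v \<xi>)))"
  proof -
    have 1: "\<xi> \<bullet> (P t *v (A t *v \<xi>)) = (P t *v \<xi>) \<bullet> (A t *v \<xi>)" by (rule Pt)
    have 2: "\<xi> \<bullet> (transpose (A t) *v (P t *v \<xi>)) = (P t *v \<xi>) \<bullet> (A t *v \<xi>)"
      using inner_transpose[of \<xi> "transpose (A t)" "P t *v \<xi>"] by (simp add: inner_commute)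
    have 3: "\<xi> \<bullet> (P t *v (S *v (P t *v \<xi>))) = (P t *v \<xi>) \<bullet> (S *v (P t *v \<xi>))" by (rule Pt)
    have 4: "\<xi> \<bullet> (transpose H *v (Ki *v (P t *v (H *v \<xi>)))) = (H *v \<xi>) \<bullet> (Ki *v (P t *v (H *v \<xi>)))"
      using inner_transpose[of \<xi> "transpose H"] by simp
    have "F t *v \<xi> = P t *v (A t *v \<xi>) + transpose (A t) *v (P t *v \<xi>) - P t *v (S *v (P t *v \<xi>)) + Q t *v \<xi>
        + transpose H *v (Ki *v (P t *v (H *v \<xi>)))"
      unfolding F_def riccati_F_def S_def[symmetric] H_def[symmetric] K_def[symmetric] Ki_def[symmetric]
      by (simp add: matrix_vector_mult_add_rdistrib matrix_vector_mult_diff_rdistrib matrix_vector_mul_assoc matrix_mul_assoc)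
    then show ?thesis by (simp add: inner_add_right inner_diff_right 1 2 3 4)
  qed
  ultimately show ?thesis using a1 a2 a3 by (simp add: algebra_simps)
qed

text \<open>If \<open>P + e (1 + \<kappa> (t - s)) I\<close> becomes degenerate at some \<open>s\<^sub>1 < t\<close>, with null vector \<open>\<xi>\<close>, then
  \<open>P \<xi>\<close> is of order \<open>e\<close> just to the right of \<open>s\<^sub>1\<close>, so \<open>\<xi> \<bullet> F \<xi>\<close> is at least of order \<open>- e\<close>
  there, and the slope \<open>e \<kappa>\<close> of the perturbation prevails when \<open>\<kappa>\<close> is large.\<close>

lemma local_psd:
  assumes t: "t \<in> {0..T}" and psd: "sym_psd (P t)"
    and \<epsilon>: "\<epsilon> > 0" "\<epsilon> \<le> t" and c: "c \<ge> 1" "\<And>s. s \<in> {t - \<epsilon>..t} \<Longrightarrow> bounded_at c s"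
    and sym: "\<And>s. s \<in> {t - \<epsilon>..t} \<Longrightarrow> transpose (P s) = P s"
  shows "\<exists>\<epsilon>'>0. \<epsilon>' \<le> \<epsilon> \<and> (\<forall>s\<in>{t - \<epsilon>'..t}. sym_psd (P s))"
proof -
  define c1 where "c1 = 2 * c + 3 * c * (c * c * c + c * c)"
  define c2 where "c2 = (c + c * c * c * c + c * c * c * (c * (c * (c + c * c * c * c))))\<^sup>2"
  have c1: "c1 > 0" unfolding c1_def using c(1) by (intro add_pos_pos mult_pos_pos) auto
  have c2: "c2 \<ge> 0" by (simp add: c2_def)
  \<comment> \<open>The form of \<open>F\<close> will be bounded below by
    \<open>- (e / 2) - (2 * c1 + 2 * c2) * e\<close>; this choice makes the slope
    \<open>e * \<kappa>\<close> of the perturbation exceed the loss by \<open>e / 2\<close>.\<close>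
  define \<kappa> where "\<kappa> = 2 * c1 + 2 * c2 + 1"
  have \<kappa>: "\<kappa> \<ge> 1" using c1 c2 by (simp add: \<kappa>_def)
  obtain L0 where L0: "\<And>s. s \<in> {t - \<epsilon>..t} \<Longrightarrow> norm (F s) \<le> L0"
  proof -
    obtain L0 where "\<forall>s\<in>{0..T}. bounded_at c s \<longrightarrow> norm (F s) \<le> L0" using F_bound by blast
    moreover have "{t - \<epsilon>..t} \<subseteq> {0..T}" using \<epsilon> t by auto
    ultimately show ?thesis using c(2) that by (meson subsetD)
  qed
  define L where "L = max L0 1"
  have L: "\<And>s. s \<in> {t - \<epsilon>..t} \<Longrightarrow> norm (F s) \<le> L" "L \<ge> 1" using L0 by (force simp: L_def)+
  \<comment> \<open>The length \<open>1 / \<kappa>\<close> keeps the factor \<open>\<psi>\<close>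
    between 1 and 2 on the whole interval.\<close>
  define \<epsilon>' where "\<epsilon>' = min \<epsilon> (1 / \<kappa>)"
  have \<epsilon>': "\<epsilon>' > 0" "\<epsilon>' \<le> \<epsilon>" "\<kappa> * \<epsilon>' \<le> 1" using \<epsilon> \<kappa> by (auto simp: \<epsilon>'_def min_def field_simps)
  define \<psi> where "\<psi> s = 1 + \<kappa> * (t - s)" for s
  have \<psi>: "1 \<le> \<psi> s" "\<psi> s \<le> 2" if "s \<in> {t - \<epsilon>'..t}" for s
  proof -
    have "\<kappa> * (t - s) \<le> \<kappa> * \<epsilon>'" using that \<kappa> by (intro mult_left_mono) auto
    then show "\<psi> s \<le> 2" using \<epsilon>'(3) unfolding \<psi>_def by linarith
    have "0 \<le> \<kappa> * (t - s)" using that \<kappa> by simp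
    then show "1 \<le> \<psi> s" unfolding \<psi>_def by linarith
  qed
  have main: "sym_psd (P s + (e * \<psi> s) *\<^sub>R mat 1)" if e: "0 < e" "e \<le> 1" and s: "s \<in> {t - \<epsilon>'..t}" for e s
  proof (rule ccontr)
    define p where "p s = P s + (e * \<psi> s) *\<^sub>R (mat 1 :: real^'n^'n)" for s
    have pv: "p s *v v = P s *v v + (e * \<psi> s) *\<^sub>R v" for s v
      by (simp add: p_def matrix_vector_mult_add_rdistrib flip: scaleR_matrix_vector_assoc)
    assume "\<not> ?thesis"
    then have fail: "\<not> sym_psd (p s)" by (simp add: p_def)
    have cont: "continuous_on {t - \<epsilon>'..t} p"
      unfolding p_def \<psi>_def using \<epsilon> \<epsilon>' t
      by (intro continuous_intros continuous_on_subset[OF P_continuous]) auto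
    have symp: "transpose (p r) = p r" if "r \<in> {t - \<epsilon>'..t}" for r
      using sym[of r] that \<epsilon>' by (auto simp: p_def transpose_add transpose_scalar)
    have fin: "0 < \<xi> \<bullet> (p t *v \<xi>)" if "norm \<xi> = 1" for \<xi>
    proof -
      have "\<xi> \<bullet> \<xi> = 1" using that by (simp add: dot_square_norm)
      moreover have "0 \<le> \<xi> \<bullet> (P t *v \<xi>)" using psd by (simp add: sym_psd_def)
      ultimately show ?thesis using e by (simp add: pv \<psi>_def inner_add_right)
    qed
    obtain s1 \<xi> where s1: "s1 \<in> {t - \<epsilon>'..<t}" and \<xi>: "norm \<xi> = 1" "\<xi> \<bullet> (p s1 *v \<xi>) = 0"
      and right: "\<And>r. r \<in> {s1..t} \<Longrightarrow> sym_psd (p r)"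
      using psd_first_failure[OF cont _ symp fin s fail] \<epsilon>' by (metis diff_le_self less_imp_le diff_add_cancel le_add_same_cancel1)
    have ker: "p s1 *v \<xi> = 0" using sym_psd_kernel[OF right[of s1] \<xi>(2)] s1 by simp
    \<comment> \<open>Moving from \<open>s1\<close> by at most \<open>h\<close> changes
      \<open>p \<xi>\<close>, which vanishes at \<open>s1\<close>, by at most
      \<open>(L + \<kappa>) * h\<close>; the choice of \<open>h\<close> bounds the resulting loss by
      \<open>e / 2\<close>.\<close>
    define h where "h = min (t - s1) (e / (2 * c1 * (L + \<kappa>)))"
    have LK: "L + \<kappa> > 0" using L(2) \<kappa> by simp
    have h: "h > 0" "s1 + h \<le> t" using s1 e c1 LK by (auto simp: h_def)
    have hs: "c1 * ((L + \<kappa>) * h) \<le> e / 2"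
    proof -
      have "h \<le> e / (2 * c1 * (L + \<kappa>))" by (simp add: h_def)
      then have "h * (2 * c1 * (L + \<kappa>)) \<le> e" using c1 LK by (subst (asm) pos_le_divide_eq) auto
      then show ?thesis by (simp add: mult_ac)
    qed
    have sub: "r \<in> {t - \<epsilon>'..t}" "r \<in> {t - \<epsilon>..t}" "r \<in> {0..T}" "r \<in> {s1..t}" if "r \<in> {s1..s1 + h}" for r
      using that s1 h \<epsilon>' \<epsilon> t by auto
    have lower: "- (e / 2) - (2 * c1 + 2 * c2) * e \<le> \<xi> \<bullet> (F r *v \<xi>)" if r: "r \<in> {s1..s1 + h}" for r
    proof -
      note rr = sub[OF r]
      have "norm (P s1 - P r) \<le> L * (r - s1)"
        using rr s1 \<epsilon> \<epsilon>' r by (intro P_lipschitz L(1)) auto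
      also have "\<dots> \<le> L * h" using r L(2) by (intro mult_left_mono) auto
      finally have "norm ((P s1 - P r) *v \<xi>) \<le> L * h * 1"
        using \<xi>(1) by (intro norm_matrix_vector_le_bound) auto
      moreover have "norm ((e * \<kappa> * (r - s1)) *\<^sub>R \<xi>) \<le> \<kappa> * h"
      proof -
        have "e * (\<kappa> * (r - s1)) \<le> 1 * (\<kappa> * h)" using e r \<kappa> by (intro mult_mono) auto
        then show ?thesis using e r \<kappa> \<xi>(1) by (simp add: abs_mult mult.assoc)
      qed
      moreover have "p r *v \<xi> = - ((P s1 - P r) *v \<xi>) - (e * \<kappa> * (r - s1)) *\<^sub>R \<xi>"
      proof -
        have "p r *v \<xi> = p r *v \<xi> - p s1 *v \<xi>" using ker by simp
        also have "\<dots> = - ((P s1 - P r) *v \<xi>) + (e * \<psi> r - e * \<psi> s1) *\<^sub>R \<xi>"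
          by (simp add: pv matrix_vector_mult_diff_rdistrib scaleR_diff_left)
        also have "e * \<psi> r - e * \<psi> s1 = - (e * \<kappa> * (r - s1))" by (simp add: \<psi>_def algebra_simps)
        finally show ?thesis by (simp add: scaleR_minus_left)
      qed
      ultimately have "norm (p r *v \<xi>) \<le> L * h + \<kappa> * h"
        using norm_triangle_ineq4[of "- ((P s1 - P r) *v \<xi>)" "(e * \<kappa> * (r - s1)) *\<^sub>R \<xi>"] by simp
      moreover have "norm ((e * \<psi> r) *\<^sub>R \<xi>) \<le> e * 2"
      proof -
        have "e * \<psi> r \<le> e * 2" using e \<psi>[OF rr(1)] by (intro mult_left_mono) auto
        then show ?thesis using e \<psi>[OF rr(1)] \<xi>(1) by (simp add: abs_mult)
      qed
      moreover have "norm (P r *v \<xi>) \<le> norm (p r *v \<xi>) + norm ((e * \<psi> r) *\<^sub>R \<xi>)"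
        using norm_triangle_ineq4[of "p r *v \<xi>" "(e * \<psi> r) *\<^sub>R \<xi>"] by (simp add: pv)
      ultimately have d: "norm (P r *v \<xi>) \<le> (L + \<kappa>) * h + 2 * e"
        unfolding distrib_right by linarith
      \<comment> \<open>The perturbed matrix is still semidefinite at \<open>r\<close>, and the
        perturbation is at most \<open>2 * e\<close>.\<close>
      have lb: "- (2 * e) * (norm v)\<^sup>2 \<le> v \<bullet> (P r *v v)" for v
      proof -
        have "0 \<le> v \<bullet> (p r *v v)" using right[OF rr(4)] by (simp add: sym_psd_def)
        moreover have "e * \<psi> r * (norm v)\<^sup>2 \<le> e * 2 * (norm v)\<^sup>2"
          using e \<psi>[OF rr(1)] by (intro mult_right_mono mult_left_mono) auto
        ultimately show ?thesis by (simp add: pv inner_add_right dot_square_norm)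
      qed
      have small: "(L + \<kappa>) * h + 2 * e \<le> 3 * c"
      proof -
        have "c1 * ((L + \<kappa>) * h) \<ge> 1 * ((L + \<kappa>) * h)"
          using c1 c(1) LK h by (intro mult_right_mono) (auto simp: c1_def intro!: add_increasing2)
        then show ?thesis using hs e c(1) by linarith
      qed
      have "- c1 * ((L + \<kappa>) * h + 2 * e) - 2 * e * c2 \<le> \<xi> \<bullet> (F r *v \<xi>)"
        unfolding c1_def c2_def
        using F_inner_ge[OF rr(3) c(2)[OF rr(2)] c(1) sym[OF rr(2)] \<xi>(1) d small lb] e by simp
      then show ?thesis using hs by (simp add: algebra_simps)
    qed
    have range: "0 \<le> s1" "s1 \<le> s1 + h" "s1 + h \<le> T" using sub[of s1] sub[of "s1 + h"] h by auto
    have i: "(F has_integral (P s1 - P (s1 + h))) {s1..s1 + h}"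
      using integrable_integral[OF F_integrable_on[OF range(1,3)]] P_diff[OF range] by simp
    have i2: "((\<lambda>r. \<xi> \<bullet> (F r *v \<xi>)) has_integral \<xi> \<bullet> ((P s1 - P (s1 + h)) *v \<xi>)) {s1..s1 + h}"
      using has_integral_linear[OF i bounded_linear_quadratic[of \<xi>]] by (simp add: comp_def)
    have "(- (e / 2) - (2 * c1 + 2 * c2) * e) * h \<le> \<xi> \<bullet> ((P s1 - P (s1 + h)) *v \<xi>)"
    proof (rule has_integral_le[OF _ i2])
      show "((\<lambda>r. - (e / 2) - (2 * c1 + 2 * c2) * e) has_integral (- (e / 2) - (2 * c1 + 2 * c2) * e) * h) {s1..s1 + h}"
        using has_integral_const_real[of "- (e / 2) - (2 * c1 + 2 * c2) * e" s1 "s1 + h"] h by (simp add: mult.commute)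
    qed (rule lower)
    \<comment> \<open>The contradiction: the perturbed form vanishes at \<open>s1\<close> and is
      nonnegative at \<open>s1 + h\<close>, while the left side, by the integrated lower bound, is
      at least \<open>e / 2 * h > 0\<close>.\<close>
    moreover have "\<xi> \<bullet> (p s1 *v \<xi>) - \<xi> \<bullet> (p (s1 + h) *v \<xi>) = \<xi> \<bullet> ((P s1 - P (s1 + h)) *v \<xi>) + e * \<kappa> * h"
    proof -
      have "\<xi> \<bullet> \<xi> = 1" using \<xi>(1) by (simp add: dot_square_norm)
      then show ?thesis
        by (simp add: pv matrix_vector_mult_diff_rdistrib inner_add_right inner_diff_right \<psi>_def algebra_simps)
    qed
    moreover have "0 \<le> \<xi> \<bullet> (p (s1 + h) *v \<xi>)" using right[of "s1 + h"] h by (simp add: sym_psd_def)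
    ultimately have "(- (e / 2) - (2 * c1 + 2 * c2) * e) * h + e * \<kappa> * h \<le> 0" using \<xi>(2) by linarith
    moreover have "(- (e / 2) - (2 * c1 + 2 * c2) * e) * h + e * \<kappa> * h = e / 2 * h"
      by (simp add: \<kappa>_def algebra_simps)
    ultimately show False using e h by (simp add: mult_le_0_iff)
  qed
  have "sym_psd (P s)" if s: "s \<in> {t - \<epsilon>'..t}" for s
    unfolding sym_psd_def
  proof (intro conjI allI)
    show "transpose (P s) = P s" using sym[of s] s \<epsilon>' by auto
    fix \<xi> :: "real^'n"
    \<comment> \<open>The perturbation is now removed by letting \<open>e\<close> tend to 0 at a
      fixed vector, where it equals \<open>e * q\<close>.\<close>
    define q where "q = \<psi> s * (\<xi> \<bullet> \<xi>)"
    have "0 \<le> \<xi> \<bullet> (P s *v \<xi>) + e * q" if "0 < e" "e \<le> 1" for e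
      using main[OF that s] unfolding sym_psd_def q_def
      by (simp add: matrix_vector_mult_add_rdistrib inner_add_right mult_ac flip: scaleR_matrix_vector_assoc)
    moreover have "q \<ge> 0" using \<psi>[OF s] by (simp add: q_def)
    ultimately show "0 \<le> \<xi> \<bullet> (P s *v \<xi>)"
    proof (intro ccontr[of "0 \<le> \<xi> \<bullet> (P s *v \<xi>)"])
      assume pos: "\<And>e. 0 < e \<Longrightarrow> e \<le> 1 \<Longrightarrow> 0 \<le> \<xi> \<bullet> (P s *v \<xi>) + e * q" and q: "q \<ge> 0"
        and neg: "\<not> 0 \<le> \<xi> \<bullet> (P s *v \<xi>)"
      define a where "a = - (\<xi> \<bullet> (P s *v \<xi>))"
      have a: "a > 0" using neg by (simp add: a_def)
      define e where "e = min 1 (a / (2 * (q + 1)))"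
      have e: "0 < e" "e \<le> 1" using a q by (auto simp: e_def)
      have "e * q \<le> a / (2 * (q + 1)) * q" using q by (intro mult_right_mono) (auto simp: e_def)
      also have "\<dots> \<le> a / 2" using a q by (simp add: field_simps)
      finally show False using pos[OF e] a by (simp add: a_def)
    qed
  qed
  then show ?thesis using \<epsilon>' by blast
qed

text \<open>At the supremum \<open>s1\<close> of the bad times \<open>P\<close> is semidefinite, by
  the terminal value or by closedness. Then bound, symmetry and positivity are extended to the left
  of \<open>s1\<close>, each on a possibly shorter interval, which contradicts the supremum. If
  \<open>s1 = 0\<close>, the only candidate for a bad time is \<open>s1\<close> itself.\<close>

lemma P_sym_psd:
  assumes "t \<in> {0..T}"
  shows "sym_psd (P t)"
proof (rule ccontr)
  assume neg: "\<not> sym_psd (P t)"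
  define N where "N = {s \<in> {0..T}. \<not> sym_psd (P s)}"
  define s1 where "s1 = Sup N"
  have N: "t \<in> N" "bdd_above N" using neg assms by (auto simp: N_def)
  have s1: "s1 \<in> {0..T}"
  proof -
    have "t \<le> s1" using cSup_upper[OF N] by (simp add: s1_def)
    moreover have "s1 \<le> T" unfolding s1_def using N(1) by (intro cSup_least) (auto simp: N_def)
    ultimately show ?thesis using assms by simp
  qed
  have right: "sym_psd (P s)" if "s \<in> {s1<..T}" for s
  proof (rule ccontr)
    assume "\<not> sym_psd (P s)"
    then have "s \<in> N" using that s1 by (simp add: N_def)
    then show False using cSup_upper[OF _ N(2), of s] that by (simp add: s1_def)
  qed
  have s1_psd: "sym_psd (P s1)"
  proof (cases "s1 = T")
    case False
    then have lt: "s1 < T" using s1 by simp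
    have "continuous_on {s1..T} P" by (rule continuous_on_subset[OF P_continuous]) (use s1 in simp)
    then show ?thesis by (rule sym_psd_right_limit) (use lt right in auto)
  qed (simp add: P_T G_psd)
  have "s1 > 0"
  proof (rule ccontr)
    assume "\<not> 0 < s1"
    then have "s1 = 0" using s1 by simp
    moreover have "t \<le> s1" using cSup_upper[OF N] by (simp add: s1_def)
    ultimately show False using neg s1_psd assms by simp
  qed
  then have s1': "s1 \<in> {0<..T}" using s1 by simp
  obtain \<epsilon> c where \<epsilon>: "\<epsilon> > 0" "\<epsilon> \<le> s1" "c \<ge> 1" "\<And>s. s \<in> {s1 - \<epsilon>..s1} \<Longrightarrow> bounded_at c s"
    using local_bound[OF s1' s1_psd] by blast
  obtain \<epsilon>2 where \<epsilon>2: "\<epsilon>2 > 0" "\<epsilon>2 \<le> \<epsilon>" "\<And>s. s \<in> {s1 - \<epsilon>2..s1} \<Longrightarrow> transpose (P s) = P s"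
    using local_symmetric[OF s1 _ \<epsilon>] s1_psd unfolding sym_psd_def by blast
  obtain \<epsilon>3 where \<epsilon>3: "\<epsilon>3 > 0" "\<epsilon>3 \<le> \<epsilon>2" "\<And>s. s \<in> {s1 - \<epsilon>3..s1} \<Longrightarrow> sym_psd (P s)"
  proof -
    have "\<epsilon>2 \<le> s1" "\<And>s. s \<in> {s1 - \<epsilon>2..s1} \<Longrightarrow> bounded_at c s" using \<epsilon> \<epsilon>2 by auto
    then show ?thesis
      using local_psd[OF s1 s1_psd \<epsilon>2(1) _ \<epsilon>(3) _ \<epsilon>2(3)] that by blast
  qed
  obtain s where s: "s \<in> N" "s1 - \<epsilon>3 < s"
    using less_cSup_iff[of N "s1 - \<epsilon>3"] N \<epsilon>3(1) by (auto simp: s1_def)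
  moreover have "s \<le> s1" using cSup_upper[OF s(1) N(2)] by (simp add: s1_def)
  ultimately show False using \<epsilon>3(3)[of s] by (auto simp: N_def)
qed

text \<open>With \<open>P t\<close> semidefinite at every time, the lower bound on \<open>K\<close>
  holds everywhere with one constant, and no covering of \<open>[0, T]\<close> by the local
  intervals is required.\<close>

lemma bounded_at_all: "\<exists>c\<ge>1. \<forall>t\<in>{0..T}. bounded_at c t"
proof -
  obtain p where p: "\<And>t. t \<in> {0..T} \<Longrightarrow> norm (P t) \<le> p" using P_bounded by blast
  show ?thesis
  proof (rule bounded_at_obtain[OF order_refl])
    fix t v assume t: "t \<in> {0..T}"
    show "norm v \<le> (1 + p * b * b / \<delta>) * norm (K t *v v)"
      unfolding K_def using P_sym_psd[OF t] by (intro K_lower_bound_psd[OF t] p[OF t]) (simp add: sym_psd_def)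
  qed
qed

lemma F_bounded: "\<exists>L. \<forall>t\<in>{0..T}. norm (F t) \<le> L"
  using bounded_at_all F_bound by meson

lemma P_diff_set_integral:
  assumes "0 \<le> s" "s \<le> t" "t \<le> T"
  shows "P s - P t = (LINT r:{s..t}|lborel. F r)"
  using set_borel_integral_eq_integral(2)[OF set_integrable_subset[OF F_integrable, of "{s..t}"]]
    P_diff[OF assms] assms by auto

section \<open>Algebra of the decoupling, pointwise in time and state\<close>

definition drift_X where
  "drift_X t xv yv zv = A t *v xv - riccati_S (B t) (E t) (R t) \<gamma> *v yv
     - (B t ** matrix_inv (R t) ** transpose (D t)) *v zv"

definition diffusion_X where
  "diffusion_X t xv yv zv = C t *v xv - (D t ** matrix_inv (R t) ** transpose (B t)) *v yv
     - riccati_L (D t) (R t) *v zv"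

definition drift_Y where
  "drift_Y t xv yv zv = - (transpose (A t) *v yv + transpose (C t) *v zv + Q t *v xv)"

definition H where "H t = riccati_H (B t) (C t) (D t) (R t) (P t)"

text \<open>The defect of \<open>z\<close> from its feedback value \<open>K^-1 P H x\<close>. It is
  handier than \<open>\<zeta>\<close>, in which \<open>z\<close> also occurs inside the diffusion
  coefficient of \<open>x\<close>.\<close>

definition Z_residual where
  "Z_residual t xv zv = zv - matrix_inv (K t) *v (P t *v (H t *v xv))"

text \<open>In \<open>z - P * diffusion\<close> the terms with \<open>z\<close> combine to
  \<open>K z\<close>. Writing \<open>y = \<eta> + P x\<close> turns the others into
  \<open>- P H x\<close> plus a multiple of \<open>\<eta>\<close>, so the residual is
  \<open>K^-1\<close> applied to a linear expression in \<open>\<eta>\<close> and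
  \<open>\<zeta>\<close>.\<close>

lemma K_Z_residual:
  assumes t: "t \<in> {0..T}"
  shows "K t *v Z_residual t xv zv = (zv - P t *v diffusion_X t xv yv zv)
    - (P t ** D t ** matrix_inv (R t) ** transpose (B t)) *v (yv - P t *v xv)"
proof -
  have inv: "invertible (K t)" using K_inv[OF t] by (simp add: K_def)
  have "K t *v Z_residual t xv zv = K t *v zv - P t *v (H t *v xv)"
    by (simp add: Z_residual_def matrix_vector_mult_diff_distrib matrix_inv_vector[OF inv])
  also have "K t *v zv = zv + P t *v (riccati_L (D t) (R t) *v zv)"
    by (simp add: K_def riccati_K_L matrix_vector_mult_add_rdistrib matrix_vector_mul_assoc)
  also have "P t *v (H t *v xv) = P t *v (C t *v xv) - (P t ** D t ** matrix_inv (R t) ** transpose (B t)) *v (P t *v xv)"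
    by (simp add: H_def riccati_H_def matrix_vector_mult_diff_rdistrib matrix_vector_mult_diff_distrib
        matrix_vector_mul_assoc matrix_mul_assoc)
  finally show ?thesis
    by (simp add: diffusion_X_def matrix_vector_mult_diff_distrib matrix_vector_mul_assoc matrix_mul_assoc
        algebra_simps)
qed

text \<open>The point where the Riccati equation is used: all terms in \<open>x\<close> alone cancel
  against \<open>F x\<close>. Symmetry of \<open>P\<close> gives
  \<open>H^T = C^T - P B R^-1 D^T\<close>, exactly the coefficient with which \<open>z\<close>
  enters the difference of the drifts.\<close>

lemma decoupled_drift:
  assumes t: "t \<in> {0..T}"
  shows "drift_Y t xv yv zv - P t *v drift_X t xv yv zv + F t *v xv =
    P t *v (riccati_S (B t) (E t) (R t) \<gamma> *v (yv - P t *v xv)) - transpose (A t) *v (yv - P t *v xv)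
    - transpose (H t) *v Z_residual t xv zv"
proof -
  define S where "S = riccati_S (B t) (E t) (R t) \<gamma>"
  have HT: "transpose (H t) = transpose (C t) - P t ** B t ** matrix_inv (R t) ** transpose (D t)"
    using P_sym_psd[OF t] R_inv_sym[OF t]
    by (simp add: H_def riccati_H_def transpose_minus matrix_transpose_mul sym_psd_def matrix_mul_assoc)
  have F: "F t *v xv = P t *v (A t *v xv) + transpose (A t) *v (P t *v xv) - P t *v (S *v (P t *v xv)) + Q t *v xv
      + transpose (H t) *v (matrix_inv (K t) *v (P t *v (H t *v xv)))"
    unfolding F_def riccati_F_def S_def[symmetric] H_def[symmetric] K_def[symmetric]
    by (simp add: matrix_vector_mult_add_rdistrib matrix_vector_mult_diff_rdistrib matrix_vector_mul_assoc matrix_mul_assoc)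
  have HZ: "transpose (H t) *v Z_residual t xv zv = transpose (C t) *v zv
      - P t *v ((B t ** matrix_inv (R t) ** transpose (D t)) *v zv)
      - transpose (H t) *v (matrix_inv (K t) *v (P t *v (H t *v xv)))"
  proof -
    have "transpose (H t) *v zv = transpose (C t) *v zv - P t *v ((B t ** matrix_inv (R t) ** transpose (D t)) *v zv)"
      by (simp add: HT matrix_vector_mult_diff_rdistrib matrix_vector_mul_assoc matrix_mul_assoc)
    then show ?thesis by (simp add: Z_residual_def matrix_vector_mult_diff_distrib)
  qed
  show ?thesis
    unfolding HZ F drift_X_def drift_Y_def S_def[symmetric]
    by (simp add: matrix_vector_mult_diff_distrib)
qed

text \<open>The residual is eliminated by inverting \<open>K\<close>; this is where the uniform
  bound on the inverse pays off.\<close>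

lemma decoupled_drift_bound:
  "\<exists>\<kappa>\<ge>0. \<forall>t\<in>{0..T}. \<forall>xv yv zv.
    norm (drift_Y t xv yv zv - P t *v drift_X t xv yv zv + F t *v xv) \<le>
    \<kappa> * (norm (yv - P t *v xv) + norm (zv - P t *v diffusion_X t xv yv zv))"
proof -
  obtain c where c: "c \<ge> 1" "\<And>t. t \<in> {0..T} \<Longrightarrow> bounded_at c t" using bounded_at_all by blast
  define l where "l = c + c * c * c * c"
  define \<kappa> where "\<kappa> = (c * (c * c * c + c * c) + c + l * (c * (c * c * c * c))) + l * c"
  have l: "l \<ge> 0" using c(1) by (simp add: l_def)
  have k0: "0 \<le> c * (c * c * c + c * c) + c + l * (c * (c * c * c * c))" "0 \<le> l * c"
    using c(1) l by simp_all
  have "norm (drift_Y t xv yv zv - P t *v drift_X t xv yv zv + F t *v xv) \<le>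
    \<kappa> * (norm (yv - P t *v xv) + norm (zv - P t *v diffusion_X t xv yv zv))"
    if t: "t \<in> {0..T}" for t xv yv zv
  proof -
    define \<eta> where "\<eta> = yv - P t *v xv"
    define \<zeta> where "\<zeta> = zv - P t *v diffusion_X t xv yv zv"
    note bd = c(2)[OF t, unfolded bounded_at_def]
    have nb: "norm (riccati_S (B t) (E t) (R t) \<gamma>) \<le> c * c * c + c * c" "norm (H t) \<le> l"
      unfolding H_def l_def
      using norm_riccati_bounds(2,3)[of "A t" c "B t" "C t" "D t" "E t" "Q t" "R t" "P t" \<gamma>] bd \<gamma> by auto
    have inv: "invertible (K t)" using K_inv[OF t] by (simp add: K_def)
    have "Z_residual t xv zv = matrix_inv (K t) *v (\<zeta> - (P t ** D t ** matrix_inv (R t) ** transpose (B t)) *v \<eta>)"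
      unfolding \<eta>_def \<zeta>_def K_Z_residual[OF t, symmetric] by (simp add: matrix_inv_vector[OF inv])
    also have "norm \<dots> \<le> c * (norm \<zeta> + c * c * c * c * norm \<eta>)"
      using bd by (intro norm_matrix_vector_le_bound norm_diff_le_bound norm_matrix_mult_le_bound) auto
    finally have z: "norm (Z_residual t xv zv) \<le> c * (norm \<zeta> + c * c * c * c * norm \<eta>)" .
    have "norm (drift_Y t xv yv zv - P t *v drift_X t xv yv zv + F t *v xv) \<le>
        c * ((c * c * c + c * c) * norm \<eta>) + c * norm \<eta> + l * (c * (norm \<zeta> + c * c * c * c * norm \<eta>))"
      unfolding decoupled_drift[OF t] \<eta>_def[symmetric] using bd nb z
      by (intro norm_diff_le_bound norm_matrix_vector_le_bound) auto
    also have "\<dots> = (c * (c * c * c + c * c) + c + l * (c * (c * c * c * c))) * norm \<eta> + l * c * norm \<zeta>"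
      by (simp add: algebra_simps)
    also have "\<dots> \<le> \<kappa> * norm \<eta> + \<kappa> * norm \<zeta>"
      using k0 by (intro add_mono mult_right_mono) (auto simp: \<kappa>_def)
    finally show ?thesis by (simp add: \<eta>_def \<zeta>_def distrib_left)
  qed
  moreover have "\<kappa> \<ge> 0" using k0 by (simp add: \<kappa>_def)
  ultimately show ?thesis by blast
qed

lemma decoupled_solution:
  assumes "t \<in> {0..T}" "yv = P t *v xv" "zv = P t *v diffusion_X t xv yv zv"
  shows "zv = matrix_inv (riccati_K (D t) (R t) (P t)) *v (P t *v (riccati_H (B t) (C t) (D t) (R t) (P t) *v xv))"
proof -
  have inv: "invertible (K t)" using K_inv[OF assms(1)] by (simp add: K_def)
  have "K t *v Z_residual t xv zv = 0"
    using K_Z_residual[OF assms(1), of xv zv yv] assms(2) assms(3)[symmetric] by simp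
  then have "Z_residual t xv zv = 0"
    using matrix_inv_vector(2)[OF inv, of "Z_residual t xv zv"] by simp
  then show ?thesis by (simp add: Z_residual_def K_def H_def)
qed

end

section \<open>Mean squares and time integrals\<close>

text \<open>Mean squares take values in the extended nonnegative reals, so that isometries and
  limits can be stated without prior integrability. The same notion serves for the probability space
  and for its product with time.\<close>

definition nn_sq :: "'a measure \<Rightarrow> ('a \<Rightarrow> 'v::real_normed_vector) \<Rightarrow> ennreal" where
  "nn_sq N f = (\<integral>\<^sup>+ x. ennreal ((norm (f x))\<^sup>2) \<partial>N)"

lemma norm_add_square_le:
  fixes u v :: "'v::real_normed_vector"
  shows "(norm (u + v))\<^sup>2 \<le> 2 * (norm u)\<^sup>2 + 2 * (norm v)\<^sup>2"
proof -
  have "(norm (u + v))\<^sup>2 \<le> (norm u + norm v)\<^sup>2"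
    by (intro power_mono norm_triangle_ineq) auto
  also have "\<dots> \<le> 2 * (norm u)\<^sup>2 + 2 * (norm v)\<^sup>2"
    using sum_squares_bound[of "norm u" "norm v"] by (simp add: power2_sum)
  finally show ?thesis .
qed

text \<open>Young's inequality with weight \<open>\<theta>\<close>. The cross term may be charged to
  either vector, so that both directions of a convergence proof can charge it to the fixed
  limit.\<close>

lemma norm_square_perturb:
  fixes u v :: "'v::real_normed_vector"
  assumes "\<theta> > 0" and that: "w = u \<or> w = v"
  shows "(norm u)\<^sup>2 \<le> (norm v)\<^sup>2 + \<theta> * (norm w)\<^sup>2 + (1 + 1 / \<theta>) * (norm (u - v))\<^sup>2"
proof -
  let ?d = "norm (u - v)"
  have "2 * (sqrt \<theta> * norm w) * (?d / sqrt \<theta>) \<le> (sqrt \<theta> * norm w)\<^sup>2 + (?d / sqrt \<theta>)\<^sup>2"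
    by (rule sum_squares_bound)
  then have y: "2 * norm w * ?d \<le> \<theta> * (norm w)\<^sup>2 + ?d\<^sup>2 / \<theta>"
    using assms by (simp add: power_mult_distrib power_divide)
  have t: "norm u \<le> norm v + ?d" "\<bar>norm u - norm v\<bar> \<le> ?d"
    using norm_triangle_ineq[of v "u - v"] norm_triangle_ineq3[of u v] by auto
  have "(norm u)\<^sup>2 \<le> (norm v)\<^sup>2 + 2 * norm w * ?d + ?d\<^sup>2"
    using that
  proof
    assume "w = v"
    have "(norm u)\<^sup>2 \<le> (norm v + ?d)\<^sup>2" using t by (intro power_mono) auto
    then show ?thesis by (simp add: \<open>w = v\<close> power2_sum)
  next
    assume "w = u"
    have "(norm u)\<^sup>2 - (norm v)\<^sup>2 = (norm u - norm v) * (2 * norm u - (norm u - norm v))"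
      by (simp add: power2_eq_square algebra_simps)
    also have "\<dots> = 2 * norm u * (norm u - norm v) - (norm u - norm v)\<^sup>2"
      by (simp add: power2_eq_square algebra_simps)
    also have "\<dots> \<le> 2 * norm u * ?d"
    proof -
      have "2 * norm u * (norm u - norm v) \<le> 2 * norm u * ?d"
        using t by (intro mult_left_mono) auto
      then show ?thesis using zero_le_power2[of "norm u - norm v"] by linarith
    qed
    finally show ?thesis unfolding \<open>w = u\<close> using zero_le_power2[of ?d] by linarith
  qed
  then show ?thesis using y by (simp add: algebra_simps)
qed

lemma nn_sq_zero [simp]: "nn_sq N (\<lambda>_. 0) = 0"
  by (simp add: nn_sq_def)

lemma nn_sq_add_le:
  fixes f g :: "'a \<Rightarrow> 'v::euclidean_space"
  assumes [measurable]: "f \<in> borel_measurable N" "g \<in> borel_measurable N"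
  shows "nn_sq N (\<lambda>x. f x + g x) \<le> 2 * nn_sq N f + 2 * nn_sq N g"
proof -
  have "nn_sq N (\<lambda>x. f x + g x)
      \<le> (\<integral>\<^sup>+ x. 2 * ennreal ((norm (f x))\<^sup>2) + 2 * ennreal ((norm (g x))\<^sup>2) \<partial>N)"
    unfolding nn_sq_def
  proof (intro nn_integral_mono)
    fix x
    have "ennreal ((norm (f x + g x))\<^sup>2) \<le> ennreal (2 * (norm (f x))\<^sup>2 + 2 * (norm (g x))\<^sup>2)"
      by (intro ennreal_leI norm_add_square_le)
    also have "\<dots> = 2 * ennreal ((norm (f x))\<^sup>2) + 2 * ennreal ((norm (g x))\<^sup>2)"
      by (simp add: ennreal_plus ennreal_mult)
    finally show "ennreal ((norm (f x + g x))\<^sup>2) \<le> \<dots>" .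
  qed
  also have "\<dots> = 2 * nn_sq N f + 2 * nn_sq N g"
    unfolding nn_sq_def by (subst nn_integral_add) (auto simp: nn_integral_cmult)
  finally show ?thesis .
qed

lemma nn_sq_minus: "nn_sq N (\<lambda>x. - f x) = nn_sq N f"
  by (simp add: nn_sq_def)

lemma nn_sq_diff_le:
  fixes f g :: "'a \<Rightarrow> 'v::euclidean_space"
  assumes [measurable]: "f \<in> borel_measurable N" "g \<in> borel_measurable N"
  shows "nn_sq N (\<lambda>x. f x - g x) \<le> 2 * nn_sq N f + 2 * nn_sq N g"
  using nn_sq_add_le[of f N "\<lambda>x. - g x"] by (simp add: nn_sq_minus)

lemma nn_sq_cong_AE: "(AE x in N. f x = g x) \<Longrightarrow> nn_sq N f = nn_sq N g"
  unfolding nn_sq_def by (rule nn_integral_cong_AE) auto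

lemma nn_sq_scale_le:
  fixes f :: "'a \<Rightarrow> 'v::euclidean_space"
  assumes [measurable]: "f \<in> borel_measurable N" and "\<And>x. norm (h x) \<le> c * norm (f x)" "0 \<le> c"
  shows "nn_sq N h \<le> ennreal (c\<^sup>2) * nn_sq N f"
proof -
  have "nn_sq N h \<le> (\<integral>\<^sup>+ x. ennreal (c\<^sup>2) * ennreal ((norm (f x))\<^sup>2) \<partial>N)"
    unfolding nn_sq_def
  proof (intro nn_integral_mono)
    fix x
    have "(norm (h x))\<^sup>2 \<le> (c * norm (f x))\<^sup>2" using assms by (intro power_mono) auto
    then show "ennreal ((norm (h x))\<^sup>2) \<le> ennreal (c\<^sup>2) * ennreal ((norm (f x))\<^sup>2)"
      by (simp add: power_mult_distrib flip: ennreal_mult)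
  qed
  also have "\<dots> = ennreal (c\<^sup>2) * nn_sq N f"
    unfolding nn_sq_def by (rule nn_integral_cmult) auto
  finally show ?thesis .
qed

lemma nn_sq_eq_0_AE:
  fixes f :: "'a \<Rightarrow> 'v::euclidean_space"
  assumes [measurable]: "f \<in> borel_measurable N" and "nn_sq N f = 0"
  shows "AE x in N. f x = 0"
  using assms(2) unfolding nn_sq_def by (subst (asm) nn_integral_0_iff_AE) auto

text \<open>Continuity of the mean square under L2 convergence, including an infinite limit. It
  transports the Ito isometry from elementary integrands to their limits.\<close>

lemma nn_sq_tendsto:
  fixes f :: "'a \<Rightarrow> 'v::euclidean_space"
  assumes [measurable]: "f \<in> borel_measurable N" "\<And>n. g n \<in> borel_measurable N"
    and lim: "(\<lambda>n. nn_sq N (\<lambda>x. f x - g n x)) \<longlonglongrightarrow> 0"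
  shows "(\<lambda>n. nn_sq N (g n)) \<longlonglongrightarrow> nn_sq N f"
proof (cases "nn_sq N f < \<infinity>")
  case False
  then have inf: "nn_sq N f = \<infinity>" by (simp add: not_less top_unique)
  have "eventually (\<lambda>n. nn_sq N (\<lambda>x. f x - g n x) < 1) sequentially"
    using lim by (auto simp: order_tendsto_iff)
  then have "eventually (\<lambda>n. nn_sq N (g n) = \<infinity>) sequentially"
  proof eventually_elim
    case (elim n)
    have "nn_sq N f \<le> 2 * nn_sq N (\<lambda>x. f x - g n x) + 2 * nn_sq N (g n)"
      using nn_sq_add_le[of "\<lambda>x. f x - g n x" N "g n"] by simp
    moreover have "nn_sq N (\<lambda>x. f x - g n x) \<noteq> \<infinity>"
      using order.strict_trans[OF elim ennreal_one_less_top] by auto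
    ultimately show ?case
      unfolding inf by (simp add: top_unique ennreal_mult_eq_top_iff)
  qed
  then show ?thesis unfolding inf by (rule tendsto_eventually)
next
  case True
  define d where "d n = nn_sq N (\<lambda>x. f x - g n x)" for n
  \<comment> \<open>Both inequalities charge the cross term to \<open>nn_sq N f\<close>, which is
    finite and independent of \<open>n\<close>.\<close>
  have cmp: "nn_sq N u \<le> nn_sq N v + ennreal \<theta> * nn_sq N f + ennreal (1 + 1 / \<theta>) * d n"
    if uv: "(u = f \<and> v = g n) \<or> (u = g n \<and> v = f)" and "\<theta> > 0" for u v \<theta> n
  proof -
    have [measurable]: "u \<in> borel_measurable N" "v \<in> borel_measurable N" using uv by auto
    have "nn_sq N u \<le> (\<integral>\<^sup>+ x. ennreal ((norm (v x))\<^sup>2) + ennreal \<theta> * ennreal ((norm (f x))\<^sup>2)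
        + ennreal (1 + 1 / \<theta>) * ennreal ((norm (f x - g n x))\<^sup>2) \<partial>N)"
      unfolding nn_sq_def
    proof (intro nn_integral_mono)
      fix x
      have "(norm (u x))\<^sup>2 \<le> (norm (v x))\<^sup>2 + \<theta> * (norm (f x))\<^sup>2
          + (1 + 1 / \<theta>) * (norm (u x - v x))\<^sup>2"
        by (rule norm_square_perturb) (use uv \<open>\<theta> > 0\<close> in auto)
      moreover have "norm (u x - v x) = norm (f x - g n x)"
        using uv by (auto simp: norm_minus_commute)
      ultimately have "(norm (u x))\<^sup>2 \<le> (norm (v x))\<^sup>2 + \<theta> * (norm (f x))\<^sup>2
          + (1 + 1 / \<theta>) * (norm (f x - g n x))\<^sup>2" by simp
      then have "ennreal ((norm (u x))\<^sup>2) \<le> ennreal ((norm (v x))\<^sup>2 + \<theta> * (norm (f x))\<^sup>2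
          + (1 + 1 / \<theta>) * (norm (f x - g n x))\<^sup>2)" by (rule ennreal_leI)
      then show "ennreal ((norm (u x))\<^sup>2) \<le> ennreal ((norm (v x))\<^sup>2)
          + ennreal \<theta> * ennreal ((norm (f x))\<^sup>2)
          + ennreal (1 + 1 / \<theta>) * ennreal ((norm (f x - g n x))\<^sup>2)"
        using \<open>\<theta> > 0\<close> by (simp add: ennreal_plus ennreal_mult)
    qed
    also have "\<dots> = nn_sq N v + ennreal \<theta> * nn_sq N f + ennreal (1 + 1 / \<theta>) * d n"
      unfolding nn_sq_def d_def by (simp add: nn_integral_add nn_integral_cmult)
    finally show ?thesis .
  qed
  obtain A where A: "nn_sq N f = ennreal A" "A \<ge> 0" using True by (cases "nn_sq N f") auto
  have close: "eventually (\<lambda>n. nn_sq N (g n) \<le> ennreal (A + e) \<and> ennreal A \<le> nn_sq N (g n) + ennreal e)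
      sequentially" if "e > 0" for e :: real
  proof -
    \<comment> \<open>With this weight \<open>\<theta> * A \<le> e / 2\<close>; the remaining
      \<open>e / 2\<close> is left for the term with \<open>d n\<close>, which tends to 0 for fixed
      \<open>\<theta>\<close>.\<close>
    define \<theta> where "\<theta> = e / (2 * (A + 1))"
    define \<kappa> where "\<kappa> = 1 + 1 / \<theta>"
    have \<theta>: "\<theta> > 0" "\<theta> * A \<le> e / 2" using \<open>e > 0\<close> A(2) by (auto simp: \<theta>_def field_simps)
    have pos: "\<kappa> > 0" using \<theta> by (simp add: \<kappa>_def add_pos_pos)
    then have "(0::ennreal) < ennreal (e / (2 * \<kappa>))" using \<open>e > 0\<close> by simp
    then have "eventually (\<lambda>n. d n < ennreal (e / (2 * \<kappa>))) sequentially"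
      using lim unfolding d_def order_tendsto_iff by blast
    then show ?thesis
    proof eventually_elim
      case (elim n)
      have "ennreal \<kappa> * d n \<le> ennreal \<kappa> * ennreal (e / (2 * \<kappa>))"
        using elim by (intro mult_left_mono) auto
      also have "\<dots> = ennreal (e / 2)"
        using pos \<open>e > 0\<close> by (subst ennreal_mult[symmetric]) auto
      finally have 1: "ennreal \<kappa> * d n \<le> ennreal (e / 2)" .
      have 2: "ennreal \<theta> * nn_sq N f \<le> ennreal (e / 2)"
        using \<theta> A ennreal_leI[OF \<theta>(2)] by (simp add: ennreal_mult)
      have 3: "ennreal \<theta> * nn_sq N f + ennreal \<kappa> * d n \<le> ennreal e"
        using add_mono[OF 2 1] \<open>e > 0\<close> by (simp flip: ennreal_plus)
      have "nn_sq N (g n) \<le> nn_sq N f + ennreal e"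
        using cmp[of "g n" f n \<theta>] \<theta>(1) 3 unfolding \<kappa>_def[symmetric] by (metis (no_types, lifting) add.assoc add_left_mono order_trans)
      moreover have "nn_sq N f \<le> nn_sq N (g n) + ennreal e"
        using cmp[of f "g n" n \<theta>] \<theta>(1) 3 unfolding \<kappa>_def[symmetric] by (metis (no_types, lifting) add.assoc add_left_mono order_trans)
      ultimately show ?case using A \<open>e > 0\<close> by (simp flip: ennreal_plus)
    qed
  qed
  show ?thesis
    unfolding A(1)
  proof (rule order_tendstoI)
    fix b :: ennreal assume "b < ennreal A"
    then obtain r where r: "b = ennreal r" "0 \<le> r" "r < A" by (cases b) (auto simp: ennreal_less_iff)
    show "eventually (\<lambda>n. b < nn_sq N (g n)) sequentially"
    proof -
      have "eventually (\<lambda>n. ennreal A \<le> nn_sq N (g n) + ennreal ((A - r) / 2)) sequentially"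
        using close[of "(A - r) / 2"] r by (auto elim!: eventually_mono)
      then show ?thesis
      proof eventually_elim
        case (elim n)
        show ?case
        proof (cases "nn_sq N (g n)")
          case (real q)
          have "ennreal A \<le> ennreal (q + (A - r) / 2)"
            using elim r real by (simp add: ennreal_plus)
          then have "A \<le> q + (A - r) / 2" using real r by (subst (asm) ennreal_le_iff) auto
          then have "r < q" using \<open>r < A\<close> by (simp add: field_simps)
          then show ?thesis using r real by (simp add: ennreal_less_iff)
        next
          case top
          then show ?thesis using r by simp
        qed
      qed
    qed
  next
    fix b :: ennreal assume b: "ennreal A < b"
    show "eventually (\<lambda>n. nn_sq N (g n) < b) sequentially"
    proof (cases b)
      case (real q)
      then have "A < q" using b A by (auto simp: ennreal_less_iff)
      have "ennreal (A + (q - A) / 2) < b"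
        using \<open>A < q\<close> A real by (auto simp: ennreal_less_iff field_simps)
      then show ?thesis using close[of "(q - A) / 2"] \<open>A < q\<close>
        by (auto elim!: eventually_mono)
    next
      case top
      then show ?thesis using close[of 1] by (auto elim!: eventually_mono intro: le_less_trans)
    qed
  qed
qed

lemma nn_sq_eq_integral:
  fixes f :: "'a \<Rightarrow> 'v::euclidean_space"
  assumes "integrable N (\<lambda>x. f x \<bullet> f x)"
  shows "nn_sq N f = ennreal (\<integral>x. f x \<bullet> f x \<partial>N)"
  unfolding nn_sq_def using nn_integral_eq_integral[OF assms] by (simp add: power2_norm_eq_inner)

lemma nn_sq_finite_iff:
  fixes f :: "'a \<Rightarrow> 'v::euclidean_space"
  assumes [measurable]: "f \<in> borel_measurable N"
  shows "nn_sq N f < \<infinity> \<longleftrightarrow> integrable N (\<lambda>x. f x \<bullet> f x)"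
  unfolding nn_sq_def integrable_iff_bounded by (simp add: power2_norm_eq_inner)

lemma tendsto_0_squeeze:
  fixes a b :: "nat \<Rightarrow> ennreal"
  assumes "a \<longlonglongrightarrow> 0" "\<And>n. b n \<le> ennreal c * a n"
  shows "b \<longlonglongrightarrow> 0"
proof -
  have lim: "(\<lambda>n. ennreal c * a n) \<longlonglongrightarrow> 0"
    using ennreal_tendsto_cmult[of "ennreal c" a 0] assms(1) by simp
  show ?thesis
    by (rule tendsto_sandwich[OF _ _ tendsto_const lim]) (use assms(2) in auto)
qed

lemma nn_sq_add_tendsto_0:
  fixes f g :: "nat \<Rightarrow> 'a \<Rightarrow> 'v::euclidean_space"
  assumes "\<And>n. f n \<in> borel_measurable N" "\<And>n. g n \<in> borel_measurable N"
    and "(\<lambda>n. nn_sq N (f n)) \<longlonglongrightarrow> 0" "(\<lambda>n. nn_sq N (g n)) \<longlonglongrightarrow> 0"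
  shows "(\<lambda>n. nn_sq N (\<lambda>x. f n x + g n x)) \<longlonglongrightarrow> 0"
proof (rule tendsto_0_squeeze)
  show "(\<lambda>n. nn_sq N (f n) + nn_sq N (g n)) \<longlonglongrightarrow> 0"
    using tendsto_add[OF assms(3,4)] by simp
  show "nn_sq N (\<lambda>x. f n x + g n x) \<le> ennreal 2 * (nn_sq N (f n) + nn_sq N (g n))" for n
    using nn_sq_add_le[OF assms(1,2)] by (simp add: distrib_left)
qed

text \<open>Intervals are open on the left, so that adjacent ones are disjoint and match the
  intervals of elementary integrands.\<close>

definition proc_on :: "real \<Rightarrow> real \<Rightarrow> (real \<Rightarrow> 'w \<Rightarrow> 'v::euclidean_space) \<Rightarrow> real \<times> 'w \<Rightarrow> 'v" where
  "proc_on s t X p = indicator {s<..t} (fst p) *\<^sub>R X (fst p) (snd p)"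

lemma norm_set_integral_square_le:
  fixes f :: "real \<Rightarrow> 'v::euclidean_space"
  assumes "s \<le> t"
  shows "ennreal ((norm (LINT r:{s..t}|lborel. f r))\<^sup>2) \<le>
    ennreal (t - s) * (\<integral>\<^sup>+ r. indicator {s<..t} r * ennreal ((norm (f r))\<^sup>2) \<partial>lborel)"
proof (cases "set_integrable lborel {s..t} f")
  \<comment> \<open>The integral of a non-integrable function is 0 by convention, which makes the
    bound unconditional.\<close>
  case False
  then have "(LINT r:{s..t}|lborel. f r) = 0"
    unfolding set_lebesgue_integral_def set_integrable_def by (rule not_integrable_integral_eq)
  then show ?thesis by simp
next
  case True
  define f' where "f' = (\<lambda>r. indicator {s..t} r *\<^sub>R f r)"
  have int: "integrable lborel f'" using True by (simp add: set_integrable_def f'_def)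
  then have [measurable]: "f' \<in> borel_measurable borel" by simp
  have "ennreal (norm (LINT r:{s..t}|lborel. f r)) \<le> (\<integral>\<^sup>+ r. ennreal (norm (f' r)) \<partial>lborel)"
    unfolding set_lebesgue_integral_def f'_def[symmetric]
    by (rule integral_norm_bound_ennreal[OF int])
  also have "\<dots> = (\<integral>\<^sup>+ r. indicator {s..t} r * ennreal (norm (f' r)) \<partial>lborel)"
    by (intro nn_integral_cong) (auto simp: f'_def indicator_def)
  finally have "(ennreal (norm (LINT r:{s..t}|lborel. f r)))\<^sup>2 \<le> (\<integral>\<^sup>+ r. indicator {s..t} r * ennreal (norm (f' r)) \<partial>lborel)\<^sup>2"
    by (intro power_mono) auto
  also have "\<dots> \<le> (\<integral>\<^sup>+ r. (indicator {s..t} r)\<^sup>2 \<partial>lborel) * (\<integral>\<^sup>+ r. (ennreal (norm (f' r)))\<^sup>2 \<partial>lborel)"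
    by (rule Cauchy_Schwarz_nn_integral) measurable
  also have "(\<integral>\<^sup>+ r. (indicator {s..t} r)\<^sup>2 \<partial>lborel) = (\<integral>\<^sup>+ r. indicator {s..t} r \<partial>lborel)"
    by (intro nn_integral_cong) (auto simp: indicator_def)
  also have "\<dots> = ennreal (t - s)" using assms by simp
  also have "(\<integral>\<^sup>+ r. (ennreal (norm (f' r)))\<^sup>2 \<partial>lborel) =
      (\<integral>\<^sup>+ r. indicator {s<..t} r * ennreal ((norm (f r))\<^sup>2) \<partial>lborel)"
  proof (rule nn_integral_cong_AE)
    show "AE r in lborel. (ennreal (norm (f' r)))\<^sup>2 = indicator {s<..t} r * ennreal ((norm (f r))\<^sup>2)"
      using AE_lborel_singleton[of s]
      by eventually_elim (auto simp: f'_def indicator_def ennreal_power)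
  qed
  finally show ?thesis by (simp add: ennreal_power)
qed

lemma set_integral_combine:
  fixes f :: "real \<Rightarrow> 'v::euclidean_space"
  assumes "set_integrable lborel {a..c} f" "a \<le> b" "b \<le> c"
  shows "(LINT r:{a..c}|lborel. f r) = (LINT r:{a..b}|lborel. f r) + (LINT r:{b..c}|lborel. f r)"
proof -
  have sub: "set_integrable lborel {a..b} f" "set_integrable lborel {b..c} f"
    using assms by (auto intro: set_integrable_subset)
  show ?thesis
    using Henstock_Kurzweil_Integration.integral_combine[of a b c f] assms
    by (simp add: set_borel_integral_eq_integral[OF sub(1)] set_borel_integral_eq_integral[OF sub(2)]
        set_borel_integral_eq_integral[OF assms(1)])
qed

lemma sum_list_filter_upt:
  "(\<Sum>i\<leftarrow>filter Q [0..<k]. f i) = (\<Sum>i<k. if Q i then f i else 0)" for f :: "nat \<Rightarrow> 'v::comm_monoid_add"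
  by (induction k) (auto simp: add.commute)

lemma bounded_bilinear_matrix_vector: "bounded_bilinear (\<lambda>(A::real^'n^'m) x. A *v x)"
proof
  show "\<exists>K. \<forall>(A::real^'n^'m) x. norm (A *v x) \<le> norm A * norm x * K"
    by (intro exI[of _ 1]) (simp add: norm_matrix_vector_le)
qed (simp_all add: algebra_simps matrix_vector_mult_scaleR flip: scaleR_matrix_vector_assoc)

lemma borel_measurable_matrix_vector [measurable (raw)]:
  fixes f :: "'a \<Rightarrow> real^'n^'m"
  assumes "f \<in> borel_measurable N" "g \<in> borel_measurable N"
  shows "(\<lambda>x. f x *v g x) \<in> borel_measurable N"
  by (rule borel_measurable_continuous_Pair[OF assms])
    (intro bounded_bilinear.continuous_on[OF bounded_bilinear_matrix_vector] continuous_intros)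

lemma nn_sq_disjoint_add:
  fixes f g :: "'a \<Rightarrow> 'v::euclidean_space"
  assumes [measurable]: "f \<in> borel_measurable N" "g \<in> borel_measurable N"
    and "\<And>x. f x = 0 \<or> g x = 0"
  shows "nn_sq N (\<lambda>x. f x + g x) = nn_sq N f + nn_sq N g"
proof -
  have "nn_sq N (\<lambda>x. f x + g x) = (\<integral>\<^sup>+x. ennreal ((norm (f x))\<^sup>2) + ennreal ((norm (g x))\<^sup>2) \<partial>N)"
    unfolding nn_sq_def
  proof (rule nn_integral_cong)
    fix x
    show "ennreal ((norm (f x + g x))\<^sup>2) = ennreal ((norm (f x))\<^sup>2) + ennreal ((norm (g x))\<^sup>2)"
      using assms(3)[of x] by auto
  qed
  also have "\<dots> = nn_sq N f + nn_sq N g" unfolding nn_sq_def by (rule nn_integral_add) auto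
  finally show ?thesis .
qed

lemma nn_sq_sum_le:
  fixes f :: "nat \<Rightarrow> 'a \<Rightarrow> 'v::euclidean_space"
  assumes [measurable]: "\<And>i. i < n \<Longrightarrow> f i \<in> borel_measurable N"
  shows "nn_sq N (\<lambda>x. \<Sum>i<n. f i x) \<le> ennreal (real n) * (\<Sum>i<n. nn_sq N (f i))"
proof -
  have "nn_sq N (\<lambda>x. \<Sum>i<n. f i x) \<le> (\<integral>\<^sup>+x. ennreal (real n) * (\<Sum>i<n. ennreal ((norm (f i x))\<^sup>2)) \<partial>N)"
    unfolding nn_sq_def
  proof (intro nn_integral_mono)
    fix x
    have "(norm (\<Sum>i<n. f i x))\<^sup>2 \<le> (\<Sum>i<n. norm (f i x))\<^sup>2"
      by (intro power_mono norm_sum) auto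
    also have "\<dots> \<le> real n * (\<Sum>i<n. (norm (f i x))\<^sup>2)"
      using Cauchy_Schwarz_ineq_sum[of "\<lambda>_. 1" "\<lambda>i. norm (f i x)" "{..<n}"] by simp
    finally have "ennreal ((norm (\<Sum>i<n. f i x))\<^sup>2) \<le> ennreal (real n * (\<Sum>i<n. (norm (f i x))\<^sup>2))"
      by (rule ennreal_leI)
    also have "\<dots> = ennreal (real n) * (\<Sum>i<n. ennreal ((norm (f i x))\<^sup>2))"
      by (subst sum_ennreal) (auto simp: ennreal_mult sum_nonneg)
    finally show "ennreal ((norm (\<Sum>i<n. f i x))\<^sup>2) \<le> \<dots>" .
  qed
  also have "\<dots> = ennreal (real n) * (\<integral>\<^sup>+x. (\<Sum>i<n. ennreal ((norm (f i x))\<^sup>2)) \<partial>N)"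
    by (rule nn_integral_cmult) (intro borel_measurable_sum, measurable)
  also have "(\<integral>\<^sup>+x. (\<Sum>i<n. ennreal ((norm (f i x))\<^sup>2)) \<partial>N) = (\<Sum>i<n. nn_sq N (f i))"
    unfolding nn_sq_def by (rule nn_integral_sum) measurable
  finally show ?thesis .
qed

lemma proc_on_combine:
  assumes "u \<le> v" "v \<le> w"
  shows "proc_on u w X p = proc_on u v X p + proc_on v w X p"
  using assms by (auto simp: proc_on_def indicator_def)

lemma set_integral_partition:
  fixes f :: "real \<Rightarrow> 'v::euclidean_space"
  assumes f: "set_integrable lborel {0..T} f"
    and r: "\<And>i. i < n \<Longrightarrow> r i \<le> r (Suc i)" "0 \<le> r 0" "r n \<le> T"
  shows "(\<Sum>i<n. LINT s:{r i..r (Suc i)}|lborel. f s) = (LINT s:{r 0..r n}|lborel. f s) \<and> r 0 \<le> r n"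
  using r
proof (induction n)
  case 0
  have "(LINT s:{r 0..r 0}|lborel. f s) = 0"
    using set_borel_integral_eq_integral(2)[OF set_integrable_subset[OF f, of "{r 0..r 0}"]] 0 by simp
  then show ?case by simp
next
  case (Suc n)
  have le: "r n \<le> r (Suc n)" using Suc.prems by simp
  have IH: "(\<Sum>i<n. LINT s:{r i..r (Suc i)}|lborel. f s) = (LINT s:{r 0..r n}|lborel. f s)" "r 0 \<le> r n"
    using Suc le by auto
  have "set_integrable lborel {r 0..r (Suc n)} f"
    by (rule set_integrable_subset[OF f]) (use Suc.prems in auto)
  from set_integral_combine[OF this IH(2) le] show ?case using IH le by simp
qed

section \<open>Brownian motion and the Ito isometry\<close>

text \<open>Elementary integrands are lists of pieces whose intervals may overlap. A sum is then a
  concatenation and no common refinement of partitions ever occurs.\<close>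

definition elem_proc :: "(real \<times> real \<times> ('w \<Rightarrow> 'v::euclidean_space)) list \<Rightarrow> real \<times> 'w \<Rightarrow> 'v" where
  "elem_proc L p = (\<Sum>(a, b, \<xi>)\<leftarrow>L. indicator {a<..b} (fst p) *\<^sub>R \<xi> (snd p))"

definition elem_int ::
    "(real \<Rightarrow> 'w \<Rightarrow> real) \<Rightarrow> (real \<times> real \<times> ('w \<Rightarrow> 'v::euclidean_space)) list \<Rightarrow> 'w \<Rightarrow> 'v" where
  "elem_int W L \<omega> = (\<Sum>(a, b, \<xi>)\<leftarrow>L. (W b \<omega> - W a \<omega>) *\<^sub>R \<xi> \<omega>)"

lemma elem_simps [simp]:
  "elem_proc [] p = 0" "elem_int W [] \<omega> = 0"
  "elem_proc ((a, b, \<xi>) # L) p = indicator {a<..b} (fst p) *\<^sub>R \<xi> (snd p) + elem_proc L p"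
  "elem_int W ((a, b, \<xi>) # L) \<omega> = (W b \<omega> - W a \<omega>) *\<^sub>R \<xi> \<omega> + elem_int W L \<omega>"
  "elem_proc (L @ L') p = elem_proc L p + elem_proc L' p"
  "elem_int W (L @ L') \<omega> = elem_int W L \<omega> + elem_int W L' \<omega>"
  by (simp_all add: elem_proc_def elem_int_def)

locale brownian = prob_space M for M :: "'w measure" +
  fixes W :: "real \<Rightarrow> 'w \<Rightarrow> real"
  assumes BM: "brownian_motion M W"
begin

abbreviation \<F> :: "real \<Rightarrow> 'w measure" where
  "\<F> \<equiv> augmented_filtration M W"

abbreviation \<mu> :: "(real \<times> 'w) measure" where
  "\<mu> \<equiv> lborel \<Otimes>\<^sub>M M"

lemma W_measurable [measurable]: "t \<ge> 0 \<Longrightarrow> W t \<in> borel_measurable M"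
  using BM by (auto simp: brownian_motion_def)

lemma space_natural: "space (natural_filtration M W t) = space M"
  unfolding natural_filtration_def by (rule space_measure_of) auto

lemma sets_natural:
  "sets (natural_filtration M W t) =
     sigma_sets (space M) (\<Union>s\<in>{0..t}. {W s -` B \<inter> space M | B. B \<in> sets borel})"
  unfolding natural_filtration_def by (rule sets_measure_of) auto

lemma sets_natural_subset: "sets (natural_filtration M W t) \<subseteq> sets M"
  unfolding sets_natural
  by (rule sets.sigma_sets_subset) (auto intro!: measurable_sets W_measurable)

lemma filtration_generator:
  "sets (natural_filtration M W t) \<union> null_sets M \<subseteq> Pow (space M)"
  using sets_natural_subset[of t] sets.space_closed[of M] by (auto simp: null_sets_def)

lemma space_filtration [simp]: "space (\<F> t) = space M"
  unfolding augmented_filtration_def by (rule space_measure_of[OF filtration_generator])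

lemma sets_filtration:
  "sets (\<F> t) = sigma_sets (space M) (sets (natural_filtration M W t) \<union> null_sets M)"
  unfolding augmented_filtration_def by (rule sets_measure_of[OF filtration_generator])

lemma sets_filtration_subset: "sets (\<F> t) \<subseteq> sets M"
  unfolding sets_filtration
  by (rule sets.sigma_sets_subset) (use sets_natural_subset in auto)

lemma sets_filtration_mono: "s \<le> t \<Longrightarrow> sets (\<F> s) \<subseteq> sets (\<F> t)"
proof -
  assume "s \<le> t"
  have "sets (natural_filtration M W s) \<subseteq> sets (natural_filtration M W t)"
    unfolding sets_natural
    by (intro sigma_sets_mono' UN_mono) (use \<open>s \<le> t\<close> in auto)
  then show ?thesis
    unfolding sets_filtration by (intro sigma_sets_mono') auto
qed

lemma filtration_measurable_M:
  "X \<in> borel_measurable (\<F> t) \<Longrightarrow> X \<in> borel_measurable M"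
  using sets_filtration_subset[of t] unfolding measurable_def by auto

lemma filtration_measurable_mono:
  "s \<le> t \<Longrightarrow> X \<in> borel_measurable (\<F> s) \<Longrightarrow> X \<in> borel_measurable (\<F> t)"
  using sets_filtration_mono[of s t] unfolding measurable_def by auto

lemma W_filtration: "0 \<le> s \<Longrightarrow> s \<le> t \<Longrightarrow> W s \<in> borel_measurable (\<F> t)"
proof (rule measurableI)
  fix A :: "real set" assume st: "0 \<le> s" "s \<le> t" and "A \<in> sets borel"
  then have "W s -` A \<inter> space M \<in> sets (natural_filtration M W t)"
    unfolding sets_natural by (intro sigma_sets.Basic UN_I[of s]) auto
  then show "W s -` A \<inter> space (\<F> t) \<in> sets (\<F> t)"
    unfolding sets_filtration by auto
qed simp

text \<open>By induction over the generated sigma-algebra: sets that agree with one of the natural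
  filtration up to a null set are closed under complements and countable unions.\<close>

lemma filtration_AE_natural:
  assumes "A \<in> sets (\<F> t)"
  shows "\<exists>B\<in>sets (natural_filtration M W t). AE \<omega> in M. \<omega> \<in> A \<longleftrightarrow> \<omega> \<in> B"
proof -
  let ?N = "natural_filtration M W t"
  from assms have "A \<in> sigma_sets (space M) (sets ?N \<union> null_sets M)"
    by (simp add: sets_filtration)
  then show ?thesis
  proof induction
    case (Basic a)
    then show ?case
    proof
      assume "a \<in> null_sets M"
      then have "AE \<omega> in M. \<omega> \<in> a \<longleftrightarrow> \<omega> \<in> {}"
        using AE_not_in by fastforce
      then show ?thesis by blast
    qed auto
  next
    case Empty
    show ?case by (rule bexI[of _ "{}"]) auto
  next
    case (Compl a)
    then obtain B where B: "B \<in> sets ?N" "AE \<omega> in M. \<omega> \<in> a \<longleftrightarrow> \<omega> \<in> B" by auto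
    have "space M - B \<in> sets ?N"
      using sets.compl_sets[OF B(1)] by (simp add: space_natural)
    moreover have "AE \<omega> in M. \<omega> \<in> space M - a \<longleftrightarrow> \<omega> \<in> space M - B"
      using B(2) by eventually_elim auto
    ultimately show ?case by blast
  next
    case (Union a)
    then obtain B where B: "\<And>i. B i \<in> sets ?N" "\<And>i. AE \<omega> in M. \<omega> \<in> a i \<longleftrightarrow> \<omega> \<in> B i"
      by metis
    have "AE \<omega> in M. \<forall>i::nat. \<omega> \<in> a i \<longleftrightarrow> \<omega> \<in> B i"
      using B(2) by (simp add: AE_all_countable)
    then have "AE \<omega> in M. \<omega> \<in> (\<Union>i. a i) \<longleftrightarrow> \<omega> \<in> (\<Union>i. B i)"
      by eventually_elim auto
    moreover have "(\<Union>i. B i) \<in> sets ?N" using B(1) by auto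
    ultimately show ?case by blast
  qed
qed

text \<open>Independence is given for the natural filtration; replacing \<open>A\<close> by a set of
  that filtration up to a null set changes no probability.\<close>

lemma filtration_indep_increment:
  assumes st: "0 \<le> s" "s < t" and A: "A \<in> sets (\<F> s)" and B: "B \<in> sets borel"
  shows "prob (A \<inter> ((\<lambda>\<omega>. W t \<omega> - W s \<omega>) -` B \<inter> space M)) =
    prob A * prob ((\<lambda>\<omega>. W t \<omega> - W s \<omega>) -` B \<inter> space M)"
proof -
  let ?B = "(\<lambda>\<omega>. W t \<omega> - W s \<omega>) -` B \<inter> space M"
  have [measurable]: "W t \<in> borel_measurable M" "W s \<in> borel_measurable M" using st by auto
  have Bs: "?B \<in> events" using B by measurable
  obtain A' where A': "A' \<in> sets (natural_filtration M W s)" "AE \<omega> in M. \<omega> \<in> A \<longleftrightarrow> \<omega> \<in> A'"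
    using filtration_AE_natural[OF A] by auto
  have ev: "A \<in> events" "A' \<in> events"
    using A A' sets_filtration_subset sets_natural_subset by blast+
  have "prob (A' \<inter> ?B) = prob A' * prob ?B"
  proof (rule indep_setD)
    show "indep_set (sets (natural_filtration M W s))
          {(\<lambda>\<omega>. W t \<omega> - W s \<omega>) -` B \<inter> space M | B. B \<in> sets borel}"
      using BM st by (auto simp: brownian_motion_def)
  qed (use A' B in auto)
  moreover have "prob (A' \<inter> ?B) = prob (A \<inter> ?B)"
    using A'(2) ev Bs by (intro finite_measure_eq_AE) auto
  moreover have "prob A' = prob A"
    using A'(2) ev by (intro finite_measure_eq_AE) auto
  ultimately show ?thesis by simp
qed

lemma indep_var_increment:
  fixes X :: "'w \<Rightarrow> real"
  assumes st: "0 \<le> s" "s < t" and X: "X \<in> borel_measurable (\<F> s)"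
  shows "indep_var borel X borel (\<lambda>\<omega>. W t \<omega> - W s \<omega>)"
  unfolding indep_var_eq
proof (intro conjI)
  have Wm [measurable]: "W t \<in> borel_measurable M" "W s \<in> borel_measurable M" using st by auto
  show Xm: "X \<in> borel_measurable M" using X by (rule filtration_measurable_M)
  show dm: "(\<lambda>\<omega>. W t \<omega> - W s \<omega>) \<in> borel_measurable M" by measurable
  show "indep_set (sigma_sets (space M) {X -` A \<inter> space M |A. A \<in> sets borel})
     (sigma_sets (space M) {(\<lambda>\<omega>. W t \<omega> - W s \<omega>) -` A \<inter> space M |A. A \<in> sets borel})"
  proof (rule indep_set_sigma_sets)
    show "Int_stable {X -` A \<inter> space M |A. A \<in> sets borel}"
      by (auto simp: Int_stable_def) (metis (no_types, lifting) sets.Int vimage_Int inf_assoc inf_commute inf_left_idem)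
    show "Int_stable {(\<lambda>\<omega>. W t \<omega> - W s \<omega>) -` A \<inter> space M |A. A \<in> sets borel}"
      by (auto simp: Int_stable_def) (metis (no_types, lifting) sets.Int vimage_Int inf_assoc inf_commute inf_left_idem)
    show "indep_set {X -` A \<inter> space M |A. A \<in> sets borel}
      {(\<lambda>\<omega>. W t \<omega> - W s \<omega>) -` A \<inter> space M |A. A \<in> sets borel}"
    proof (rule indep_setI)
      fix a b
      assume "a \<in> {X -` A \<inter> space M |A. A \<in> sets borel}"
        and "b \<in> {(\<lambda>\<omega>. W t \<omega> - W s \<omega>) -` A \<inter> space M |A. A \<in> sets borel}"
      moreover have "X -` A \<inter> space M \<in> sets (\<F> s)" if "A \<in> sets borel" for A
        using measurable_sets[OF X that] by simp
      ultimately show "prob (a \<inter> b) = prob a * prob b"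
        using filtration_indep_increment[OF st] by auto
    qed (use Xm dm in \<open>auto intro: measurable_sets\<close>)
  qed
qed

lemma increment_moments:
  assumes st: "0 \<le> s" "s \<le> t"
  shows "integrable M (\<lambda>\<omega>. W t \<omega> - W s \<omega>)" "expectation (\<lambda>\<omega>. W t \<omega> - W s \<omega>) = 0"
    "integrable M (\<lambda>\<omega>. (W t \<omega> - W s \<omega>)\<^sup>2)" "expectation (\<lambda>\<omega>. (W t \<omega> - W s \<omega>)\<^sup>2) = t - s"
proof -
  have *: "integrable M (\<lambda>\<omega>. W t \<omega> - W s \<omega>) \<and> expectation (\<lambda>\<omega>. W t \<omega> - W s \<omega>) = 0 \<and>
    integrable M (\<lambda>\<omega>. (W t \<omega> - W s \<omega>)\<^sup>2) \<and> expectation (\<lambda>\<omega>. (W t \<omega> - W s \<omega>)\<^sup>2) = t - s"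
  proof (cases "s = t")
    case False
    then have "s < t" using st by simp
    then have D: "distributed M lborel (\<lambda>\<omega>. W t \<omega> - W s \<omega>) (normal_density 0 (sqrt (t - s)))"
      and pos: "0 < sqrt (t - s)"
      using BM st by (auto simp: brownian_motion_def)
    have E: "expectation (\<lambda>\<omega>. W t \<omega> - W s \<omega>) = 0"
      by (rule normal_distributed_expectation[OF pos D])
    have "integrable M (\<lambda>\<omega>. (W t \<omega> - W s \<omega>) ^ k)" for k
      using distributed_integrable[OF D, of "\<lambda>x. x ^ k"] integrable_normal_moment[OF pos, of 0 k]
      by simp
    from this[of 1] this[of 2] E normal_distributed_variance[OF pos D] pos show ?thesis by simp
  qed simp
  then show "integrable M (\<lambda>\<omega>. W t \<omega> - W s \<omega>)" "expectation (\<lambda>\<omega>. W t \<omega> - W s \<omega>) = 0"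
    "integrable M (\<lambda>\<omega>. (W t \<omega> - W s \<omega>)\<^sup>2)" "expectation (\<lambda>\<omega>. (W t \<omega> - W s \<omega>)\<^sup>2) = t - s"
    by auto
qed

lemma mult_increment:
  assumes st: "0 \<le> s" "s \<le> t" and X: "X \<in> borel_measurable (\<F> s)" "integrable M X"
  shows "integrable M (\<lambda>\<omega>. X \<omega> * (W t \<omega> - W s \<omega>))"
    "expectation (\<lambda>\<omega>. X \<omega> * (W t \<omega> - W s \<omega>)) = 0"
    "integrable M (\<lambda>\<omega>. X \<omega> * (W t \<omega> - W s \<omega>)\<^sup>2)"
    "expectation (\<lambda>\<omega>. X \<omega> * (W t \<omega> - W s \<omega>)\<^sup>2) = expectation X * (t - s)"
proof -
  have *: "integrable M (\<lambda>\<omega>. X \<omega> * (W t \<omega> - W s \<omega>)) \<and>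
    expectation (\<lambda>\<omega>. X \<omega> * (W t \<omega> - W s \<omega>)) = 0 \<and>
    integrable M (\<lambda>\<omega>. X \<omega> * (W t \<omega> - W s \<omega>)\<^sup>2) \<and>
    expectation (\<lambda>\<omega>. X \<omega> * (W t \<omega> - W s \<omega>)\<^sup>2) = expectation X * (t - s)"
  proof (cases "s = t")
    case False
    then have st': "0 \<le> s" "s < t" using st by simp_all
    have i1: "indep_var borel X borel (\<lambda>\<omega>. W t \<omega> - W s \<omega>)"
      by (rule indep_var_increment[OF st' X(1)])
    have "indep_var borel ((\<lambda>x. x) \<circ> X) borel ((\<lambda>x. x\<^sup>2) \<circ> (\<lambda>\<omega>. W t \<omega> - W s \<omega>))"
      by (rule indep_var_compose[OF i1]) auto
    then have i2: "indep_var borel X borel (\<lambda>\<omega>. (W t \<omega> - W s \<omega>)\<^sup>2)"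
      by (simp add: comp_def)
    note m = increment_moments[OF st]
    show ?thesis
      using indep_var_integrable[OF i1 X(2) m(1)] indep_var_integrable[OF i2 X(2) m(3)]
        indep_var_lebesgue_integral[OF i1 X(2) m(1)] indep_var_lebesgue_integral[OF i2 X(2) m(3)]
        m(2,4) by simp
  qed simp
  then show "integrable M (\<lambda>\<omega>. X \<omega> * (W t \<omega> - W s \<omega>))"
    "expectation (\<lambda>\<omega>. X \<omega> * (W t \<omega> - W s \<omega>)) = 0"
    "integrable M (\<lambda>\<omega>. X \<omega> * (W t \<omega> - W s \<omega>)\<^sup>2)"
    "expectation (\<lambda>\<omega>. X \<omega> * (W t \<omega> - W s \<omega>)\<^sup>2) = expectation X * (t - s)"
    by auto
qed

sublocale LM: pair_sigma_finite lborel M ..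

section \<open>Isometry and orthogonality for elementary integrals\<close>

definition adapted_elem :: "real \<Rightarrow> real \<Rightarrow> (real \<times> real \<times> ('w \<Rightarrow> 'v::euclidean_space)) list \<Rightarrow> bool" where
  "adapted_elem s t L \<longleftrightarrow> (\<forall>(a, b, \<xi>)\<in>set L. s \<le> a \<and> a \<le> b \<and> b \<le> t \<and>
     \<xi> \<in> borel_measurable (\<F> a) \<and> (\<exists>K. \<forall>\<omega>\<in>space M. norm (\<xi> \<omega>) \<le> K))"

lemma adapted_elem_simps [simp]:
  "adapted_elem s t []"
  "adapted_elem s t ((a, b, \<xi>) # L) \<longleftrightarrow> (s \<le> a \<and> a \<le> b \<and> b \<le> t \<and>
     \<xi> \<in> borel_measurable (\<F> a) \<and> (\<exists>K. \<forall>\<omega>\<in>space M. norm (\<xi> \<omega>) \<le> K)) \<and> adapted_elem s t L"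
  "adapted_elem s t (L @ L') \<longleftrightarrow> adapted_elem s t L \<and> adapted_elem s t L'"
  by (simp_all add: adapted_elem_def ball_Un)

lemma elem_measurable:
  assumes "adapted_elem s t L" "0 \<le> s"
  shows "elem_int W L \<in> borel_measurable M" "elem_proc L \<in> borel_measurable \<mu>"
proof -
  have "elem_int W L \<in> borel_measurable M \<and> elem_proc L \<in> borel_measurable \<mu>"
    using assms(1)
  proof (induction L)
    case Nil
    have "elem_int W [] = (\<lambda>_. 0)" "elem_proc [] = (\<lambda>_. 0)" by auto
    then show ?case by simp
  next
    case (Cons e L)
    obtain a b \<xi> where e: "e = (a, b, \<xi>)" by (cases e)
    have [measurable]: "W a \<in> borel_measurable M" "W b \<in> borel_measurable M" "\<xi> \<in> borel_measurable M"
      "elem_int W L \<in> borel_measurable M" "elem_proc L \<in> borel_measurable \<mu>"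
      using Cons e assms(2) by (auto intro: filtration_measurable_M)
    have "elem_int W (e # L) = (\<lambda>\<omega>. (W b \<omega> - W a \<omega>) *\<^sub>R \<xi> \<omega> + elem_int W L \<omega>)"
      "elem_proc (e # L) = (\<lambda>p. indicator {a<..b} (fst p) *\<^sub>R \<xi> (snd p) + elem_proc L p)"
      by (auto simp: e)
    then show ?case by simp
  qed
  then show "elem_int W L \<in> borel_measurable M" "elem_proc L \<in> borel_measurable \<mu>"
    by auto
qed

lemma integrable_bounded_mult:
  fixes X Y :: "'w \<Rightarrow> real"
  assumes "integrable M Y" "X \<in> borel_measurable M" "\<And>\<omega>. \<omega> \<in> space M \<Longrightarrow> \<bar>X \<omega>\<bar> \<le> K"
  shows "integrable M (\<lambda>\<omega>. X \<omega> * Y \<omega>)"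
proof (rule Bochner_Integration.integrable_bound)
  show "integrable M (\<lambda>\<omega>. K * Y \<omega>)" using assms(1) by simp
  show "(\<lambda>\<omega>. X \<omega> * Y \<omega>) \<in> borel_measurable M" using assms by auto
  have "\<bar>X \<omega>\<bar> * \<bar>Y \<omega>\<bar> \<le> \<bar>K\<bar> * \<bar>Y \<omega>\<bar>" if "\<omega> \<in> space M" for \<omega>
    using assms(3)[OF that] by (intro mult_right_mono) auto
  then show "AE x in M. norm (X x * Y x) \<le> norm (K * Y x)"
    by (auto simp: abs_mult)
qed

text \<open>\<open>X\<close> is known at the later of the two left ends. Splitting both increments
  at \<open>c\<close> and at the smaller right end leaves products over disjoint intervals, which
  have mean zero, and the square of the increment over the overlap.\<close>

lemma increments_mult:
  fixes X :: "'w \<Rightarrow> real"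
  assumes "0 \<le> a" "a \<le> b" "a \<le> c" "c \<le> d"
    and X: "X \<in> borel_measurable (\<F> c)" "\<And>\<omega>. \<omega> \<in> space M \<Longrightarrow> \<bar>X \<omega>\<bar> \<le> K"
  shows "integrable M (\<lambda>\<omega>. X \<omega> * ((W b \<omega> - W a \<omega>) * (W d \<omega> - W c \<omega>)))"
    "expectation (\<lambda>\<omega>. X \<omega> * ((W b \<omega> - W a \<omega>) * (W d \<omega> - W c \<omega>))) =
      expectation X * max 0 (min b d - c)"
proof -
  have "integrable M (\<lambda>\<omega>. X \<omega> * ((W b \<omega> - W a \<omega>) * (W d \<omega> - W c \<omega>))) \<and>
    expectation (\<lambda>\<omega>. X \<omega> * ((W b \<omega> - W a \<omega>) * (W d \<omega> - W c \<omega>))) =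
      expectation X * max 0 (min b d - c)"
  proof -
    have Xm: "X \<in> borel_measurable M" by (rule filtration_measurable_M[OF X(1)])
    have Xi: "integrable M X"
      using integrable_bounded_mult[of "\<lambda>_. 1" X K] Xm X(2) by simp
    have bef: "integrable M (\<lambda>\<omega>. X \<omega> * (W v \<omega> - W u \<omega>) * (W q \<omega> - W p \<omega>)) \<and>
       expectation (\<lambda>\<omega>. X \<omega> * (W v \<omega> - W u \<omega>) * (W q \<omega> - W p \<omega>)) = 0"
      if "0 \<le> u" "u \<le> v" "v \<le> p" "p \<le> q" "c \<le> p" for u v p q
    proof -
      have "(\<lambda>\<omega>. X \<omega> * (W v \<omega> - W u \<omega>)) \<in> borel_measurable (\<F> p)"
        using W_filtration[of u p] W_filtration[of v p] filtration_measurable_mono[OF \<open>c \<le> p\<close> X(1)] that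
        by auto
      moreover have "integrable M (\<lambda>\<omega>. X \<omega> * (W v \<omega> - W u \<omega>))"
        using integrable_bounded_mult[OF increment_moments(1) Xm X(2)] that by auto
      ultimately show ?thesis
        using mult_increment(1,2)[of p q "\<lambda>\<omega>. X \<omega> * (W v \<omega> - W u \<omega>)"] that by auto
    qed
    show ?thesis
    proof (cases "b \<le> c")
      case True
      then show ?thesis using bef[of a b c d] assms by (simp add: mult.assoc max_def min_def)
    next
      case False
      \<comment> \<open>The overlap of the two intervals is \<open>(c, m]\<close>; one of the two
        cross terms below is zero since \<open>m\<close> is \<open>b\<close> or
        \<open>d\<close>.\<close>
      define m where "m = min b d"
      have m: "c \<le> m" "m \<le> b" "m \<le> d" "m = b \<or> m = d" using False assms by (auto simp: m_def)
      have rest: "integrable M (\<lambda>\<omega>. X \<omega> * (W b \<omega> - W c \<omega>) * (W d \<omega> - W m \<omega>) +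
            X \<omega> * (W m \<omega> - W c \<omega>) * (W b \<omega> - W m \<omega>)) \<and>
         expectation (\<lambda>\<omega>. X \<omega> * (W b \<omega> - W c \<omega>) * (W d \<omega> - W m \<omega>) +
            X \<omega> * (W m \<omega> - W c \<omega>) * (W b \<omega> - W m \<omega>)) = 0"
        using m(4)
      proof
        assume "m = b"
        then show ?thesis using bef[of c b b d] assms m by simp
      next
        assume "m = d"
        then show ?thesis using bef[of c d d b] assms m by simp
      qed
      have eq: "(\<lambda>\<omega>. X \<omega> * ((W b \<omega> - W a \<omega>) * (W d \<omega> - W c \<omega>))) =
        (\<lambda>\<omega>. X \<omega> * (W c \<omega> - W a \<omega>) * (W d \<omega> - W c \<omega>) + (X \<omega> * (W m \<omega> - W c \<omega>)\<^sup>2 +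
          (X \<omega> * (W b \<omega> - W c \<omega>) * (W d \<omega> - W m \<omega>) +
            X \<omega> * (W m \<omega> - W c \<omega>) * (W b \<omega> - W m \<omega>))))"
        using m(4) by (auto simp: power2_eq_square algebra_simps)
      have p1: "integrable M (\<lambda>\<omega>. X \<omega> * (W c \<omega> - W a \<omega>) * (W d \<omega> - W c \<omega>))"
        "expectation (\<lambda>\<omega>. X \<omega> * (W c \<omega> - W a \<omega>) * (W d \<omega> - W c \<omega>)) = 0"
        using bef[of a c c d] assms by auto
      have p2: "integrable M (\<lambda>\<omega>. X \<omega> * (W m \<omega> - W c \<omega>)\<^sup>2)"
        "expectation (\<lambda>\<omega>. X \<omega> * (W m \<omega> - W c \<omega>)\<^sup>2) = expectation X * (m - c)"
        using mult_increment(3,4)[of c m X] X(1) Xi m(1) assms by auto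
      show ?thesis
        unfolding eq using p1 p2 rest m(1) by (simp add: m_def)
    qed
  qed
  then show "integrable M (\<lambda>\<omega>. X \<omega> * ((W b \<omega> - W a \<omega>) * (W d \<omega> - W c \<omega>)))"
    "expectation (\<lambda>\<omega>. X \<omega> * ((W b \<omega> - W a \<omega>) * (W d \<omega> - W c \<omega>))) =
      expectation X * max 0 (min b d - c)" by auto
qed

lemma integral_fst_mult_snd:
  fixes f :: "real \<Rightarrow> real" and X :: "'w \<Rightarrow> real"
  assumes "integrable lborel f" "integrable M X"
  shows "integrable \<mu> (\<lambda>p. f (fst p) * X (snd p))"
    "(\<integral>p. f (fst p) * X (snd p) \<partial>\<mu>) = (\<integral>r. f r \<partial>lborel) * expectation X"
proof -
  have [measurable]: "f \<in> borel_measurable borel" "X \<in> borel_measurable M" using assms by auto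
  show i: "integrable \<mu> (\<lambda>p. f (fst p) * X (snd p))"
  proof (rule LM.Fubini_integrable)
    show "(\<lambda>p. f (fst p) * X (snd p)) \<in> borel_measurable \<mu>" by measurable
    show "integrable lborel (\<lambda>x. \<integral>y. norm (f (fst (x, y)) * X (snd (x, y))) \<partial>M)"
      using assms by (simp add: abs_mult)
    show "AE x in lborel. integrable M (\<lambda>y. f (fst (x, y)) * X (snd (x, y)))"
      using assms by simp
  qed
  show "(\<integral>p. f (fst p) * X (snd p) \<partial>\<mu>) = (\<integral>r. f r \<partial>lborel) * expectation X"
    using LM.integral_fst'[OF i] by simp
qed

text \<open>The bilinear isometry bundled with integrability of both sides, which makes it additive
  in each argument and reduces it to single pieces.\<close>

definition elem_isometric :: "(real \<times> real \<times> ('w \<Rightarrow> 'v::euclidean_space)) list \<Rightarrow> _ \<Rightarrow> bool" where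
  "elem_isometric L L' \<longleftrightarrow> integrable M (\<lambda>\<omega>. elem_int W L \<omega> \<bullet> elem_int W L' \<omega>) \<and>
     integrable \<mu> (\<lambda>p. elem_proc L p \<bullet> elem_proc L' p) \<and>
     expectation (\<lambda>\<omega>. elem_int W L \<omega> \<bullet> elem_int W L' \<omega>) =
       (\<integral>p. elem_proc L p \<bullet> elem_proc L' p \<partial>\<mu>)"

lemma elem_isometric_append:
  "elem_isometric L1 L \<Longrightarrow> elem_isometric L2 L \<Longrightarrow> elem_isometric (L1 @ L2) L"
  "elem_isometric L L1 \<Longrightarrow> elem_isometric L L2 \<Longrightarrow> elem_isometric L (L1 @ L2)"
  unfolding elem_isometric_def by (simp_all add: inner_add_left inner_add_right)

text \<open>Both sides equal the expectation of \<open>\<xi> \<bullet> \<xi>'\<close> times the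
  length of the overlap of the two intervals.\<close>

lemma elem_isometric_single:
  assumes "0 \<le> s" "adapted_elem s t [(a, b, \<xi>)]" "adapted_elem s t [(c, d, \<xi>')]"
  shows "elem_isometric [(a, b, \<xi>)] [(c, d, \<xi>')]"
proof -
  have ab: "0 \<le> a" "a \<le> b" "0 \<le> c" "c \<le> d" using assms by auto
  have \<xi>: "\<xi> \<in> borel_measurable (\<F> a)" "\<xi>' \<in> borel_measurable (\<F> c)" using assms by auto
  obtain K K' where K: "\<And>\<omega>. \<omega> \<in> space M \<Longrightarrow> norm (\<xi> \<omega>) \<le> K" "\<And>\<omega>. \<omega> \<in> space M \<Longrightarrow> norm (\<xi>' \<omega>) \<le> K'"
    using assms by auto
  define X where "X = (\<lambda>\<omega>. \<xi> \<omega> \<bullet> \<xi>' \<omega>)"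
  have Xb: "\<bar>X \<omega>\<bar> \<le> K * K'" if "\<omega> \<in> space M" for \<omega>
  proof -
    have "\<bar>X \<omega>\<bar> \<le> norm (\<xi> \<omega>) * norm (\<xi>' \<omega>)" unfolding X_def by (rule Cauchy_Schwarz_ineq2)
    also have "\<dots> \<le> K * K'" using K[OF that] by (intro mult_mono) (auto intro: order_trans[OF norm_ge_zero])
    finally show ?thesis .
  qed
  have Xm: "X \<in> borel_measurable (\<F> u)" if "a \<le> u" "c \<le> u" for u
    using filtration_measurable_mono[OF that(1) \<xi>(1)] filtration_measurable_mono[OF that(2) \<xi>(2)]
    unfolding X_def by (intro borel_measurable_inner)
  have XM: "X \<in> borel_measurable M" by (rule filtration_measurable_M[of _ "max a c"]) (auto intro: Xm)
  have Xi: "integrable M X" using integrable_bounded_mult[of "\<lambda>_. 1" X "K * K'"] XM Xb by simp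
  have inc: "integrable M (\<lambda>\<omega>. X \<omega> * ((W b \<omega> - W a \<omega>) * (W d \<omega> - W c \<omega>))) \<and>
    expectation (\<lambda>\<omega>. X \<omega> * ((W b \<omega> - W a \<omega>) * (W d \<omega> - W c \<omega>))) =
      expectation X * max 0 (min b d - max a c)"
  proof (cases "a \<le> c")
    case True
    then show ?thesis using increments_mult[of a b c d X "K * K'"] ab Xm Xb by (simp add: max_def)
  next
    case False
    then show ?thesis
      using increments_mult[of c d a b X "K * K'"] ab Xm Xb by (simp add: max_def min.commute mult.commute)
  qed
  define f :: "real \<Rightarrow> real" where "f = indicator {max a c<..min b d}"
  have "emeasure lborel {max a c<..min b d} < \<infinity>"
    by (cases "max a c \<le> min b d") (simp_all del: max.bounded_iff min.bounded_iff)
  then have fi: "integrable lborel f" "(\<integral>r. f r \<partial>lborel) = max 0 (min b d - max a c)"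
    unfolding f_def by (auto simp: integrable_indicator_iff max_def min_def)
  have m: "(\<lambda>\<omega>. elem_int W [(a, b, \<xi>)] \<omega> \<bullet> elem_int W [(c, d, \<xi>')] \<omega>) =
      (\<lambda>\<omega>. X \<omega> * ((W b \<omega> - W a \<omega>) * (W d \<omega> - W c \<omega>)))"
    by (auto simp: X_def)
  have p: "(\<lambda>p. elem_proc [(a, b, \<xi>)] p \<bullet> elem_proc [(c, d, \<xi>')] p) = (\<lambda>p. f (fst p) * X (snd p))"
    by (auto simp: X_def f_def indicator_def)
  show ?thesis
    unfolding elem_isometric_def m p using inc integral_fst_mult_snd[OF fi(1) Xi] fi(2) by simp
qed

lemma elem_isometric_nil: "elem_isometric [] L" "elem_isometric L []"
  by (simp_all add: elem_isometric_def)

lemma elem_isometry: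
  assumes "0 \<le> s" "adapted_elem s t L" "adapted_elem s t L'"
  shows "elem_isometric L L'"
proof -
  have single: "elem_isometric [(a, b, \<xi>)] L'" if e: "adapted_elem s t [(a, b, \<xi>)]" for a b \<xi>
    using assms(3)
  proof (induction L')
    case (Cons e' L')
    obtain c d \<xi>' where e': "e' = (c, d, \<xi>')" by (cases e')
    have ad: "adapted_elem s t [(c, d, \<xi>')]" "adapted_elem s t L'" using Cons.prems e' by simp_all
    have "elem_isometric [(a, b, \<xi>)] ([(c, d, \<xi>')] @ L')"
      by (rule elem_isometric_append(2)[OF elem_isometric_single[OF assms(1) e ad(1)] Cons.IH[OF ad(2)]])
    then show ?case by (simp add: e')
  qed (rule elem_isometric_nil)
  show ?thesis
    using assms(2)
  proof (induction L)
    case (Cons e L)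
    obtain a b \<xi> where e: "e = (a, b, \<xi>)" by (cases e)
    have ad: "adapted_elem s t [(a, b, \<xi>)]" "adapted_elem s t L" using Cons.prems e by simp_all
    have "elem_isometric ([(a, b, \<xi>)] @ L) L'"
      by (rule elem_isometric_append(1)[OF single[OF ad(1)] Cons.IH[OF ad(2)]])
    then show ?case by (simp add: e)
  qed (rule elem_isometric_nil)
qed

text \<open>Every piece starts at some \<open>a \<ge> s\<close>, so
  \<open>\<eta> \<bullet> \<xi>\<close> is known at time \<open>a\<close> and independent of the
  centred increment that follows. It is integrable because \<open>\<xi>\<close> is bounded.\<close>

lemma elem_orthogonal:
  fixes \<eta> :: "'w \<Rightarrow> 'v::euclidean_space"
  assumes "0 \<le> s" "adapted_elem s t L" "\<eta> \<in> borel_measurable (\<F> s)" "integrable M \<eta>"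
  shows "integrable M (\<lambda>\<omega>. \<eta> \<omega> \<bullet> elem_int W L \<omega>) \<and> expectation (\<lambda>\<omega>. \<eta> \<omega> \<bullet> elem_int W L \<omega>) = 0"
  using assms(2)
proof (induction L)
  case (Cons e L)
  obtain a b \<xi> where e: "e = (a, b, \<xi>)" by (cases e)
  have h: "s \<le> a" "a \<le> b" "\<xi> \<in> borel_measurable (\<F> a)" "adapted_elem s t L" using Cons.prems e by simp_all
  obtain K where K: "\<And>\<omega>. \<omega> \<in> space M \<Longrightarrow> norm (\<xi> \<omega>) \<le> K" using Cons.prems e by auto
  define X where "X = (\<lambda>\<omega>. \<eta> \<omega> \<bullet> \<xi> \<omega>)"
  have Xm: "X \<in> borel_measurable (\<F> a)"
    unfolding X_def
    by (rule borel_measurable_inner[OF filtration_measurable_mono[OF h(1) assms(3)] h(3)])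
  have "integrable M X"
  proof (rule Bochner_Integration.integrable_bound)
    show "integrable M (\<lambda>\<omega>. K * norm (\<eta> \<omega>))" using assms(4) by simp
    show "X \<in> borel_measurable M" by (rule filtration_measurable_M[OF Xm])
    have "\<bar>X \<omega>\<bar> \<le> \<bar>K * norm (\<eta> \<omega>)\<bar>" if "\<omega> \<in> space M" for \<omega>
    proof -
      have "\<bar>X \<omega>\<bar> \<le> norm (\<eta> \<omega>) * norm (\<xi> \<omega>)" unfolding X_def by (rule Cauchy_Schwarz_ineq2)
      also have "\<dots> \<le> norm (\<eta> \<omega>) * K" using K[OF that] by (intro mult_left_mono) auto
      finally show ?thesis by (simp add: mult.commute)
    qed
    then show "AE x in M. norm (X x) \<le> norm (K * norm (\<eta> x))" by auto
  qed
  then have "integrable M (\<lambda>\<omega>. X \<omega> * (W b \<omega> - W a \<omega>))" "expectation (\<lambda>\<omega>. X \<omega> * (W b \<omega> - W a \<omega>)) = 0"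
    using mult_increment(1,2)[of a b X] Xm h assms(1) by auto
  moreover have "(\<lambda>\<omega>. \<eta> \<omega> \<bullet> elem_int W (e # L) \<omega>) =
      (\<lambda>\<omega>. X \<omega> * (W b \<omega> - W a \<omega>) + \<eta> \<omega> \<bullet> elem_int W L \<omega>)"
    by (auto simp: e X_def inner_add_right mult.commute)
  ultimately show ?case using Cons.IH h by simp
qed simp

lemma square_integrable_integrable:
  fixes f :: "'w \<Rightarrow> 'v::euclidean_space"
  assumes [measurable]: "f \<in> borel_measurable M" and "nn_sq M f < \<infinity>"
  shows "integrable M f"
proof -
  have "integrable M (\<lambda>x. (norm (f x))\<^sup>2)"
    using assms(2) nn_sq_finite_iff[OF assms(1)] by (simp add: power2_norm_eq_inner)
  then have "integrable M (\<lambda>x. norm (f x))"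
    by (rule square_integrable_imp_integrable[rotated]) measurable
  then show ?thesis by (simp add: integrable_norm_iff)
qed

lemma elem_pythagoras:
  fixes \<eta> :: "'w \<Rightarrow> 'v::euclidean_space"
  assumes s: "0 \<le> s" and L: "adapted_elem s t L" and \<eta>: "\<eta> \<in> borel_measurable (\<F> s)" "nn_sq M \<eta> < \<infinity>"
  shows "nn_sq M (\<lambda>\<omega>. \<eta> \<omega> + elem_int W L \<omega>) = nn_sq M \<eta> + nn_sq \<mu> (elem_proc L)"
proof -
  have \<eta>M: "\<eta> \<in> borel_measurable M" by (rule filtration_measurable_M[OF \<eta>(1)])
  have 1: "integrable M (\<lambda>\<omega>. \<eta> \<omega> \<bullet> \<eta> \<omega>)" using nn_sq_finite_iff[OF \<eta>M] \<eta>(2) by simp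
  have 2: "integrable M (\<lambda>\<omega>. \<eta> \<omega> \<bullet> elem_int W L \<omega>)" "expectation (\<lambda>\<omega>. \<eta> \<omega> \<bullet> elem_int W L \<omega>) = 0"
    using elem_orthogonal[OF s L \<eta>(1) square_integrable_integrable[OF \<eta>M \<eta>(2)]] by auto
  have 3: "integrable M (\<lambda>\<omega>. elem_int W L \<omega> \<bullet> elem_int W L \<omega>)"
    "integrable \<mu> (\<lambda>p. elem_proc L p \<bullet> elem_proc L p)"
    "expectation (\<lambda>\<omega>. elem_int W L \<omega> \<bullet> elem_int W L \<omega>) =
       (\<integral>p. elem_proc L p \<bullet> elem_proc L p \<partial>\<mu>)"
    using elem_isometry[OF s L L] by (auto simp: elem_isometric_def)
  have eq: "(\<lambda>\<omega>. (\<eta> \<omega> + elem_int W L \<omega>) \<bullet> (\<eta> \<omega> + elem_int W L \<omega>)) =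
    (\<lambda>\<omega>. \<eta> \<omega> \<bullet> \<eta> \<omega> + 2 * (\<eta> \<omega> \<bullet> elem_int W L \<omega>) + elem_int W L \<omega> \<bullet> elem_int W L \<omega>)"
    by (auto simp: inner_add_left inner_add_right inner_commute)
  have i: "integrable M (\<lambda>\<omega>. (\<eta> \<omega> + elem_int W L \<omega>) \<bullet> (\<eta> \<omega> + elem_int W L \<omega>))"
    unfolding eq using 1 2 3 by simp
  have "expectation (\<lambda>\<omega>. (\<eta> \<omega> + elem_int W L \<omega>) \<bullet> (\<eta> \<omega> + elem_int W L \<omega>)) =
    expectation (\<lambda>\<omega>. \<eta> \<omega> \<bullet> \<eta> \<omega>) + (\<integral>p. elem_proc L p \<bullet> elem_proc L p \<partial>\<mu>)"
    unfolding eq using 1 2 3 by simp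
  then show ?thesis
    by (simp add: nn_sq_eq_integral[OF i] nn_sq_eq_integral[OF 1] nn_sq_eq_integral[OF 3(2)])
qed

text \<open>Integrands are functions on the product \<^term>\<open>\<mu>\<close>, cut off outside the interval: \<open>Y\<close> is the
  Ito integral of \<open>Z\<close> over \<open>(s, t]\<close>, and \<open>Z\<close> vanishes almost everywhere off \<open>(s, t]\<close>.\<close>

definition ito_rv :: "real \<Rightarrow> real \<Rightarrow> (real \<times> 'w \<Rightarrow> 'v::euclidean_space) \<Rightarrow> ('w \<Rightarrow> 'v) \<Rightarrow> bool" where
  "ito_rv s t Z Y \<longleftrightarrow> Z \<in> borel_measurable \<mu> \<and> Y \<in> borel_measurable M \<and>
     (\<exists>L. (\<forall>n. adapted_elem s t (L n)) \<and>
        (\<lambda>n. nn_sq \<mu> (\<lambda>p. Z p - elem_proc (L n) p)) \<longlonglongrightarrow> 0 \<and>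
        (\<lambda>n. nn_sq M (\<lambda>\<omega>. Y \<omega> - elem_int W (L n) \<omega>)) \<longlonglongrightarrow> 0)"

lemma ito_rv_measurable:
  "ito_rv s t Z Y \<Longrightarrow> Z \<in> borel_measurable \<mu>" "ito_rv s t Z Y \<Longrightarrow> Y \<in> borel_measurable M"
  by (auto simp: ito_rv_def)

text \<open>The elementary identity passes to the limit on both sides, as mean squares are
  continuous under L2 convergence.\<close>

lemma ito_rv_pythagoras:
  fixes \<eta> :: "'w \<Rightarrow> 'v::euclidean_space"
  assumes s: "0 \<le> s" and I: "ito_rv s t Z Y" and \<eta>: "\<eta> \<in> borel_measurable (\<F> s)" "nn_sq M \<eta> < \<infinity>"
  shows "nn_sq M (\<lambda>\<omega>. \<eta> \<omega> + Y \<omega>) = nn_sq M \<eta> + nn_sq \<mu> Z"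
proof -
  obtain L where L: "\<And>n. adapted_elem s t (L n)"
      "(\<lambda>n. nn_sq \<mu> (\<lambda>p. Z p - elem_proc (L n) p)) \<longlonglongrightarrow> 0"
      "(\<lambda>n. nn_sq M (\<lambda>\<omega>. Y \<omega> - elem_int W (L n) \<omega>)) \<longlonglongrightarrow> 0"
    using I by (auto simp: ito_rv_def)
  have [measurable]: "\<eta> \<in> borel_measurable M" by (rule filtration_measurable_M[OF \<eta>(1)])
  note [measurable] = ito_rv_measurable[OF I] elem_measurable[OF L(1) s]
  have lim: "(\<lambda>n. nn_sq M (\<lambda>\<omega>. \<eta> \<omega> + elem_int W (L n) \<omega>)) \<longlonglongrightarrow> nn_sq M (\<lambda>\<omega>. \<eta> \<omega> + Y \<omega>)"
    by (rule nn_sq_tendsto) (use L(3) in auto)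
  have "(\<lambda>n. nn_sq M \<eta> + nn_sq \<mu> (elem_proc (L n)))
      \<longlonglongrightarrow> nn_sq M \<eta> + nn_sq \<mu> Z"
    by (intro tendsto_add tendsto_const nn_sq_tendsto) (use L(2) in auto)
  then show ?thesis
    by (rule LIMSEQ_unique[OF lim[unfolded elem_pythagoras[OF s L(1) \<eta>]]])
qed

lemma ito_rv_isometry:
  assumes "0 \<le> s" "ito_rv s t Z Y"
  shows "nn_sq M Y = nn_sq \<mu> Z"
  using ito_rv_pythagoras[OF assms, of "\<lambda>_. 0"] by simp

lemma ito_rv_mono:
  assumes "ito_rv s t Z Y" "s' \<le> s" "t \<le> t'"
  shows "ito_rv s' t' Z Y"
proof -
  have "adapted_elem s' t' L" if "adapted_elem s t L" for L :: "(real \<times> real \<times> ('w \<Rightarrow> 'a)) list"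
    using that assms(2,3) by (force simp: adapted_elem_def)
  with assms(1) show ?thesis unfolding ito_rv_def by blast
qed

lemma ito_rv_zero: "ito_rv s t (\<lambda>_. 0) (\<lambda>_. 0)"
  unfolding ito_rv_def by (auto intro!: exI[of _ "\<lambda>_. []"])

lemma ito_rv_add:
  assumes s: "0 \<le> s" and 1: "ito_rv s t Z Y" and 2: "ito_rv s t Z' Y'"
  shows "ito_rv s t (\<lambda>p. Z p + Z' p) (\<lambda>\<omega>. Y \<omega> + Y' \<omega>)"
proof -
  obtain L where L: "\<And>n. adapted_elem s t (L n)"
      "(\<lambda>n. nn_sq \<mu> (\<lambda>p. Z p - elem_proc (L n) p)) \<longlonglongrightarrow> 0"
      "(\<lambda>n. nn_sq M (\<lambda>\<omega>. Y \<omega> - elem_int W (L n) \<omega>)) \<longlonglongrightarrow> 0"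
    using 1 by (auto simp: ito_rv_def)
  obtain L' where L': "\<And>n. adapted_elem s t (L' n)"
      "(\<lambda>n. nn_sq \<mu> (\<lambda>p. Z' p - elem_proc (L' n) p)) \<longlonglongrightarrow> 0"
      "(\<lambda>n. nn_sq M (\<lambda>\<omega>. Y' \<omega> - elem_int W (L' n) \<omega>)) \<longlonglongrightarrow> 0"
    using 2 by (auto simp: ito_rv_def)
  note [measurable] = ito_rv_measurable[OF 1] ito_rv_measurable[OF 2]
    elem_measurable[OF L(1) s] elem_measurable[OF L'(1) s]
  have eqs: "(\<lambda>p. Z p + Z' p - elem_proc (L n @ L' n) p) =
      (\<lambda>p. (Z p - elem_proc (L n) p) + (Z' p - elem_proc (L' n) p))"
    "(\<lambda>\<omega>. Y \<omega> + Y' \<omega> - elem_int W (L n @ L' n) \<omega>) =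
      (\<lambda>\<omega>. (Y \<omega> - elem_int W (L n) \<omega>) + (Y' \<omega> - elem_int W (L' n) \<omega>))" for n
    by auto
  have "(\<lambda>n. nn_sq \<mu> (\<lambda>p. Z p + Z' p - elem_proc (L n @ L' n) p)) \<longlonglongrightarrow> 0"
    unfolding eqs by (rule nn_sq_add_tendsto_0[OF _ _ L(2) L'(2)]) measurable
  moreover have "(\<lambda>n. nn_sq M (\<lambda>\<omega>. Y \<omega> + Y' \<omega> - elem_int W (L n @ L' n) \<omega>)) \<longlonglongrightarrow> 0"
    unfolding eqs by (rule nn_sq_add_tendsto_0[OF _ _ L(3) L'(3)]) measurable
  ultimately show ?thesis
    unfolding ito_rv_def using L(1) L'(1) by (auto intro!: exI[of _ "\<lambda>n. L n @ L' n"])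
qed

lemma ito_rv_linear:
  fixes f :: "'v::euclidean_space \<Rightarrow> 'u::euclidean_space"
  assumes s: "0 \<le> s" and 1: "ito_rv s t Z Y" and f: "bounded_linear f"
  shows "ito_rv s t (\<lambda>p. f (Z p)) (\<lambda>\<omega>. f (Y \<omega>))"
proof -
  interpret f: bounded_linear f by (rule f)
  obtain K where K: "\<And>x. norm (f x) \<le> norm x * K" "K > 0" using f.pos_bounded by blast
  obtain L where L: "\<And>n. adapted_elem s t (L n)"
      "(\<lambda>n. nn_sq \<mu> (\<lambda>p. Z p - elem_proc (L n) p)) \<longlonglongrightarrow> 0"
      "(\<lambda>n. nn_sq M (\<lambda>\<omega>. Y \<omega> - elem_int W (L n) \<omega>)) \<longlonglongrightarrow> 0"
    using 1 by (auto simp: ito_rv_def)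
  define fm where "fm = map (\<lambda>(a::real, b::real, \<xi>::'w \<Rightarrow> 'v). (a, b, \<lambda>\<omega>. f (\<xi> \<omega>)))"
  have [measurable]: "f \<in> borel_measurable borel" by (rule borel_measurable_continuous_onI) (rule f.continuous_on, rule continuous_on_id)
  note [measurable] = ito_rv_measurable[OF 1] elem_measurable[OF L(1) s]
  have fL: "elem_proc (fm l) p = f (elem_proc l p)" "elem_int W (fm l) \<omega> = f (elem_int W l \<omega>)" for l p \<omega>
    by (induction l) (auto simp: fm_def f.zero f.add f.scaleR)
  have ad: "adapted_elem s t (fm l)" if "adapted_elem s t l" for l
    using that
  proof (induction l)
    case (Cons e l)
    obtain a b \<xi> where e: "e = (a, b, \<xi>)" by (cases e)
    have h: "\<xi> \<in> borel_measurable (\<F> a)" using Cons e by auto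
    obtain B where B: "\<And>\<omega>. \<omega> \<in> space M \<Longrightarrow> norm (\<xi> \<omega>) \<le> B" using Cons e by auto
    have "norm (f (\<xi> \<omega>)) \<le> B * K" if "\<omega> \<in> space M" for \<omega>
      using K(1)[of "\<xi> \<omega>"] mult_right_mono[OF B[OF that], of K] K(2) by linarith
    moreover have "(\<lambda>\<omega>. f (\<xi> \<omega>)) \<in> borel_measurable (\<F> a)"
      using measurable_compose[OF h, of f borel] by simp
    ultimately show ?case using Cons e by (auto simp: fm_def)
  qed (simp add: fm_def)
  have le: "nn_sq \<mu> (\<lambda>p. f (Z p) - elem_proc (fm (L n)) p) \<le>
      ennreal (K\<^sup>2) * nn_sq \<mu> (\<lambda>p. Z p - elem_proc (L n) p)"
    "nn_sq M (\<lambda>\<omega>. f (Y \<omega>) - elem_int W (fm (L n)) \<omega>) \<le>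
      ennreal (K\<^sup>2) * nn_sq M (\<lambda>\<omega>. Y \<omega> - elem_int W (L n) \<omega>)" for n
    using K by (auto intro!: nn_sq_scale_le simp: fL mult.commute simp flip: f.diff)
  show ?thesis
    unfolding ito_rv_def
    using ad[OF L(1)] tendsto_0_squeeze[OF L(2) le(1)] tendsto_0_squeeze[OF L(3) le(2)]
    by (auto intro!: exI[of _ "\<lambda>n. fm (L n)"])
qed

lemma ito_rv_diff:
  assumes s: "0 \<le> s" and 1: "ito_rv s t Z Y" and 2: "ito_rv s t Z' Y'"
  shows "ito_rv s t (\<lambda>p. Z p - Z' p) (\<lambda>\<omega>. Y \<omega> - Y' \<omega>)"
  using ito_rv_add[OF s 1 ito_rv_linear[OF s 2 bounded_linear_minus[OF bounded_linear_ident]]] by simp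

lemma ito_rv_sum:
  assumes "finite I" "0 \<le> s" "\<And>i. i \<in> I \<Longrightarrow> ito_rv s t (Z i) (Y i)"
  shows "ito_rv s t (\<lambda>p. \<Sum>i\<in>I. Z i p) (\<lambda>\<omega>. \<Sum>i\<in>I. Y i \<omega>)"
  using assms by (induction I) (auto intro: ito_rv_zero ito_rv_add)

section \<open>Square-integrable processes\<close>

lemma measurable_ident_filtration: "(\<lambda>\<omega>. \<omega>) \<in> measurable M (\<F> t)"
proof (rule measurableI)
  fix A assume "A \<in> sets (\<F> t)"
  moreover from this have "A \<subseteq> space M" using sets.sets_into_space[of A "\<F> t"] by simp
  ultimately show "(\<lambda>\<omega>. \<omega>) -` A \<inter> space M \<in> events"
    using sets_filtration_subset[of t] by (simp add: vimage_def Int_absorb2 subset_iff Int_def conj_commute) (metis (no_types, lifting) Collect_cong Collect_mem_eq subsetD)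
qed simp

text \<open>Progressive measurability at the single time \<open>T\<close> gives joint measurability
  on \<open>[0, T]\<close>. The indicator extends the process by 0 to other times, where nothing is
  known about it.\<close>

lemma prog_measurable_joint:
  fixes X :: "real \<Rightarrow> 'w \<Rightarrow> 'v::euclidean_space"
  assumes X: "prog_measurable M W T X" and T: "0 \<le> T"
  shows "(\<lambda>p. indicator {0..T} (fst p) *\<^sub>R X (fst p) (snd p)) \<in> borel_measurable \<mu>"
proof -
  define S where "S = {0..T} \<times> space M"
  let ?R = "restrict_space \<mu> S"
  have S: "S \<in> sets \<mu>" unfolding S_def by auto
  have spR: "space ?R = S" using sets.sets_into_space[OF S] by (auto simp: space_restrict_space)
  have f: "fst \<in> measurable ?R (restrict_space borel {0..T})"
  proof (rule measurable_restrict_space2)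
    show "fst \<in> space ?R \<rightarrow> {0..T}" unfolding spR S_def by auto
    show "fst \<in> measurable ?R borel" by (rule measurable_restrict_space1) measurable
  qed
  have s: "snd \<in> measurable ?R (\<F> T)"
    by (rule measurable_restrict_space1, rule measurable_compose[OF measurable_snd measurable_ident_filtration])
  have "(\<lambda>(s, \<omega>). X s \<omega>) \<in> borel_measurable (restrict_space borel {0..T} \<Otimes>\<^sub>M \<F> T)"
    using X T by (auto simp: prog_measurable_def)
  from measurable_compose[OF measurable_Pair[OF f s] this]
  have "(\<lambda>p. X (fst p) (snd p)) \<in> borel_measurable ?R" by (simp add: case_prod_unfold)
  then have "(\<lambda>p. indicator S p *\<^sub>R X (fst p) (snd p)) \<in> borel_measurable \<mu>"
    using S by (subst (asm) borel_measurable_restrict_space_iff) auto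
  then show ?thesis
    by (rule measurable_cong[THEN iffD1, rotated]) (auto simp: S_def indicator_def space_pair_measure)
qed

lemma prog_measurable_at:
  fixes X :: "real \<Rightarrow> 'w \<Rightarrow> 'v::euclidean_space"
  assumes X: "prog_measurable M W T X" and t: "t \<in> {0..T}"
  shows "X t \<in> borel_measurable (\<F> t)"
proof -
  have 1: "(\<lambda>\<omega>. t) \<in> measurable (\<F> t) (restrict_space borel {0..t})"
    using t by (intro measurable_restrict_space2) auto
  have "(\<lambda>(s, \<omega>). X s \<omega>) \<in> borel_measurable (restrict_space borel {0..t} \<Otimes>\<^sub>M \<F> t)"
    using X t by (auto simp: prog_measurable_def)
  from measurable_compose[OF measurable_Pair[OF 1 measurable_ident] this]
  show ?thesis by simp
qed

lemma prog_measurable_at_M: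
  fixes X :: "real \<Rightarrow> 'w \<Rightarrow> 'v::euclidean_space"
  shows "prog_measurable M W T X \<Longrightarrow> t \<in> {0..T} \<Longrightarrow> X t \<in> borel_measurable M"
  by (rule filtration_measurable_M[OF prog_measurable_at])

section \<open>Jointly measurable processes and their time integrals\<close>

definition joint_meas :: "real \<Rightarrow> (real \<Rightarrow> 'w \<Rightarrow> 'v::euclidean_space) \<Rightarrow> bool" where
  "joint_meas T X \<longleftrightarrow> (\<lambda>p. indicator {0..T} (fst p) *\<^sub>R X (fst p) (snd p)) \<in> borel_measurable \<mu>"

lemma joint_meas_proc_on:
  assumes "joint_meas T X" "0 \<le> s" "t \<le> T"
  shows "proc_on s t X \<in> borel_measurable \<mu>"
proof -
  have [measurable]: "(\<lambda>p. indicator {0..T} (fst p) *\<^sub>R X (fst p) (snd p)) \<in> borel_measurable \<mu>"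
    using assms by (simp add: joint_meas_def)
  have eq: "proc_on s t X = (\<lambda>p. indicator {s<..t} (fst p) *\<^sub>R (indicator {0..T} (fst p) *\<^sub>R X (fst p) (snd p)))"
    using assms by (auto simp: proc_on_def indicator_def fun_eq_iff)
  show ?thesis unfolding eq by measurable
qed

lemma joint_meas_path:
  assumes "joint_meas T X" "\<omega> \<in> space M"
  shows "(\<lambda>r. indicator {0..T} r *\<^sub>R X r \<omega>) \<in> borel_measurable borel"
proof -
  have m: "(\<lambda>r. (r, \<omega>)) \<in> measurable borel \<mu>" using assms(2) by measurable
  show ?thesis
    using measurable_compose[OF m assms(1)[unfolded joint_meas_def]] by simp
qed

lemma joint_meas_at:
  assumes "joint_meas T X" "t \<in> {0..T}"
  shows "X t \<in> borel_measurable M"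
proof -
  have m: "(\<lambda>\<omega>. (t, \<omega>)) \<in> measurable M \<mu>" by measurable
  show ?thesis
    using measurable_compose[OF m assms(1)[unfolded joint_meas_def]] assms(2) by simp
qed

lemma nn_sq_proc_on:
  assumes "joint_meas T X" "0 \<le> s" "t \<le> T"
  shows "nn_sq \<mu> (proc_on s t X) = (\<integral>\<^sup>+ r. indicator {s<..t} r * nn_sq M (X r) \<partial>lborel)"
    "nn_sq \<mu> (proc_on s t X) =
      (\<integral>\<^sup>+ \<omega>. (\<integral>\<^sup>+ r. indicator {s<..t} r * ennreal ((norm (X r \<omega>))\<^sup>2) \<partial>lborel) \<partial>M)"
    "(\<lambda>\<omega>. \<integral>\<^sup>+ r. indicator {s<..t} r * ennreal ((norm (X r \<omega>))\<^sup>2) \<partial>lborel) \<in> borel_measurable M"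
    "(\<lambda>r. indicator {s<..t} r * nn_sq M (X r)) \<in> borel_measurable borel"
proof -
  note [measurable] = joint_meas_proc_on[OF assms]
  have m: "(\<lambda>p. ennreal ((norm (proc_on s t X p))\<^sup>2)) \<in> borel_measurable \<mu>" by measurable
  have eq: "ennreal ((norm (proc_on s t X (r, \<omega>)))\<^sup>2) = indicator {s<..t} r * ennreal ((norm (X r \<omega>))\<^sup>2)" for r \<omega>
    by (auto simp: proc_on_def indicator_def)
  have eq2: "(\<integral>\<^sup>+ \<omega>. indicator {s<..t} r * ennreal ((norm (X r \<omega>))\<^sup>2) \<partial>M) = indicator {s<..t} r * nn_sq M (X r)" for r
    by (simp add: nn_sq_def indicator_def)
  show "nn_sq \<mu> (proc_on s t X) = (\<integral>\<^sup>+ r. indicator {s<..t} r * nn_sq M (X r) \<partial>lborel)"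
    unfolding nn_sq_def[of "lborel \<Otimes>\<^sub>M M"] using nn_integral_fst[OF m] by (simp add: eq eq2)
  show "nn_sq \<mu> (proc_on s t X) =
      (\<integral>\<^sup>+ \<omega>. (\<integral>\<^sup>+ r. indicator {s<..t} r * ennreal ((norm (X r \<omega>))\<^sup>2) \<partial>lborel) \<partial>M)"
    unfolding nn_sq_def[of "lborel \<Otimes>\<^sub>M M"] using LM.nn_integral_snd[OF m] by (simp add: eq)
  have sw: "(\<lambda>(\<omega>, r). ennreal ((norm (proc_on s t X (r, \<omega>)))\<^sup>2)) \<in> borel_measurable (M \<Otimes>\<^sub>M lborel)"
    using measurable_compose[OF measurable_pair_swap' m] by (simp add: case_prod_unfold)
  show "(\<lambda>\<omega>. \<integral>\<^sup>+ r. indicator {s<..t} r * ennreal ((norm (X r \<omega>))\<^sup>2) \<partial>lborel) \<in> borel_measurable M"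
    using lborel.borel_measurable_nn_integral_fst[OF sw] by (simp add: eq)
  show "(\<lambda>r. indicator {s<..t} r * nn_sq M (X r)) \<in> borel_measurable borel"
    using borel_measurable_nn_integral_fst[OF m] by (simp add: eq eq2)
qed

lemma nn_sq_time_integral_le:
  assumes "joint_meas T X" "0 \<le> s" "s \<le> t" "t \<le> T"
  shows "nn_sq M (\<lambda>\<omega>. LINT r:{s..t}|lborel. X r \<omega>) \<le> ennreal (t - s) * nn_sq \<mu> (proc_on s t X)"
proof -
  have "nn_sq M (\<lambda>\<omega>. LINT r:{s..t}|lborel. X r \<omega>) \<le>
      (\<integral>\<^sup>+ \<omega>. ennreal (t - s) * (\<integral>\<^sup>+ r. indicator {s<..t} r * ennreal ((norm (X r \<omega>))\<^sup>2) \<partial>lborel) \<partial>M)"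
    unfolding nn_sq_def[of M] by (intro nn_integral_mono norm_set_integral_square_le assms)
  also have "\<dots> = ennreal (t - s) * nn_sq \<mu> (proc_on s t X)"
    unfolding nn_sq_proc_on(2)[OF assms(1,2,4)]
    by (rule nn_integral_cmult[OF nn_sq_proc_on(3)[OF assms(1,2,4)]])
  finally show ?thesis .
qed

lemma time_integral_measurable:
  assumes "joint_meas T X" "0 \<le> s" "t \<le> T"
  shows "(\<lambda>\<omega>. LINT r:{s..t}|lborel. X r \<omega>) \<in> borel_measurable M"
proof -
  have [measurable]: "(\<lambda>p. indicator {0..T} (fst p) *\<^sub>R X (fst p) (snd p)) \<in> borel_measurable \<mu>"
    using assms by (simp add: joint_meas_def)
  have "(\<lambda>p. indicator {s..t} (fst p) *\<^sub>R (indicator {0..T} (fst p) *\<^sub>R X (fst p) (snd p))) \<in> borel_measurable \<mu>"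
    by measurable
  from measurable_compose[OF measurable_pair_swap' this]
  have "(\<lambda>(\<omega>, r). indicator {s..t} r *\<^sub>R (indicator {0..T} r *\<^sub>R X r \<omega>)) \<in> borel_measurable (M \<Otimes>\<^sub>M lborel)"
    by (simp add: case_prod_unfold)
  from lborel.borel_measurable_lebesgue_integral[OF this]
  have "(\<lambda>\<omega>. \<integral>r. indicator {s..t} r *\<^sub>R (indicator {0..T} r *\<^sub>R X r \<omega>) \<partial>lborel) \<in> borel_measurable M" .
  moreover have "(\<lambda>r. indicator {s..t} r *\<^sub>R (indicator {0..T} r *\<^sub>R X r \<omega>)) = (\<lambda>r. indicator {s..t} r *\<^sub>R X r \<omega>)" for \<omega>
    using assms by (auto simp: indicator_def fun_eq_iff)
  ultimately show ?thesis unfolding set_lebesgue_integral_def by simp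
qed

definition L2_joint :: "real \<Rightarrow> (real \<Rightarrow> 'w \<Rightarrow> 'v::euclidean_space) \<Rightarrow> bool" where
  "L2_joint T X \<longleftrightarrow> joint_meas T X \<and> nn_sq \<mu> (proc_on 0 T X) < \<infinity>"

lemma nn_sq_proc_on_mono:
  assumes "s \<le> s'" "t' \<le> t"
  shows "nn_sq N (proc_on s' t' X) \<le> nn_sq N (proc_on s t X)"
  unfolding nn_sq_def using assms by (intro nn_integral_mono) (auto simp: proc_on_def indicator_def)

lemma L2_prog_joint:
  assumes "L2_prog M W T X" "0 \<le> T"
  shows "L2_joint T X"
proof -
  have j: "joint_meas T X" unfolding joint_meas_def
    by (rule prog_measurable_joint) (use assms in \<open>auto simp: L2_prog_def\<close>)
  have "nn_sq \<mu> (proc_on 0 T X) \<le> L2norm_sq M T X"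
    unfolding nn_sq_proc_on(2)[OF j order_refl order_refl] L2norm_sq_def
    by (intro nn_integral_mono) (auto simp: indicator_def)
  then show ?thesis using assms j by (auto simp: L2_joint_def L2_prog_def)
qed

lemma L2_joint_finite:
  assumes "L2_joint T X" "0 \<le> s" "t \<le> T"
  shows "nn_sq \<mu> (proc_on s t X) < \<infinity>"
proof -
  have "nn_sq \<mu> (proc_on s t X) \<le> nn_sq \<mu> (proc_on 0 T X)"
    using assms by (intro nn_sq_proc_on_mono) auto
  also have "\<dots> < \<infinity>" using assms by (simp add: L2_joint_def)
  finally show ?thesis .
qed

text \<open>On a bounded interval \<open>1 + |X|^2\<close> dominates \<open>|X|\<close>. Pathwise
  integrability is what allows time integrals to be added and split along almost every path.\<close>

lemma L2_joint_AE_integrable: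
  fixes X :: "real \<Rightarrow> 'w \<Rightarrow> 'v::euclidean_space"
  assumes X: "L2_joint T X" and T: "0 \<le> T"
  shows "AE \<omega> in M. set_integrable lborel {0..T} (\<lambda>r. X r \<omega>)"
proof -
  have j: "joint_meas T X" using X by (simp add: L2_joint_def)
  have "AE \<omega> in M. (\<integral>\<^sup>+ r. indicator {0<..T} r * ennreal ((norm (X r \<omega>))\<^sup>2) \<partial>lborel) \<noteq> \<infinity>"
    using X nn_sq_proc_on(3)[OF j order_refl order_refl]
    by (intro nn_integral_noteq_infinite) (auto simp: L2_joint_def nn_sq_proc_on(2)[OF j order_refl order_refl])
  then show ?thesis
    using AE_space
  proof eventually_elim
    case (elim \<omega>)
    define f where "f = (\<lambda>r. indicator {0..T} r *\<^sub>R X r \<omega>)"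
    have [measurable]: "f \<in> borel_measurable borel" unfolding f_def by (rule joint_meas_path[OF j elim(2)])
    have "(\<integral>\<^sup>+ r. ennreal (norm (f r)) \<partial>lborel) \<le>
        (\<integral>\<^sup>+ r. indicator {0..T} r + indicator {0<..T} r * ennreal ((norm (X r \<omega>))\<^sup>2) \<partial>lborel)"
    proof (rule nn_integral_mono_AE)
      show "AE r in lborel. ennreal (norm (f r)) \<le> indicator {0..T} r + indicator {0<..T} r * ennreal ((norm (X r \<omega>))\<^sup>2)"
        using AE_lborel_singleton[of 0]
      proof eventually_elim
        case (elim r)
        have "2 * norm (X r \<omega>) \<le> 1 + (norm (X r \<omega>))\<^sup>2"
          using sum_squares_bound[of 1 "norm (X r \<omega>)"] by simp
        then have "norm (X r \<omega>) \<le> 1 + (norm (X r \<omega>))\<^sup>2"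
          using norm_ge_zero[of "X r \<omega>"] by linarith
        then have "ennreal (norm (X r \<omega>)) \<le> ennreal (1 + (norm (X r \<omega>))\<^sup>2)" by (rule ennreal_leI)
        then show ?case using elim by (auto simp: f_def indicator_def ennreal_plus)
      qed
    qed
    also have "\<dots> = (\<integral>\<^sup>+ r. indicator {0..T} r \<partial>lborel) + (\<integral>\<^sup>+ r. indicator {0<..T} r * ennreal ((norm (X r \<omega>))\<^sup>2) \<partial>lborel)"
    proof (rule nn_integral_add)
      have "(\<lambda>r. indicator {0<..T} r * ennreal ((norm (f r))\<^sup>2)) \<in> borel_measurable lborel" by measurable
      moreover have "(\<lambda>r. indicator {0<..T} r * ennreal ((norm (f r))\<^sup>2)) = (\<lambda>r. indicator {0<..T} r * ennreal ((norm (X r \<omega>))\<^sup>2))"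
        by (auto simp: f_def indicator_def fun_eq_iff)
      ultimately show "(\<lambda>r. indicator {0<..T} r * ennreal ((norm (X r \<omega>))\<^sup>2)) \<in> borel_measurable lborel" by simp
    qed auto
    also have "\<dots> < \<infinity>" using elim(1) T by (auto simp: top.not_eq_extremum)
    finally have "integrable lborel f" by (auto simp: integrable_iff_bounded)
    then show ?case by (simp add: set_integrable_def f_def)
  qed
qed

text \<open>The simple processes approximating \<open>Z\<close> on \<open>[0, T]\<close> are
  restricted to \<open>(s, t]\<close> by moving their nodes into \<open>[s, t]\<close>; the
  restricted integrals are differences of the original ones at \<open>t\<close> and
  \<open>s\<close>.\<close>

lemma has_ito_integral_ito_rv:
  fixes Z Y :: "real \<Rightarrow> 'w \<Rightarrow> 'v::euclidean_space"
  assumes I: "has_ito_integral M W T Z Y" and st: "0 \<le> s" "s \<le> t" "t \<le> T"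
  shows "ito_rv s t (proc_on s t Z) (\<lambda>\<omega>. Y t \<omega> - Y s \<omega>)"
proof -
  from I obtain k \<tau> \<xi> where sd: "\<And>j. simple_data M W T (k j) (\<tau> j) (\<xi> j)"
    and lim1: "(\<lambda>j. L2norm_sq M T (\<lambda>t \<omega>. Z t \<omega> - simple_process (k j) (\<tau> j) (\<xi> j) t \<omega>)) \<longlonglongrightarrow> 0"
    and lim2: "\<And>t. t \<in> {0..T} \<Longrightarrow>
       (\<lambda>j. nn_sq M (\<lambda>\<omega>. Y t \<omega> - simple_ito W (k j) (\<tau> j) (\<xi> j) t \<omega>)) \<longlonglongrightarrow> 0"
    unfolding has_ito_integral_def nn_sq_def by blast
  have Z: "L2_prog M W T Z" and Y: "prog_measurable M W T Y"
    using I by (auto simp: has_ito_integral_def)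
  have jZ: "joint_meas T Z" using L2_prog_joint[OF Z] st by (simp add: L2_joint_def)
  have Ym: "Y t \<in> borel_measurable M" "Y s \<in> borel_measurable M"
    using prog_measurable_at_M[OF Y] st by auto
  define clip where "clip u = max s (min t u)" for u
  \<comment> \<open>Pieces starting after \<open>t\<close> are discarded rather than collapsed to
    the point \<open>t\<close>: their coefficients need not be measurable at \<open>t\<close>. For
    the others the node can only move to the right, which preserves adaptedness.\<close>
  define L where "L j = map (\<lambda>i. (clip (\<tau> j i), clip (\<tau> j (Suc i)), \<xi> j i)) (filter (\<lambda>i. \<tau> j i \<le> t) [0..<k j])" for j
  have ad: "adapted_elem s t (L j)" for j
  proof -
    have "s \<le> clip (\<tau> j i) \<and> clip (\<tau> j i) \<le> clip (\<tau> j (Suc i)) \<and> clip (\<tau> j (Suc i)) \<le> t \<and>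
      \<xi> j i \<in> borel_measurable (\<F> (clip (\<tau> j i))) \<and> (\<exists>K. \<forall>\<omega>\<in>space M. norm (\<xi> j i \<omega>) \<le> K)"
      if i: "i < k j" "\<tau> j i \<le> t" for i
    proof (intro conjI)
      have m: "\<tau> j i \<le> \<tau> j (Suc i)" "\<xi> j i \<in> borel_measurable (\<F> (\<tau> j i))"
        "\<exists>K. \<forall>\<omega>\<in>space M. norm (\<xi> j i \<omega>) \<le> K"
        using sd[of j] i unfolding simple_data_def by blast+
      show "s \<le> clip (\<tau> j i)" "clip (\<tau> j i) \<le> clip (\<tau> j (Suc i))" "clip (\<tau> j (Suc i)) \<le> t"
        using m(1) st by (auto simp: clip_def)
      have "\<tau> j i \<le> clip (\<tau> j i)" using i(2) by (simp add: clip_def)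
      then show "\<xi> j i \<in> borel_measurable (\<F> (clip (\<tau> j i)))" using m(2) by (rule filtration_measurable_mono)
      show "\<exists>K. \<forall>\<omega>\<in>space M. norm (\<xi> j i \<omega>) \<le> K" by (rule m(3))
    qed
    then show ?thesis by (auto simp: adapted_elem_def L_def)
  qed
  have proc: "elem_proc (L j) p = proc_on s t (simple_process (k j) (\<tau> j) (\<xi> j)) p" for j p
  proof -
    have "elem_proc (L j) p = (\<Sum>i\<leftarrow>filter (\<lambda>i. \<tau> j i \<le> t) [0..<k j].
        indicator {clip (\<tau> j i)<..clip (\<tau> j (Suc i))} (fst p) *\<^sub>R \<xi> j i (snd p))"
      by (simp add: elem_proc_def L_def comp_def)
    also have "\<dots> = (\<Sum>i<k j. indicator {s<..t} (fst p) *\<^sub>R (indicator {\<tau> j i<..\<tau> j (Suc i)} (fst p) *\<^sub>R \<xi> j i (snd p)))"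
      unfolding sum_list_filter_upt
    proof (rule sum.cong[OF refl])
      fix i assume "i \<in> {..<k j}"
      then have "\<tau> j i \<le> \<tau> j (Suc i)" using sd[of j] by (simp add: simple_data_def)
      then show "(if \<tau> j i \<le> t then indicator {clip (\<tau> j i)<..clip (\<tau> j (Suc i))} (fst p) *\<^sub>R \<xi> j i (snd p) else 0) =
          indicator {s<..t} (fst p) *\<^sub>R (indicator {\<tau> j i<..\<tau> j (Suc i)} (fst p) *\<^sub>R \<xi> j i (snd p))"
        using st by (auto simp: indicator_def clip_def)
    qed
    finally show ?thesis by (simp only: proc_on_def simple_process_def scaleR_sum_right)
  qed
  have int: "elem_int W (L j) \<omega> = simple_ito W (k j) (\<tau> j) (\<xi> j) t \<omega> - simple_ito W (k j) (\<tau> j) (\<xi> j) s \<omega>" for j \<omega>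
  proof -
    have "elem_int W (L j) \<omega> = (\<Sum>i\<leftarrow>filter (\<lambda>i. \<tau> j i \<le> t) [0..<k j].
        (W (clip (\<tau> j (Suc i))) \<omega> - W (clip (\<tau> j i)) \<omega>) *\<^sub>R \<xi> j i \<omega>)"
      by (simp add: elem_int_def L_def comp_def)
    also have "\<dots> = (\<Sum>i<k j. (W (min (\<tau> j (Suc i)) t) \<omega> - W (min (\<tau> j i) t) \<omega>) *\<^sub>R \<xi> j i \<omega> -
        (W (min (\<tau> j (Suc i)) s) \<omega> - W (min (\<tau> j i) s) \<omega>) *\<^sub>R \<xi> j i \<omega>)"
      unfolding sum_list_filter_upt
    proof (rule sum.cong[OF refl])
      fix i assume "i \<in> {..<k j}"
      then have le: "\<tau> j i \<le> \<tau> j (Suc i)" using sd[of j] by (simp add: simple_data_def)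
      \<comment> \<open>The last summand does not depend on \<open>u\<close> and cancels in
        increments.\<close>
      have cl: "W (clip u) \<omega> = W (min u t) \<omega> - W (min u s) \<omega> + W s \<omega>" for u
        using st by (auto simp: clip_def min_def max_def)
      show "(if \<tau> j i \<le> t then (W (clip (\<tau> j (Suc i))) \<omega> - W (clip (\<tau> j i)) \<omega>) *\<^sub>R \<xi> j i \<omega> else 0) =
          (W (min (\<tau> j (Suc i)) t) \<omega> - W (min (\<tau> j i) t) \<omega>) *\<^sub>R \<xi> j i \<omega> -
          (W (min (\<tau> j (Suc i)) s) \<omega> - W (min (\<tau> j i) s) \<omega>) *\<^sub>R \<xi> j i \<omega>"
      proof (cases "\<tau> j i \<le> t")
        case True
        then show ?thesis by (simp add: cl scaleR_diff_left[symmetric])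
      next
        case False
        then have "min (\<tau> j (Suc i)) t = t" "min (\<tau> j i) t = t" "min (\<tau> j (Suc i)) s = s" "min (\<tau> j i) s = s"
          using le st by auto
        then show ?thesis using False by simp
      qed
    qed
    finally show ?thesis by (simp add: simple_ito_def sum_subtractf)
  qed
  have simm: "simple_ito W (k j) (\<tau> j) (\<xi> j) u \<in> borel_measurable M" if "0 \<le> u" for j u
  proof -
    have \<tau>0: "0 \<le> \<tau> j i" if "i \<le> k j" for i
      using that
    proof (induction i)
      case 0
      then show ?case using sd[of j] by (simp add: simple_data_def)
    next
      case (Suc i)
      moreover have "\<tau> j i \<le> \<tau> j (Suc i)" using Suc.prems sd[of j] by (simp add: simple_data_def)
      ultimately show ?case by simp
    qed
    have "(\<lambda>\<omega>. (W (min (\<tau> j (Suc i)) u) \<omega> - W (min (\<tau> j i) u) \<omega>) *\<^sub>R \<xi> j i \<omega>) \<in> borel_measurable M"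
      if "i < k j" for i
    proof -
      have "0 \<le> \<tau> j i" "0 \<le> \<tau> j (Suc i)" using \<tau>0 that by auto
      then have [measurable]: "W (min (\<tau> j (Suc i)) u) \<in> borel_measurable M" "W (min (\<tau> j i) u) \<in> borel_measurable M"
        using \<open>0 \<le> u\<close> by auto
      have [measurable]: "\<xi> j i \<in> borel_measurable M"
        using sd[of j] that by (auto simp: simple_data_def intro: filtration_measurable_M)
      show ?thesis by measurable
    qed
    then show ?thesis unfolding simple_ito_def[abs_def] by (intro borel_measurable_sum) auto
  qed
  have "(\<lambda>j. nn_sq \<mu> (\<lambda>p. proc_on s t Z p - elem_proc (L j) p)) \<longlonglongrightarrow> 0"
  proof (rule tendsto_0_squeeze[OF lim1])
    fix j
    define D where "D = (\<lambda>t \<omega>. Z t \<omega> - simple_process (k j) (\<tau> j) (\<xi> j) t \<omega>)"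
    have eq: "(\<lambda>p. proc_on s t Z p - elem_proc (L j) p) = proc_on s t D"
      unfolding proc D_def by (auto simp: proc_on_def scaleR_diff_right)
    have m: "proc_on s t D \<in> borel_measurable \<mu>"
      unfolding eq[symmetric] using joint_meas_proc_on[OF jZ] elem_measurable(2)[OF ad] st by auto
    have "nn_sq \<mu> (proc_on s t D) =
        (\<integral>\<^sup>+ \<omega>. (\<integral>\<^sup>+ r. ennreal ((norm (proc_on s t D (r, \<omega>)))\<^sup>2) \<partial>lborel) \<partial>M)"
      unfolding nn_sq_def by (rule LM.nn_integral_snd[symmetric]) (use m in measurable)
    also have "\<dots> \<le> L2norm_sq M T D"
      unfolding L2norm_sq_def using st
      by (intro nn_integral_mono) (auto simp: proc_on_def indicator_def)
    finally show "nn_sq \<mu> (\<lambda>p. proc_on s t Z p - elem_proc (L j) p) \<le> ennreal 1 *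
        L2norm_sq M T (\<lambda>t \<omega>. Z t \<omega> - simple_process (k j) (\<tau> j) (\<xi> j) t \<omega>)"
      unfolding eq by (simp add: D_def)
  qed
  moreover have "(\<lambda>j. nn_sq M (\<lambda>\<omega>. (Y t \<omega> - Y s \<omega>) - elem_int W (L j) \<omega>)) \<longlonglongrightarrow> 0"
  proof -
    have eq: "(\<lambda>\<omega>. (Y t \<omega> - Y s \<omega>) - elem_int W (L j) \<omega>) =
      (\<lambda>\<omega>. (Y t \<omega> - simple_ito W (k j) (\<tau> j) (\<xi> j) t \<omega>) + - (Y s \<omega> - simple_ito W (k j) (\<tau> j) (\<xi> j) s \<omega>))" for j
      by (auto simp: int)
    have "(\<lambda>j. nn_sq M (\<lambda>\<omega>. - (Y s \<omega> - simple_ito W (k j) (\<tau> j) (\<xi> j) s \<omega>))) \<longlonglongrightarrow> 0"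
      unfolding nn_sq_minus using lim2[of s] st by simp
    moreover have "(\<lambda>j. nn_sq M (\<lambda>\<omega>. Y t \<omega> - simple_ito W (k j) (\<tau> j) (\<xi> j) t \<omega>)) \<longlonglongrightarrow> 0"
      using lim2[of t] st by simp
    moreover note [measurable] = Ym simm[of t] simm[of s]
    ultimately show ?thesis
      unfolding eq using st by (intro nn_sq_add_tendsto_0) (auto intro!: borel_measurable_diff borel_measurable_uminus simm Ym)
  qed
  moreover have "proc_on s t Z \<in> borel_measurable \<mu>"
    by (rule joint_meas_proc_on[OF jZ st(1,3)])
  moreover have "(\<lambda>\<omega>. Y t \<omega> - Y s \<omega>) \<in> borel_measurable M"
    by (rule borel_measurable_diff[OF Ym])
  ultimately show ?thesis
    unfolding ito_rv_def using ad by blast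
qed

lemma joint_meas_add: "joint_meas T X \<Longrightarrow> joint_meas T Y \<Longrightarrow> joint_meas T (\<lambda>r \<omega>. X r \<omega> + Y r \<omega>)"
  unfolding joint_meas_def by (simp only: scaleR_add_right) (rule borel_measurable_add)

lemma joint_meas_diff: "joint_meas T X \<Longrightarrow> joint_meas T Y \<Longrightarrow> joint_meas T (\<lambda>r \<omega>. X r \<omega> - Y r \<omega>)"
  unfolding joint_meas_def by (simp only: scaleR_diff_right) (rule borel_measurable_diff)

lemma joint_meas_matrix:
  fixes Q :: "real \<Rightarrow> real^'n^'m"
  assumes Q: "(\<lambda>r. indicator {0..T} r *\<^sub>R Q r) \<in> borel_measurable borel" and X: "joint_meas T X"
  shows "joint_meas T (\<lambda>r \<omega>. Q r *v X r \<omega>)"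
proof -
  note [measurable] = Q X[unfolded joint_meas_def]
  have eq: "(\<lambda>p. indicator {0..T} (fst p) *\<^sub>R (Q (fst p) *v X (fst p) (snd p))) =
      (\<lambda>p. (indicator {0..T} (fst p) *\<^sub>R Q (fst p)) *v (indicator {0..T} (fst p) *\<^sub>R X (fst p) (snd p)))"
    by (auto simp: indicator_def fun_eq_iff)
  have "(\<lambda>p. indicator {0..T} (fst p) *\<^sub>R Q (fst p)) \<in> borel_measurable \<mu>"
    by measurable
  then show ?thesis unfolding joint_meas_def eq
    by (rule borel_measurable_matrix_vector) (rule X[unfolded joint_meas_def])
qed

lemma joint_meas_const:
  assumes [measurable]: "Z \<in> borel_measurable M"
  shows "joint_meas T (\<lambda>r. Z)"
  unfolding joint_meas_def by measurable

lemma nn_sq_proc_on_bound: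
  assumes X: "joint_meas T X" and st: "0 \<le> s" "t \<le> T" and c: "0 \<le> c"
    and le: "\<And>r \<omega>. r \<in> {s<..t} \<Longrightarrow> norm (Y r \<omega>) \<le> c * norm (X r \<omega>)"
  shows "nn_sq \<mu> (proc_on s t Y) \<le> ennreal (c\<^sup>2) * nn_sq \<mu> (proc_on s t X)"
proof (rule nn_sq_scale_le[OF joint_meas_proc_on[OF X st] _ c])
  show "norm (proc_on s t Y p) \<le> c * norm (proc_on s t X p)" for p
    using le[of "fst p" "snd p"] by (auto simp: proc_on_def indicator_def)
qed

lemma proc_on_add: "proc_on s t (\<lambda>r \<omega>. X r \<omega> + Y r \<omega>) = (\<lambda>p. proc_on s t X p + proc_on s t Y p)"
  by (auto simp: proc_on_def scaleR_add_right)

lemma nn_sq_proc_on_add: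
  assumes "joint_meas T X" "joint_meas T Y" "0 \<le> s" "t \<le> T"
  shows "nn_sq \<mu> (proc_on s t (\<lambda>r \<omega>. X r \<omega> + Y r \<omega>)) \<le>
    2 * nn_sq \<mu> (proc_on s t X) + 2 * nn_sq \<mu> (proc_on s t Y)"
  unfolding proc_on_add by (rule nn_sq_add_le) (use assms joint_meas_proc_on in blast)+

lemma L2_joint_add:
  assumes "L2_joint T X" "L2_joint T Y"
  shows "L2_joint T (\<lambda>r \<omega>. X r \<omega> + Y r \<omega>)"
proof -
  have "nn_sq \<mu> (proc_on 0 T (\<lambda>r \<omega>. X r \<omega> + Y r \<omega>)) \<le>
    2 * nn_sq \<mu> (proc_on 0 T X) + 2 * nn_sq \<mu> (proc_on 0 T Y)"
    using assms by (intro nn_sq_proc_on_add) (auto simp: L2_joint_def)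
  also have "\<dots> < \<infinity>" using assms by (simp add: L2_joint_def ennreal_mult_less_top)
  finally show ?thesis using assms by (simp add: L2_joint_def joint_meas_add)
qed

lemma L2_joint_matrix:
  fixes Q :: "real \<Rightarrow> real^'n^'m"
  assumes Q: "(\<lambda>r. indicator {0..T} r *\<^sub>R Q r) \<in> borel_measurable borel"
    and c: "\<And>r. r \<in> {0..T} \<Longrightarrow> norm (Q r) \<le> c" and X: "L2_joint T X"
  shows "L2_joint T (\<lambda>r \<omega>. Q r *v X r \<omega>)"
proof -
  have j: "joint_meas T X" using X by (simp add: L2_joint_def)
  have "nn_sq \<mu> (proc_on 0 T (\<lambda>r \<omega>. Q r *v X r \<omega>)) \<le> ennreal (\<bar>c\<bar>\<^sup>2) * nn_sq \<mu> (proc_on 0 T X)"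
  proof (rule nn_sq_proc_on_bound[OF j])
    fix r \<omega> assume "r \<in> {0<..T}"
    then have "norm (Q r) \<le> \<bar>c\<bar>" using c[of r] by simp
    then show "norm (Q r *v X r \<omega>) \<le> \<bar>c\<bar> * norm (X r \<omega>)"
      by (rule norm_matrix_vector_le_bound) simp
  qed auto
  also have "\<dots> < \<infinity>" using X by (simp add: L2_joint_def ennreal_mult_less_top)
  finally show ?thesis using joint_meas_matrix[OF Q j] by (simp add: L2_joint_def)
qed

lemma L2_joint_diff:
  assumes "L2_joint T X" "L2_joint T Y"
  shows "L2_joint T (\<lambda>r \<omega>. X r \<omega> - Y r \<omega>)"
proof -
  have "proc_on 0 T (\<lambda>r \<omega>. - Y r \<omega>) = (\<lambda>p. - proc_on 0 T Y p)" by (auto simp: proc_on_def)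
  then have "L2_joint T (\<lambda>r \<omega>. - Y r \<omega>)"
    using assms(2) by (simp add: L2_joint_def joint_meas_def nn_sq_minus)
  from L2_joint_add[OF assms(1) this] show ?thesis by simp
qed

lemma nn_sq_proc_on_combine:
  assumes "joint_meas T X" "0 \<le> u" "u \<le> v" "v \<le> w" "w \<le> T"
  shows "nn_sq \<mu> (proc_on u w X) =
    nn_sq \<mu> (proc_on u v X) + nn_sq \<mu> (proc_on v w X)"
proof -
  have eq: "proc_on u w X = (\<lambda>p. proc_on u v X p + proc_on v w X p)"
    using proc_on_combine[OF assms(3,4)] by (intro ext) blast
  have "proc_on u v X p = 0 \<or> proc_on v w X p = 0" for p
    by (auto simp: proc_on_def indicator_def)
  then show ?thesis
    unfolding eq using assms by (intro nn_sq_disjoint_add joint_meas_proc_on[OF assms(1)]) auto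
qed

lemma nn_sq_proc_on_partition:
  assumes X: "joint_meas T X" and r: "\<And>i. i < n \<Longrightarrow> r i \<le> r (Suc i)" "0 \<le> r 0" "r n \<le> T"
  shows "(\<Sum>i<n. nn_sq \<mu> (proc_on (r i) (r (Suc i)) X)) = nn_sq \<mu> (proc_on (r 0) (r n) X)"
  using r
proof (induction n)
  case 0
  have "proc_on (r 0) (r 0) X = (\<lambda>_. 0)" by (auto simp: proc_on_def)
  then show ?case by simp
next
  case (Suc n)
  have mono: "r 0 \<le> r i" if "i \<le> n" for i
    using that
  proof (induction i)
    case (Suc i)
    then show ?case using Suc.prems \<open>\<And>i. i < Suc n \<Longrightarrow> r i \<le> r (Suc i)\<close>[of i] by simp
  qed simp
  have le: "r n \<le> r (Suc n)" using Suc.prems by simp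
  have "(\<Sum>i<n. nn_sq \<mu> (proc_on (r i) (r (Suc i)) X)) = nn_sq \<mu> (proc_on (r 0) (r n) X)"
    using Suc le by simp
  then show ?case
    using nn_sq_proc_on_combine[OF X Suc.prems(2) mono[OF order_refl] le Suc.prems(3)] by simp
qed

text \<open>The mean squares add up since the pieces have disjoint supports. The other conjuncts
  feed the induction: the vanishing beyond \<open>r n\<close> gives disjointness from the next
  piece.\<close>

lemma nn_sq_partition:
  assumes X: "\<And>i. i < n \<Longrightarrow> joint_meas T (X i)" and r: "\<And>i. i < n \<Longrightarrow> r i \<le> r (Suc i)" "0 \<le> r 0" "r n \<le> T"
  shows "nn_sq \<mu> (\<lambda>p. \<Sum>i<n. proc_on (r i) (r (Suc i)) (X i) p) =
     (\<Sum>i<n. nn_sq \<mu> (proc_on (r i) (r (Suc i)) (X i)))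
     \<and> (\<lambda>p. \<Sum>i<n. proc_on (r i) (r (Suc i)) (X i) p) \<in> borel_measurable \<mu>
     \<and> (\<forall>p. r n < fst p \<longrightarrow> (\<Sum>i<n. proc_on (r i) (r (Suc i)) (X i) p) = 0) \<and> 0 \<le> r n"
  using X r
proof (induction n)
  case (Suc n)
  let ?S = "\<lambda>p. \<Sum>i<n. proc_on (r i) (r (Suc i)) (X i) p"
  have le: "r n \<le> r (Suc n)" using Suc.prems by simp
  have IH: "nn_sq \<mu> ?S = (\<Sum>i<n. nn_sq \<mu> (proc_on (r i) (r (Suc i)) (X i)))"
    "?S \<in> borel_measurable \<mu>" "\<And>p. r n < fst p \<Longrightarrow> ?S p = 0" "0 \<le> r n"
    using Suc.IH Suc.prems le by auto
  have m: "proc_on (r n) (r (Suc n)) (X n) \<in> borel_measurable \<mu>"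
    by (rule joint_meas_proc_on[OF Suc.prems(1)]) (use IH(4) Suc.prems in auto)
  have "nn_sq \<mu> (\<lambda>p. ?S p + proc_on (r n) (r (Suc n)) (X n) p) =
      nn_sq \<mu> ?S + nn_sq \<mu> (proc_on (r n) (r (Suc n)) (X n))"
  proof (rule nn_sq_disjoint_add[OF IH(2) m])
    fix p show "?S p = 0 \<or> proc_on (r n) (r (Suc n)) (X n) p = 0"
      using IH(3)[of p] by (cases "r n < fst p") (auto simp: proc_on_def)
  qed
  moreover have "?S p + proc_on (r n) (r (Suc n)) (X n) p = 0" if "r (Suc n) < fst p" for p
    using IH(3)[of p] that le by (simp add: proc_on_def)
  moreover have "(\<lambda>p. ?S p + proc_on (r n) (r (Suc n)) (X n) p) \<in> borel_measurable \<mu>"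
    using IH(2) m by (rule borel_measurable_add)
  ultimately show ?case using IH(1,4) le by simp
qed simp

lemma has_ito_differential_increment:
  assumes X: "has_ito_differential M W T X b s" and uv: "0 \<le> u" "u \<le> v" "v \<le> T"
  shows "\<exists>D. ito_rv u v (proc_on u v s) D \<and>
    (AE \<omega> in M. X v \<omega> - X u \<omega> = (LINT r:{u..v}|lborel. b r \<omega>) + D \<omega>)"
proof -
  obtain Y where Y: "has_ito_integral M W T s Y"
    "AE \<omega> in M. \<forall>t\<in>{0..T}. X t \<omega> = X 0 \<omega> + (LINT r:{0..t}|lborel. b r \<omega>) + Y t \<omega>"
    using X by (auto simp: has_ito_differential_def)
  have "L2_joint T b"
    by (rule L2_prog_joint) (use X uv in \<open>auto simp: has_ito_differential_def\<close>)
  from L2_joint_AE_integrable[OF this] uv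
  have "AE \<omega> in M. set_integrable lborel {0..T} (\<lambda>r. b r \<omega>)" by simp
  with Y(2) have "AE \<omega> in M. X v \<omega> - X u \<omega> = (LINT r:{u..v}|lborel. b r \<omega>) + (Y v \<omega> - Y u \<omega>)"
  proof eventually_elim
    case (elim \<omega>)
    have "set_integrable lborel {0..v} (\<lambda>r. b r \<omega>)"
      by (rule set_integrable_subset[OF elim(2)]) (use uv in auto)
    from set_integral_combine[OF this uv(1,2)] show ?case
      using elim(1)[rule_format, of u] elim(1)[rule_format, of v] uv by simp
  qed
  with has_ito_integral_ito_rv[OF Y(1) uv] show ?thesis by blast
qed

lemma joint_meas_norm:
  fixes X :: "real \<Rightarrow> 'w \<Rightarrow> 'v::euclidean_space"
  assumes X: "joint_meas T X"
  shows "joint_meas T (\<lambda>r \<omega>. norm (X r \<omega>))"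
proof -
  have "(\<lambda>p. indicator {0..T} (fst p) *\<^sub>R norm (X (fst p) (snd p))) =
      (\<lambda>p. norm (indicator {0..T} (fst p) *\<^sub>R X (fst p) (snd p)))" by auto
  then show ?thesis using measurable_compose[OF X[unfolded joint_meas_def] borel_measurable_norm] by (simp only: joint_meas_def)
qed

lemma nn_sq_proc_on_norm: "nn_sq N (proc_on s t (\<lambda>r \<omega>. norm (X r \<omega>))) = nn_sq N (proc_on s t X)"
  by (simp add: nn_sq_def proc_on_def)

text \<open>\<open>proc_on\<close> omits time 0, which is a null set. The measurability of the zero
  set allows almost sure statements at almost every time to be combined on the product.\<close>

lemma joint_meas_zero_AE:
  fixes X :: "real \<Rightarrow> 'w \<Rightarrow> 'v::euclidean_space"
  assumes X: "joint_meas T X" and zero: "nn_sq \<mu> (proc_on 0 T X) = 0"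
  shows "AE (t, \<omega>) in restrict_space lborel {0..T} \<Otimes>\<^sub>M M. X t \<omega> = 0"
proof -
  let ?N = "restrict_space lborel {0..T}"
  interpret N: sigma_finite_measure ?N
    by (rule sigma_finite_measure_restrict_space) (auto intro: lborel.sigma_finite_measure_axioms)
  interpret NM: pair_sigma_finite ?N M ..
  have f: "fst \<in> measurable (?N \<Otimes>\<^sub>M M) lborel"
    using measurable_compose[OF measurable_fst measurable_restrict_space1[OF measurable_ident[of lborel]]] by simp
  have m: "(\<lambda>p. X (fst p) (snd p)) \<in> borel_measurable (?N \<Otimes>\<^sub>M M)"
  proof -
    have "(\<lambda>p. indicator {0..T} (fst p) *\<^sub>R X (fst p) (snd p)) \<in> borel_measurable (?N \<Otimes>\<^sub>M M)"
      using measurable_compose[OF measurable_Pair[OF f measurable_snd] X[unfolded joint_meas_def]] by simp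
    then show ?thesis
      by (rule measurable_cong[THEN iffD1, rotated]) (auto simp: space_pair_measure space_restrict_space)
  qed
  have "AE t in lborel. indicator {0<..T} t * nn_sq M (X t) = 0"
    using zero nn_sq_proc_on(4)[OF X order_refl order_refl] unfolding nn_sq_proc_on(1)[OF X order_refl order_refl]
    by (subst (asm) nn_integral_0_iff_AE) auto
  then have "AE t in lborel. t \<in> {0..T} \<longrightarrow> (AE \<omega> in M. X t \<omega> = 0)"
    using AE_lborel_singleton[of 0]
  proof eventually_elim
    case (elim t)
    show ?case
    proof
      assume t: "t \<in> {0..T}"
      then have "nn_sq M (X t) = 0" using elim by (auto simp: indicator_def)
      then show "AE \<omega> in M. X t \<omega> = 0" using joint_meas_at[OF X t] by (intro nn_sq_eq_0_AE)
    qed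
  qed
  then have "AE t in ?N. AE \<omega> in M. X t \<omega> = 0"
    by (subst AE_restrict_space_iff) auto
  then have "AE t in ?N. AE \<omega> in M. X (fst (t, \<omega>)) (snd (t, \<omega>)) = 0" by simp
  note [measurable] = m
  have "{p \<in> space (?N \<Otimes>\<^sub>M M). X (fst p) (snd p) = 0} \<in> sets (?N \<Otimes>\<^sub>M M)" by measurable
  then have "AE p in ?N \<Otimes>\<^sub>M M. X (fst p) (snd p) = 0"
    by (rule NM.AE_pair_measure) fact
  then show ?thesis by (simp add: case_prod_unfold)
qed

end

section \<open>Decoupling\<close>

text \<open>Two Ito processes and a Lipschitz matrix function with \<open>P' = - F\<close>. The
  structure of the coefficients is abstracted away; it reappears only as the bound on
  \<open>g\<close> when the vanishing is proved.\<close>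

locale decoupling = brownian M W for M :: "'w measure" and W +
  fixes T L :: real and x y bx sx bY sY :: "real \<Rightarrow> 'w \<Rightarrow> real^'n" and P F :: "real \<Rightarrow> real^'n^'n"
  assumes T_pos: "T > 0"
    and dx: "has_ito_differential M W T x bx sx" and dy: "has_ito_differential M W T y bY sY"
    and L2: "L2_prog M W T x" "L2_prog M W T y"
    and P_diff: "\<And>s t. 0 \<le> s \<Longrightarrow> s \<le> t \<Longrightarrow> t \<le> T \<Longrightarrow> P s - P t = (LINT r:{s..t}|lborel. F r)"
    and F_int: "set_integrable lborel {0..T} F"
    and F_bound: "\<And>r. r \<in> {0..T} \<Longrightarrow> norm (F r) \<le> L"
begin

definition \<eta> where "\<eta> r \<omega> = y r \<omega> - P r *v x r \<omega>"
definition \<zeta> where "\<zeta> r \<omega> = sY r \<omega> - P r *v sx r \<omega>"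
text \<open>The drift of \<open>\<eta>\<close> predicted by the product rule, with the sign of
  \<open>F\<close> coming from \<open>P' = - F\<close>.\<close>

definition g where "g r \<omega> = bY r \<omega> - P r *v bx r \<omega> + F r *v x r \<omega>"

lemma L_nonneg: "L \<ge> 0"
  using F_bound[of 0] T_pos order_trans[OF norm_ge_zero] by auto

lemma F_measurable: "(\<lambda>r. indicator {0..T} r *\<^sub>R F r) \<in> borel_measurable borel"
  using F_int unfolding set_integrable_def by (drule_tac borel_measurable_integrable) simp

lemma P_lipschitz:
  assumes "0 \<le> s" "s \<le> t" "t \<le> T"
  shows "norm (P t - P s) \<le> L * (t - s)"
proof -
  have i: "set_integrable lborel {s..t} F" by (rule set_integrable_subset[OF F_int]) (use assms in auto)
  have "(F has_integral (P s - P t)) (cbox s t)"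
    using set_borel_integral_eq_integral[OF i] P_diff[OF assms] by (simp add: cbox_interval has_integral_iff)
  then have "norm (P s - P t) \<le> L * (t - s)"
    using has_integral_bound[OF L_nonneg, of F "P s - P t" s t] F_bound assms by (simp add: cbox_interval)
  then show ?thesis by (simp add: norm_minus_commute)
qed

lemma P_continuous: "continuous_on {0..T} P"
proof -
  have "dist (P s) (P t) \<le> L * dist s t" if "s \<in> {0..T}" "t \<in> {0..T}" for s t
    using P_lipschitz[of s t] P_lipschitz[of t s] that
    by (cases "s \<le> t") (auto simp: dist_norm norm_minus_commute)
  then have "L-lipschitz_on {0..T} P" by (rule lipschitz_onI[OF _ L_nonneg])
  then show ?thesis by (rule lipschitz_on_continuous_on)
qed

lemma P_measurable: "(\<lambda>r. indicator {0..T} r *\<^sub>R P r) \<in> borel_measurable borel"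
  by (rule borel_measurable_continuous_on_indicator[OF _ P_continuous]) simp

lemma P_bounded: "\<exists>c. \<forall>r\<in>{0..T}. norm (P r) \<le> c"
  using compact_imp_bounded[OF compact_continuous_image[OF P_continuous compact_Icc]]
  unfolding bounded_iff by auto

lemma L2_processes:
  "L2_joint T x" "L2_joint T y" "L2_joint T bx" "L2_joint T bY" "L2_joint T sx" "L2_joint T sY"
proof -
  have "L2_prog M W T bx" "L2_prog M W T bY" "L2_prog M W T sx" "L2_prog M W T sY"
    using dx dy unfolding has_ito_differential_def has_ito_integral_def by blast+
  then show "L2_joint T x" "L2_joint T y" "L2_joint T bx" "L2_joint T bY" "L2_joint T sx" "L2_joint T sY"
    using L2 by (auto intro!: L2_prog_joint less_imp_le[OF T_pos])
qed

lemma joint_meas_processes: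
  "joint_meas T x" "joint_meas T y" "joint_meas T bx" "joint_meas T bY" "joint_meas T sx" "joint_meas T sY"
  using L2_processes by (simp_all add: L2_joint_def)

lemma L2_combined: "L2_joint T \<eta>" "L2_joint T \<zeta>" "L2_joint T g"
proof -
  obtain c where c: "\<And>r. r \<in> {0..T} \<Longrightarrow> norm (P r) \<le> c" using P_bounded by blast
  note m = L2_joint_matrix[OF P_measurable c]
  show "L2_joint T \<eta>" unfolding \<eta>_def[abs_def] by (intro L2_joint_diff m L2_processes)
  show "L2_joint T \<zeta>" unfolding \<zeta>_def[abs_def] by (intro L2_joint_diff m L2_processes)
  show "L2_joint T g" unfolding g_def[abs_def]
    by (intro L2_joint_add L2_joint_diff m L2_processes L2_joint_matrix[OF F_measurable F_bound])
qed

lemma joint_meas_combined: "joint_meas T \<eta>" "joint_meas T \<zeta>" "joint_meas T g"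
  using L2_combined by (simp_all add: L2_joint_def)

lemma \<eta>_adapted: "t \<in> {0..T} \<Longrightarrow> \<eta> t \<in> borel_measurable (\<F> t)"
proof -
  assume t: "t \<in> {0..T}"
  have [measurable]: "x t \<in> borel_measurable (\<F> t)" "y t \<in> borel_measurable (\<F> t)"
    using L2 t by (auto simp: L2_prog_def intro: prog_measurable_at)
  show ?thesis unfolding \<eta>_def[abs_def] by measurable
qed

text \<open>The mean square of the coefficients of \<open>x\<close>. It controls the errors of
  freezing and is additive over adjacent intervals, so the errors of a partition can be
  summed.\<close>

definition energy :: "real \<Rightarrow> real \<Rightarrow> ennreal" where
  "energy u v = nn_sq \<mu> (proc_on u v bx) + nn_sq \<mu> (proc_on u v sx)"

lemma x_increment:
  assumes "0 \<le> u" "u \<le> v" "v \<le> T"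
  shows "nn_sq M (\<lambda>\<omega>. x v \<omega> - x u \<omega>) \<le>
    2 * (ennreal (v - u) * nn_sq \<mu> (proc_on u v bx)) + 2 * nn_sq \<mu> (proc_on u v sx)"
proof -
  obtain D where D: "ito_rv u v (proc_on u v sx) D"
    "AE \<omega> in M. x v \<omega> - x u \<omega> = (LINT r:{u..v}|lborel. bx r \<omega>) + D \<omega>"
    using has_ito_differential_increment[OF dx assms] by blast
  have "nn_sq M (\<lambda>\<omega>. x v \<omega> - x u \<omega>) = nn_sq M (\<lambda>\<omega>. (LINT r:{u..v}|lborel. bx r \<omega>) + D \<omega>)"
    by (rule nn_sq_cong_AE[OF D(2)])
  also have "\<dots> \<le> 2 * nn_sq M (\<lambda>\<omega>. LINT r:{u..v}|lborel. bx r \<omega>) + 2 * nn_sq M D"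
    by (rule nn_sq_add_le[OF time_integral_measurable[OF joint_meas_processes(3)] ito_rv_measurable(2)[OF D(1)]])
      (use assms in auto)
  also have "\<dots> \<le> 2 * (ennreal (v - u) * nn_sq \<mu> (proc_on u v bx)) + 2 * nn_sq \<mu> (proc_on u v sx)"
    unfolding ito_rv_isometry[OF assms(1) D(1)]
    by (intro add_mono mult_left_mono nn_sq_time_integral_le[OF joint_meas_processes(3) assms]) auto
  finally show ?thesis .
qed

lemma energy_finite: "0 \<le> u \<Longrightarrow> v \<le> T \<Longrightarrow> energy u v < \<infinity>"
  using L2_joint_finite[OF L2_processes(3)] L2_joint_finite[OF L2_processes(5)] by (simp add: energy_def)

text \<open>One step of the discrete product rule for \<open>P x\<close>, with \<open>P\<close> frozen at the left end of the
  interval in the stochastic integral.\<close>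

lemma step:
  assumes uv: "0 \<le> u" "u \<le> v" "v \<le> T"
  shows "\<exists>D e. ito_rv u v (proc_on u v (\<lambda>r \<omega>. sY r \<omega> - P u *v sx r \<omega>)) D \<and> e \<in> borel_measurable M \<and>
     nn_sq M e \<le> ennreal (L\<^sup>2 * (6 * T + 4) * (v - u)\<^sup>2) * energy u v \<and>
     (AE \<omega> in M. \<eta> v \<omega> - \<eta> u \<omega> = (LINT r:{u..v}|lborel. g r \<omega>) + D \<omega> + e \<omega>)"
proof -
  obtain DX where DX: "ito_rv u v (proc_on u v sx) DX"
    "AE \<omega> in M. x v \<omega> - x u \<omega> = (LINT r:{u..v}|lborel. bx r \<omega>) + DX \<omega>"
    using has_ito_differential_increment[OF dx uv] by blast
  obtain DY where DY: "ito_rv u v (proc_on u v sY) DY"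
    "AE \<omega> in M. y v \<omega> - y u \<omega> = (LINT r:{u..v}|lborel. bY r \<omega>) + DY \<omega>"
    using has_ito_differential_increment[OF dy uv] by blast
  define D where "D \<omega> = DY \<omega> - P u *v DX \<omega>" for \<omega>
  have D: "ito_rv u v (proc_on u v (\<lambda>r \<omega>. sY r \<omega> - P u *v sx r \<omega>)) D"
  proof -
    have eq: "proc_on u v (\<lambda>r \<omega>. sY r \<omega> - P u *v sx r \<omega>) = (\<lambda>p. proc_on u v sY p - P u *v proc_on u v sx p)"
      by (auto simp: proc_on_def indicator_def)
    show ?thesis unfolding eq D_def[abs_def]
      by (intro ito_rv_diff ito_rv_linear[OF uv(1) DX(1) matrix_vector_mul_bounded_linear] DY(1) uv)
  qed
  \<comment> \<open>The increment of \<open>P x\<close> is written as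
    \<open>P u (x v - x u) + (P v - P u) x v\<close>. Compared with the integral of \<open>g\<close>
    this leaves two errors: \<open>e1\<close> from freezing \<open>P\<close> in the drift, and
    \<open>e2\<close> from taking \<open>x\<close> at the right end in the term with
    \<open>F\<close>.\<close>
  define e1 where "e1 r \<omega> = (P r - P u) *v bx r \<omega>" for r \<omega>
  define e2 where "e2 r \<omega> = F r *v (x v \<omega> - x r \<omega>)" for r \<omega>
  define e where "e \<omega> = (LINT r:{u..v}|lborel. e1 r \<omega> + e2 r \<omega>)" for \<omega>
  have Pu: "(\<lambda>r. indicator {0..T} r *\<^sub>R (P r - P u)) \<in> borel_measurable borel"
    using P_measurable by (simp add: scaleR_diff_right)
  obtain c where c: "\<And>r. r \<in> {0..T} \<Longrightarrow> norm (P r) \<le> c" using P_bounded by blast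
  have le1: "L2_joint T e1" unfolding e1_def[abs_def]
  proof (rule L2_joint_matrix[OF Pu _ L2_processes(3)])
    fix r assume "r \<in> {0..T}"
    then show "norm (P r - P u) \<le> c + c" using c[of r] c[of u] uv by (intro norm_diff_le_bound) auto
  qed
  have xv: "x v \<in> borel_measurable M" using joint_meas_at[OF joint_meas_processes(1)] uv by simp
  have jd: "joint_meas T (\<lambda>r \<omega>. x v \<omega> - x r \<omega>)"
    by (intro joint_meas_diff joint_meas_const xv joint_meas_processes)
  have j1: "joint_meas T e1" using le1 by (simp add: L2_joint_def)
  have j2: "joint_meas T e2" unfolding e2_def[abs_def] by (rule joint_meas_matrix[OF F_measurable jd])
  have j: "joint_meas T (\<lambda>r \<omega>. e1 r \<omega> + e2 r \<omega>)" by (rule joint_meas_add[OF j1 j2])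
  have em: "e \<in> borel_measurable M"
    unfolding e_def[abs_def] by (rule time_integral_measurable[OF j]) (use uv in auto)
  \<comment> \<open>Integration over time costs one factor \<open>v - u\<close> by Cauchy-Schwarz,
    and the mean squares of \<open>e1\<close> and \<open>e2\<close> bring another; the Lipschitz
    bound on \<open>P\<close> and the increment estimate for \<open>x\<close> are responsible for
    the latter.\<close>
  have bound: "nn_sq M e \<le> ennreal (L\<^sup>2 * (6 * T + 4) * (v - u)\<^sup>2) * energy u v"
  proof -
    obtain B where B: "nn_sq \<mu> (proc_on u v bx) = ennreal B" "B \<ge> 0"
      using L2_joint_finite[OF L2_processes(3) uv(1,3)] by (cases "nn_sq \<mu> (proc_on u v bx)") auto
    obtain S where S: "nn_sq \<mu> (proc_on u v sx) = ennreal S" "S \<ge> 0"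
      using L2_joint_finite[OF L2_processes(5) uv(1,3)] by (cases "nn_sq \<mu> (proc_on u v sx)") auto
    define h where "h = v - u"
    have h: "0 \<le> h" "h \<le> T" using uv by (auto simp: h_def)
    have b1: "nn_sq \<mu> (proc_on u v e1) \<le> ennreal ((L * h)\<^sup>2 * B)"
    proof -
      have "nn_sq \<mu> (proc_on u v e1) \<le> ennreal ((L * h)\<^sup>2) * nn_sq \<mu> (proc_on u v bx)"
      proof (rule nn_sq_proc_on_bound[OF joint_meas_processes(3) uv(1,3)])
        fix r \<omega> assume r: "r \<in> {u<..v}"
        have "norm (P r - P u) \<le> L * (r - u)" by (rule P_lipschitz) (use r uv in auto)
        also have "\<dots> \<le> L * h" using r L_nonneg by (intro mult_left_mono) (auto simp: h_def)
        finally show "norm (e1 r \<omega>) \<le> L * h * norm (bx r \<omega>)"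
          unfolding e1_def by (rule norm_matrix_vector_le_bound) simp
      qed (use h L_nonneg in simp)
      then show ?thesis using B by (simp add: ennreal_mult)
    qed
    have b2: "nn_sq \<mu> (proc_on u v e2) \<le> ennreal (L\<^sup>2 * (h * (2 * h * B + 2 * S)))"
    proof -
      have "nn_sq \<mu> (proc_on u v e2) \<le> ennreal (L\<^sup>2) * nn_sq \<mu> (proc_on u v (\<lambda>r \<omega>. x v \<omega> - x r \<omega>))"
      proof (rule nn_sq_proc_on_bound[OF jd uv(1,3) L_nonneg])
        fix r \<omega> assume "r \<in> {u<..v}"
        then have "norm (F r) \<le> L" using uv by (intro F_bound) auto
        then show "norm (e2 r \<omega>) \<le> L * norm (x v \<omega> - x r \<omega>)"
          unfolding e2_def by (rule norm_matrix_vector_le_bound) simp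
      qed
      also have "nn_sq \<mu> (proc_on u v (\<lambda>r \<omega>. x v \<omega> - x r \<omega>)) \<le> (\<integral>\<^sup>+ r. indicator {u..v} r * ennreal (2 * h * B + 2 * S) \<partial>lborel)"
        unfolding nn_sq_proc_on(1)[OF jd uv(1,3)]
      proof (intro nn_integral_mono)
        fix r
        show "indicator {u<..v} r * nn_sq M (\<lambda>\<omega>. x v \<omega> - x r \<omega>) \<le> indicator {u..v} r * ennreal (2 * h * B + 2 * S)"
        proof (cases "r \<in> {u<..v}")
          case True
          then have "nn_sq M (\<lambda>\<omega>. x v \<omega> - x r \<omega>) \<le>
              2 * (ennreal (v - r) * nn_sq \<mu> (proc_on r v bx)) + 2 * nn_sq \<mu> (proc_on r v sx)"
            using uv by (intro x_increment) auto
          also have "\<dots> \<le> 2 * (ennreal h * ennreal B) + 2 * ennreal S"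
            unfolding B(1)[symmetric] S(1)[symmetric] using True
            by (intro add_mono mult_mono nn_sq_proc_on_mono ennreal_leI) (auto simp: h_def)
          also have "\<dots> = ennreal (2 * h * B + 2 * S)"
            using h B S by (simp add: ennreal_plus ennreal_mult mult.assoc)
          finally show ?thesis using True by simp
        qed simp
      qed
      also have "\<dots> = ennreal (h * (2 * h * B + 2 * S))"
        using uv h B S by (subst nn_integral_multc) (auto simp: h_def ennreal_mult)
      finally show ?thesis using h B S by (simp add: ennreal_mult mult_left_mono)
    qed
    have "nn_sq M e \<le> ennreal h * nn_sq \<mu> (proc_on u v (\<lambda>r \<omega>. e1 r \<omega> + e2 r \<omega>))"
      unfolding e_def[abs_def] h_def by (rule nn_sq_time_integral_le[OF j uv])
    also have "\<dots> \<le> ennreal h * (2 * nn_sq \<mu> (proc_on u v e1) + 2 * nn_sq \<mu> (proc_on u v e2))"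
      by (intro mult_left_mono nn_sq_proc_on_add[OF j1 j2 uv(1,3)]) auto
    also have "\<dots> \<le> ennreal h * (2 * ennreal ((L * h)\<^sup>2 * B) + 2 * ennreal (L\<^sup>2 * (h * (2 * h * B + 2 * S))))"
      by (intro mult_left_mono add_mono b1 b2) auto
    also have "\<dots> = ennreal (h * (2 * ((L * h)\<^sup>2 * B) + 2 * (L\<^sup>2 * (h * (2 * h * B + 2 * S)))))"
      using h B S by (simp add: ennreal_plus ennreal_mult)
    also have "\<dots> \<le> ennreal (L\<^sup>2 * (6 * T + 4) * h\<^sup>2 * (B + S))"
    proof (rule ennreal_leI)
      \<comment> \<open>This identity produces the constants 6 and 4; the extra factor
        \<open>h\<close> beside \<open>B\<close> is then replaced by \<open>T\<close>.\<close>
      have eq: "h * (2 * ((L * h)\<^sup>2 * B) + 2 * (L\<^sup>2 * (h * (2 * h * B + 2 * S)))) = L\<^sup>2 * h\<^sup>2 * (6 * h * B + 4 * S)"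
        by (simp add: power2_eq_square algebra_simps)
      have "6 * h * B \<le> 6 * T * B" "0 \<le> T * S" using h B S T_pos by (auto intro!: mult_right_mono)
      then have "6 * h * B + 4 * S \<le> (6 * T + 4) * (B + S)" using B S by (simp add: algebra_simps)
      then have "L\<^sup>2 * h\<^sup>2 * (6 * h * B + 4 * S) \<le> L\<^sup>2 * h\<^sup>2 * ((6 * T + 4) * (B + S))"
        by (intro mult_left_mono) auto
      then show "h * (2 * ((L * h)\<^sup>2 * B) + 2 * (L\<^sup>2 * (h * (2 * h * B + 2 * S)))) \<le> L\<^sup>2 * (6 * T + 4) * h\<^sup>2 * (B + S)"
        unfolding eq by (simp add: mult_ac)
    qed
    also have "\<dots> = ennreal (L\<^sup>2 * (6 * T + 4) * (v - u)\<^sup>2) * energy u v"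
      unfolding energy_def B(1) S(1) using B(2) S(2) T_pos
      by (simp add: h_def ennreal_mult ennreal_plus)
    finally show ?thesis .
  qed
  have T0: "0 \<le> T" using T_pos by simp
  have LFx: "L2_joint T (\<lambda>r \<omega>. F r *v x r \<omega>)"
    by (rule L2_joint_matrix[OF F_measurable F_bound L2_processes(1)])
  have "AE \<omega> in M. \<eta> v \<omega> - \<eta> u \<omega> = (LINT r:{u..v}|lborel. g r \<omega>) + D \<omega> + e \<omega>"
    using DX(2) DY(2) L2_joint_AE_integrable[OF L2_processes(3) T0] L2_joint_AE_integrable[OF L2_processes(4) T0]
      L2_joint_AE_integrable[OF L2_combined(3) T0] L2_joint_AE_integrable[OF le1 T0]
      L2_joint_AE_integrable[OF LFx T0]
  proof eventually_elim
    case (elim \<omega>)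
    have sub: "set_integrable lborel {u..v} f" if "set_integrable lborel {0..T} f" for f :: "real \<Rightarrow> 'z::euclidean_space"
      by (rule set_integrable_subset[OF that]) (use uv in auto)
    have iF: "set_integrable lborel {u..v} F" by (rule sub[OF F_int])
    have Fi: "((\<lambda>r. F r *v x v \<omega>) has_integral ((P u - P v) *v x v \<omega>)) {u..v}"
    proof -
      have "(F has_integral (P u - P v)) {u..v}"
        using set_borel_integral_eq_integral[OF iF] P_diff[OF uv] by (simp add: has_integral_iff)
      from has_integral_linear[OF this bounded_bilinear.bounded_linear_left[OF bounded_bilinear_matrix_vector, of "x v \<omega>"]]
      show ?thesis by (simp add: comp_def)
    qed
    have iFv: "set_integrable lborel {u..v} (\<lambda>r. F r *v x v \<omega>)"
      using integrable_bounded_linear[OF bounded_bilinear.bounded_linear_left[OF bounded_bilinear_matrix_vector, of "x v \<omega>"] iF[unfolded set_integrable_def]]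
      by (simp add: set_integrable_def flip: scaleR_matrix_vector_assoc)
    have i2: "set_integrable lborel {u..v} (\<lambda>r. e2 r \<omega>)"
      unfolding e2_def matrix_vector_mult_diff_distrib by (intro set_integral_diff(1) iFv sub elim)
    have ie: "set_integrable lborel {u..v} (\<lambda>r. e1 r \<omega> + e2 r \<omega>)"
      by (intro set_integral_add(1) i2 sub elim)
    have bxi: "((\<lambda>r. bx r \<omega>) has_integral (LINT r:{u..v}|lborel. bx r \<omega>)) {u..v}"
      and bYi: "((\<lambda>r. bY r \<omega>) has_integral (LINT r:{u..v}|lborel. bY r \<omega>)) {u..v}"
      and gi: "((\<lambda>r. g r \<omega>) has_integral (LINT r:{u..v}|lborel. g r \<omega>)) {u..v}"
      and ei: "((\<lambda>r. e1 r \<omega> + e2 r \<omega>) has_integral e \<omega>) {u..v}"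
      using set_borel_integral_eq_integral[OF sub[OF elim(3)]] set_borel_integral_eq_integral[OF sub[OF elim(4)]]
        set_borel_integral_eq_integral[OF sub[OF elim(5)]] set_borel_integral_eq_integral[OF ie]
      by (simp_all add: has_integral_iff e_def)
    have "((\<lambda>r. bY r \<omega> - P u *v bx r \<omega> + F r *v x v \<omega>) has_integral
        ((LINT r:{u..v}|lborel. bY r \<omega>) - P u *v (LINT r:{u..v}|lborel. bx r \<omega>) + (P u - P v) *v x v \<omega>)) {u..v}"
      using has_integral_linear[OF bxi matrix_vector_mul_bounded_linear[of "P u"]]
      by (intro has_integral_add has_integral_diff bYi Fi) (simp add: comp_def)
    moreover have "(\<lambda>r. bY r \<omega> - P u *v bx r \<omega> + F r *v x v \<omega>) = (\<lambda>r. g r \<omega> + (e1 r \<omega> + e2 r \<omega>))"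
      by (auto simp: g_def e1_def e2_def algebra_simps)
    ultimately have "(LINT r:{u..v}|lborel. g r \<omega>) + e \<omega> =
        (LINT r:{u..v}|lborel. bY r \<omega>) - P u *v (LINT r:{u..v}|lborel. bx r \<omega>) + (P u - P v) *v x v \<omega>"
      using has_integral_unique[OF has_integral_add[OF gi ei]] by simp
    moreover have "(LINT r:{u..v}|lborel. bx r \<omega>) = x v \<omega> - x u \<omega> - DX \<omega>"
      "(LINT r:{u..v}|lborel. bY r \<omega>) = y v \<omega> - y u \<omega> - DY \<omega>"
      using elim(1,2) by simp_all
    ultimately have "(LINT r:{u..v}|lborel. g r \<omega>) + e \<omega> = y v \<omega> - y u \<omega> - DY \<omega>
        - P u *v (x v \<omega> - x u \<omega> - DX \<omega>) + (P u - P v) *v x v \<omega>" by simp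
    then show ?case
      by (simp add: \<eta>_def D_def algebra_simps)
  qed
  then show ?thesis using D em bound by blast
qed

text \<open>The stochastic integrals of the \<open>n\<close> steps are added up before orthogonality
  is used, so that the Pythagorean identity is applied once over the whole interval. What remains of
  the freezing errors is of order \<open>1/n\<close>.\<close>

lemma estimate_partition:
  assumes t: "0 \<le> t" "t < t'" "t' \<le> T" and fin: "AE \<omega> in M. \<eta> t' \<omega> = 0" and n: "n > 0"
    and En: "energy t t' = ennreal En" "En \<ge> 0"
  shows "nn_sq M (\<eta> t) + nn_sq \<mu> (proc_on t t' \<zeta>) \<le>
    ennreal (4 * (t' - t)) * nn_sq \<mu> (proc_on t t' g)
    + ennreal ((4 * (L\<^sup>2 * (6 * T + 4)) + 2 * L\<^sup>2) * (t' - t)\<^sup>2 * En / real n)"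
proof -
  define h where "h = (t' - t) / real n"
  define r where "r i = t + real i * h" for i
  have h: "h > 0" using t n by (simp add: h_def)
  have r0: "r 0 = t" and rn: "r n = t'" using n by (simp_all add: r_def h_def)
  have rS: "r (Suc i) - r i = h" for i by (simp add: r_def algebra_simps)
  have rm: "r i \<le> r (Suc i)" for i using rS[of i] h by simp
  have ri: "0 \<le> r i" "t \<le> r i" for i using t h by (simp_all add: r_def)
  have rT: "r (Suc i) \<le> t'" "r (Suc i) \<le> T" if "i < n" for i
  proof -
    have "real (Suc i) * h \<le> real n * h" using that h by (intro mult_right_mono) auto
    then show "r (Suc i) \<le> t'" using rn by (simp add: r_def)
    then show "r (Suc i) \<le> T" using t by simp
  qed
  \<comment> \<open>The integrand with \<open>P\<close> frozen at the left node of the piece, so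
    that it differs from \<open>\<zeta>\<close> by at most \<open>L * h\<close> times the norm of
    \<open>sx\<close>.\<close>
  define X where "X i r' \<omega> = sY r' \<omega> - P (r i) *v sx r' \<omega>" for i r' \<omega>
  have LX: "L2_joint T (X i)" for i
  proof -
    have "(\<lambda>s. indicator {0..T} s *\<^sub>R P (r i)) \<in> borel_measurable borel" by measurable
    then show ?thesis unfolding X_def[abs_def]
      by (intro L2_joint_diff L2_processes L2_joint_matrix[where c = "norm (P (r i))"]) auto
  qed
  then have jX: "joint_meas T (X i)" for i by (simp add: L2_joint_def)
  define C where "C = L\<^sup>2 * (6 * T + 4)"
  have C: "C \<ge> 0" using T_pos by (simp add: C_def)
  define \<Phi> where "\<Phi> i D e \<longleftrightarrow> ito_rv (r i) (r (Suc i)) (proc_on (r i) (r (Suc i)) (X i)) D \<and> e \<in> borel_measurable M \<and>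
     nn_sq M e \<le> ennreal (C * h\<^sup>2) * energy (r i) (r (Suc i)) \<and>
     (AE \<omega> in M. \<eta> (r (Suc i)) \<omega> - \<eta> (r i) \<omega> = (LINT s:{r i..r (Suc i)}|lborel. g s \<omega>) + D \<omega> + e \<omega>)" for i D e
  have "\<forall>i\<in>{..<n}. \<exists>De. \<Phi> i (fst De) (snd De)"
  proof
    fix i assume "i \<in> {..<n}"
    then have "\<exists>D e. \<Phi> i D e"
      unfolding \<Phi>_def X_def[abs_def] C_def using step[OF ri(1) rm rT(2), of i] by (simp add: rS)
    then show "\<exists>De. \<Phi> i (fst De) (snd De)" by auto
  qed
  from bchoice[OF this] obtain De where De: "\<forall>i\<in>{..<n}. \<Phi> i (fst (De i)) (snd (De i))" ..
  define D where "D i = fst (De i)" for i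
  define e where "e i = snd (De i)" for i
  have De: "ito_rv (r i) (r (Suc i)) (proc_on (r i) (r (Suc i)) (X i)) (D i)" "e i \<in> borel_measurable M"
    "nn_sq M (e i) \<le> ennreal (C * h\<^sup>2) * energy (r i) (r (Suc i))"
    "AE \<omega> in M. \<eta> (r (Suc i)) \<omega> - \<eta> (r i) \<omega> = (LINT s:{r i..r (Suc i)}|lborel. g s \<omega>) + D i \<omega> + e i \<omega>"
    if "i < n" for i
    using De that unfolding \<Phi>_def D_def e_def by auto
  define N where "N \<omega> = (\<Sum>i<n. D i \<omega>)" for \<omega>
  define es where "es \<omega> = (\<Sum>i<n. e i \<omega>)" for \<omega>
  define Z where "Z p = (\<Sum>i<n. proc_on (r i) (r (Suc i)) (X i) p)" for p
  define I where "I \<omega> = (LINT s:{t..t'}|lborel. g s \<omega>)" for \<omega>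
  have ito: "ito_rv t t' Z N"
    unfolding Z_def[abs_def] N_def[abs_def]
  proof (rule ito_rv_sum)
    fix i assume "i \<in> {..<n}"
    then have i: "i < n" by simp
    show "ito_rv t t' (proc_on (r i) (r (Suc i)) (X i)) (D i)"
      by (rule ito_rv_mono[OF De(1)[OF i] ri(2) rT(1)[OF i]])
  qed (use t in auto)
  have nZ: "nn_sq \<mu> Z = (\<Sum>i<n. nn_sq \<mu> (proc_on (r i) (r (Suc i)) (X i)))"
    unfolding Z_def[abs_def] using nn_sq_partition[of n T X r] jX rm ri rn t by auto
  have Zfin: "nn_sq \<mu> Z < \<infinity>"
    unfolding nZ using L2_joint_finite[OF LX ri(1)] rT(2) by simp
  have Im: "I \<in> borel_measurable M"
    unfolding I_def[abs_def] by (rule time_integral_measurable[OF joint_meas_combined(3)]) (use t in auto)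
  have esm: "es \<in> borel_measurable M" unfolding es_def[abs_def] using De(2) by (intro borel_measurable_sum) auto
  have \<eta>m: "\<eta> t \<in> borel_measurable (\<F> t)" by (rule \<eta>_adapted) (use t in auto)
  note [measurable] = Im esm filtration_measurable_M[OF \<eta>m] ito_rv_measurable(2)[OF ito]
  have eq: "AE \<omega> in M. \<eta> t \<omega> + N \<omega> = - (I \<omega> + es \<omega>)"
  proof -
    have "AE \<omega> in M. \<forall>i\<in>{..<n}. \<eta> (r (Suc i)) \<omega> - \<eta> (r i) \<omega> = (LINT s:{r i..r (Suc i)}|lborel. g s \<omega>) + D i \<omega> + e i \<omega>"
      using De(4) by (intro AE_finite_allI) auto
    then show ?thesis
      using fin L2_joint_AE_integrable[OF L2_combined(3) less_imp_le[OF T_pos]]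
    proof eventually_elim
      case (elim \<omega>)
      have "\<eta> (r n) \<omega> - \<eta> (r 0) \<omega> = (\<Sum>i<n. \<eta> (r (Suc i)) \<omega> - \<eta> (r i) \<omega>)"
        by (rule sum_lessThan_telescope[symmetric])
      also have "\<dots> = (\<Sum>i<n. (LINT s:{r i..r (Suc i)}|lborel. g s \<omega>) + D i \<omega> + e i \<omega>)"
        using elim(1) by (intro sum.cong) auto
      also have "\<dots> = I \<omega> + N \<omega> + es \<omega>"
        using set_integral_partition[OF elim(3), of n r] rm ri rn t
        by (simp add: sum.distrib N_def es_def I_def r0)
      finally have *: "\<eta> (r n) \<omega> - \<eta> (r 0) \<omega> = I \<omega> + N \<omega> + es \<omega>" .
      have "\<eta> t \<omega> = - (\<eta> (r n) \<omega> - \<eta> (r 0) \<omega>)" using elim(2) by (simp add: r0 rn)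
      then show ?case unfolding * by (simp only:) (simp add: algebra_simps)
    qed
  qed
  have nI: "nn_sq M I \<le> ennreal (t' - t) * nn_sq \<mu> (proc_on t t' g)"
    unfolding I_def[abs_def] by (rule nn_sq_time_integral_le[OF joint_meas_combined(3)]) (use t in auto)
  have esum: "(\<Sum>i<n. energy (r i) (r (Suc i))) = energy t t'"
    unfolding energy_def sum.distrib
    using nn_sq_proc_on_partition[OF joint_meas_processes(3), of n r] nn_sq_proc_on_partition[OF joint_meas_processes(5), of n r]
      rm ri rn r0 t by auto
  have nes: "nn_sq M es \<le> ennreal (C * (t' - t)\<^sup>2 * En / real n)"
  proof -
    have "nn_sq M es \<le> ennreal (real n) * (\<Sum>i<n. nn_sq M (e i))"
      unfolding es_def[abs_def] by (rule nn_sq_sum_le) (rule De(2))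
    also have "\<dots> \<le> ennreal (real n) * (\<Sum>i<n. ennreal (C * h\<^sup>2) * energy (r i) (r (Suc i)))"
      using De(3) by (intro mult_left_mono sum_mono) auto
    also have "\<dots> = ennreal (real n) * (ennreal (C * h\<^sup>2) * ennreal En)"
      by (simp add: sum_distrib_left[symmetric] esum En(1))
    also have "\<dots> = ennreal (real n * (C * h\<^sup>2 * En))" using C En by (simp add: ennreal_mult)
    also have "real n * (C * h\<^sup>2 * En) = C * (t' - t)\<^sup>2 * En / real n"
      using n by (simp add: h_def power2_eq_square field_simps)
    finally show ?thesis .
  qed
  have fin_I_es: "nn_sq M (\<lambda>\<omega>. I \<omega> + es \<omega>) < \<infinity>"
  proof -
    have "nn_sq M I < \<infinity>"
      using nI L2_joint_finite[OF L2_combined(3), of t t'] t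
      by (auto intro!: le_less_trans[OF nI] simp: ennreal_mult_less_top)
    moreover have "nn_sq M es < \<infinity>" by (rule le_less_trans[OF nes]) simp
    ultimately have "2 * nn_sq M I + 2 * nn_sq M es < \<infinity>" by (simp add: ennreal_mult_less_top)
    then show ?thesis by (rule le_less_trans[rotated]) (rule nn_sq_add_le[OF Im esm])
  qed
  \<comment> \<open>Square integrability over time says nothing about a particular \<open>t\<close>.
    Finiteness of the mean square of \<open>\<eta> t\<close> is therefore read off from the equation
    itself.\<close>
  have \<eta>fin: "nn_sq M (\<eta> t) < \<infinity>"
  proof -
    have "nn_sq M (\<eta> t) = nn_sq M (\<lambda>\<omega>. - (I \<omega> + es \<omega>) - N \<omega>)"
    proof (rule nn_sq_cong_AE)
      show "AE \<omega> in M. \<eta> t \<omega> = - (I \<omega> + es \<omega>) - N \<omega>"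
        using eq by eventually_elim (simp add: eq_diff_eq)
    qed
    also have "\<dots> \<le> 2 * nn_sq M (\<lambda>\<omega>. - (I \<omega> + es \<omega>)) + 2 * nn_sq M N"
      by (rule nn_sq_diff_le) measurable
    also have "\<dots> < \<infinity>"
      using fin_I_es Zfin t ito_rv_isometry[OF t(1) ito] by (simp only: nn_sq_minus) (simp add: ennreal_mult_less_top)
    finally show ?thesis .
  qed
  have pyth: "nn_sq M (\<eta> t) + nn_sq \<mu> Z \<le> 2 * nn_sq M I + 2 * nn_sq M es"
  proof -
    have "nn_sq M (\<eta> t) + nn_sq \<mu> Z = nn_sq M (\<lambda>\<omega>. \<eta> t \<omega> + N \<omega>)"
      by (rule ito_rv_pythagoras[OF t(1) ito \<eta>m \<eta>fin, symmetric])
    also have "\<dots> = nn_sq M (\<lambda>\<omega>. I \<omega> + es \<omega>)"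
      using nn_sq_cong_AE[OF eq] nn_sq_minus[of M "\<lambda>\<omega>. I \<omega> + es \<omega>"] by simp
    also have "\<dots> \<le> 2 * nn_sq M I + 2 * nn_sq M es" by (rule nn_sq_add_le[OF Im esm])
    finally show ?thesis .
  qed
  have n\<zeta>: "nn_sq \<mu> (proc_on t t' \<zeta>) \<le> 2 * nn_sq \<mu> Z + ennreal (2 * (L * h)\<^sup>2 * En)"
  proof -
    have part: "nn_sq \<mu> (proc_on (r i) (r (Suc i)) \<zeta>) \<le> 2 * nn_sq \<mu> (proc_on (r i) (r (Suc i)) (X i))
        + ennreal (2 * (L * h)\<^sup>2) * nn_sq \<mu> (proc_on (r i) (r (Suc i)) sx)" if i: "i < n" for i
    proof -
      define d where "d s \<omega> = (P (r i) - P s) *v sx s \<omega>" for s \<omega>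
      have jd: "joint_meas T d"
        unfolding d_def[abs_def] using P_measurable
        by (intro joint_meas_matrix joint_meas_processes) (simp add: scaleR_diff_right)
      have "\<zeta> = (\<lambda>s \<omega>. X i s \<omega> + d s \<omega>)"
        by (auto simp: \<zeta>_def X_def d_def fun_eq_iff algebra_simps)
      then have "nn_sq \<mu> (proc_on (r i) (r (Suc i)) \<zeta>) \<le>
          2 * nn_sq \<mu> (proc_on (r i) (r (Suc i)) (X i)) + 2 * nn_sq \<mu> (proc_on (r i) (r (Suc i)) d)"
        using nn_sq_proc_on_add[OF jX jd ri(1) rT(2)[OF i]] by simp
      also have "nn_sq \<mu> (proc_on (r i) (r (Suc i)) d) \<le> ennreal ((L * h)\<^sup>2) * nn_sq \<mu> (proc_on (r i) (r (Suc i)) sx)"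
      proof (rule nn_sq_proc_on_bound[OF joint_meas_processes(5) ri(1) rT(2)[OF i]])
        fix s \<omega> assume s: "s \<in> {r i<..r (Suc i)}"
        have "norm (P (r i) - P s) \<le> L * (s - r i)"
          using P_lipschitz[of "r i" s] s ri(1)[of i] rT(2)[OF i] by (simp add: norm_minus_commute)
        also have "\<dots> \<le> L * h" using s rS[of i] L_nonneg by (intro mult_left_mono) auto
        finally show "norm (d s \<omega>) \<le> L * h * norm (sx s \<omega>)"
          unfolding d_def by (rule norm_matrix_vector_le_bound) simp
      qed (use h L_nonneg in simp)
      finally show ?thesis by (simp add: ennreal_mult mult.assoc add_left_mono mult_left_mono)
    qed
    have "nn_sq \<mu> (proc_on t t' \<zeta>) = (\<Sum>i<n. nn_sq \<mu> (proc_on (r i) (r (Suc i)) \<zeta>))"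
      using nn_sq_proc_on_partition[OF joint_meas_combined(2), of n r] rm ri rn r0 t by simp
    also have "\<dots> \<le> (\<Sum>i<n. 2 * nn_sq \<mu> (proc_on (r i) (r (Suc i)) (X i))
        + ennreal (2 * (L * h)\<^sup>2) * nn_sq \<mu> (proc_on (r i) (r (Suc i)) sx))"
      using part by (intro sum_mono) auto
    also have "\<dots> = 2 * nn_sq \<mu> Z + ennreal (2 * (L * h)\<^sup>2) * nn_sq \<mu> (proc_on t t' sx)"
      using nn_sq_proc_on_partition[OF joint_meas_processes(5), of n r] rm ri rn r0 t
      by (simp add: sum.distrib sum_distrib_left[symmetric] nZ)
    also have "nn_sq \<mu> (proc_on t t' sx) \<le> ennreal En"
      unfolding En(1)[symmetric] energy_def by simp
    also have "ennreal (2 * (L * h)\<^sup>2) * ennreal En = ennreal (2 * (L * h)\<^sup>2 * En)"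
      using En by (simp add: ennreal_mult)
    finally show ?thesis by (simp add: mult_left_mono)
  qed
  have small: "2 * (L * h)\<^sup>2 * En \<le> 2 * L\<^sup>2 * (t' - t)\<^sup>2 * En / real n"
  proof -
    have "h\<^sup>2 = (t' - t)\<^sup>2 / (real n * real n)" by (simp add: h_def power2_eq_square)
    also have "\<dots> \<le> (t' - t)\<^sup>2 / real n" using n by (intro divide_left_mono) auto
    finally have "2 * L\<^sup>2 * h\<^sup>2 * En \<le> 2 * L\<^sup>2 * ((t' - t)\<^sup>2 / real n) * En"
      using En by (intro mult_right_mono mult_left_mono) auto
    then show ?thesis by (simp add: power_mult_distrib mult.assoc)
  qed
  have "nn_sq M (\<eta> t) + nn_sq \<mu> (proc_on t t' \<zeta>) \<le> nn_sq M (\<eta> t) + (2 * nn_sq \<mu> Z + ennreal (2 * (L * h)\<^sup>2 * En))"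
    by (intro add_left_mono n\<zeta>)
  \<comment> \<open>Doubling the first term makes the Pythagorean bound applicable to the sum; with
    the factor 2 from splitting \<open>I + es\<close> this is the origin of the constant 4.\<close>
  also have "\<dots> \<le> 2 * (nn_sq M (\<eta> t) + nn_sq \<mu> Z) + ennreal (2 * (L * h)\<^sup>2 * En)"
  proof -
    have "nn_sq M (\<eta> t) \<le> 2 * nn_sq M (\<eta> t)" by (simp add: mult_2)
    then show ?thesis unfolding distrib_left add.assoc[symmetric] by (rule add_right_mono[OF add_right_mono])
  qed
  also have "\<dots> \<le> 2 * (2 * nn_sq M I + 2 * nn_sq M es) + ennreal (2 * L\<^sup>2 * (t' - t)\<^sup>2 * En / real n)"
    by (intro add_mono mult_left_mono pyth ennreal_leI small) auto
  also have "\<dots> \<le> 2 * (2 * (ennreal (t' - t) * nn_sq \<mu> (proc_on t t' g)) + 2 * ennreal (C * (t' - t)\<^sup>2 * En / real n))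
      + ennreal (2 * L\<^sup>2 * (t' - t)\<^sup>2 * En / real n)"
    by (intro add_mono mult_left_mono nI nes) auto
  also have "\<dots> = ennreal (4 * (t' - t)) * nn_sq \<mu> (proc_on t t' g)
      + (ennreal (4 * (C * (t' - t)\<^sup>2 * En / real n)) + ennreal (2 * L\<^sup>2 * (t' - t)\<^sup>2 * En / real n))"
  proof -
    have "2 * (2 * ennreal a) = ennreal (4 * a)" for a
      by (cases "a \<ge> 0") (simp_all add: ennreal_mult ennreal_neg mult.assoc[symmetric])
    then show ?thesis by (simp add: distrib_left mult.assoc[symmetric] add.assoc)
  qed
  also have "ennreal (4 * (C * (t' - t)\<^sup>2 * En / real n)) + ennreal (2 * L\<^sup>2 * (t' - t)\<^sup>2 * En / real n) =
      ennreal ((4 * C + 2 * L\<^sup>2) * (t' - t)\<^sup>2 * En / real n)"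
    using C En by (subst ennreal_plus[symmetric]) (auto simp: add_divide_distrib algebra_simps)
  finally show ?thesis by (simp add: C_def)
qed

text \<open>In the partition estimate only the error term depends on the number of pieces, and it
  tends to 0.\<close>

lemma estimate:
  assumes t: "0 \<le> t" "t < t'" "t' \<le> T" and fin: "AE \<omega> in M. \<eta> t' \<omega> = 0"
  shows "nn_sq M (\<eta> t) + nn_sq \<mu> (proc_on t t' \<zeta>) \<le> ennreal (4 * (t' - t)) * nn_sq \<mu> (proc_on t t' g)"
proof (rule ennreal_le_epsilon)
  fix \<epsilon> :: real assume \<epsilon>: "\<epsilon> > 0"
  obtain En where En: "energy t t' = ennreal En" "En \<ge> 0"
    using energy_finite[OF t(1,3)] by (cases "energy t t'") auto
  define c where "c = (4 * (L\<^sup>2 * (6 * T + 4)) + 2 * L\<^sup>2) * (t' - t)\<^sup>2 * En"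
  obtain n :: nat where n: "c / \<epsilon> < real n" "n > 0"
    using reals_Archimedean2[of "max 1 (c / \<epsilon>)"] by auto
  have "c / real n \<le> \<epsilon>" using n \<epsilon> by (simp add: field_simps)
  then have "ennreal (c / real n) \<le> ennreal \<epsilon>" by (rule ennreal_leI)
  with estimate_partition[OF t fin n(2) En]
  show "nn_sq M (\<eta> t) + nn_sq \<mu> (proc_on t t' \<zeta>) \<le> ennreal (4 * (t' - t)) * nn_sq \<mu> (proc_on t t' g) + ennreal \<epsilon>"
    unfolding c_def by (meson add_left_mono order_trans)
qed

text \<open>The estimate at every \<open>s\<close> in the interval bounds the mean square of
  \<open>\<eta> s\<close> by \<open>q\<close>, and integration over \<open>s\<close> bounds that of
  \<open>\<eta>\<close> in time; the estimate at \<open>t0\<close> bounds that of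
  \<open>\<zeta>\<close>. Since \<open>q\<close> is proportional to their sum, shortness of the
  interval makes the sum at most half of itself.\<close>

lemma vanish_short:
  assumes t: "0 \<le> t0" "t0 < t'" "t' \<le> T" and fin: "AE \<omega> in M. \<eta> t' \<omega> = 0"
    and \<kappa>: "\<kappa> \<ge> 0" "\<And>r \<omega>. r \<in> {0..T} \<Longrightarrow> norm (g r \<omega>) \<le> \<kappa> * (norm (\<eta> r \<omega>) + norm (\<zeta> r \<omega>))"
    and short: "8 * \<kappa>\<^sup>2 * (t' - t0) * (1 + (t' - t0)) \<le> 1 / 2"
  shows "nn_sq \<mu> (proc_on t0 t' \<eta>) = 0" "nn_sq \<mu> (proc_on t0 t' \<zeta>) = 0" "AE \<omega> in M. \<eta> t0 \<omega> = 0"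
proof -
  obtain a where a: "nn_sq \<mu> (proc_on t0 t' \<eta>) = ennreal a" "a \<ge> 0"
    using L2_joint_finite[OF L2_combined(1) t(1,3)] by (cases "nn_sq \<mu> (proc_on t0 t' \<eta>)") auto
  obtain b where b: "nn_sq \<mu> (proc_on t0 t' \<zeta>) = ennreal b" "b \<ge> 0"
    using L2_joint_finite[OF L2_combined(2) t(1,3)] by (cases "nn_sq \<mu> (proc_on t0 t' \<zeta>)") auto
  define \<epsilon> where "\<epsilon> = t' - t0"
  have \<epsilon>: "\<epsilon> > 0" using t by (simp add: \<epsilon>_def)
  \<comment> \<open>The factor \<open>4 * \<epsilon>\<close> of the estimate times the bound
    \<open>2 * \<kappa>^2 * (a + b)\<close> for \<open>g\<close>.\<close>
  define q where "q = 8 * \<kappa>\<^sup>2 * \<epsilon> * (a + b)"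
  have q: "q \<ge> 0" using a b \<epsilon> by (simp add: q_def)
  have ng: "nn_sq \<mu> (proc_on t0 t' g) \<le> ennreal (2 * \<kappa>\<^sup>2 * (a + b))"
  proof -
    note j = joint_meas_norm[OF joint_meas_combined(1)] joint_meas_norm[OF joint_meas_combined(2)]
    have "nn_sq \<mu> (proc_on t0 t' g) \<le> ennreal (\<kappa>\<^sup>2) * nn_sq \<mu> (proc_on t0 t' (\<lambda>r \<omega>. norm (\<eta> r \<omega>) + norm (\<zeta> r \<omega>)))"
      by (rule nn_sq_proc_on_bound[OF joint_meas_add[OF j]]) (use t \<kappa> in auto)
    also have "\<dots> \<le> ennreal (\<kappa>\<^sup>2) * (2 * ennreal a + 2 * ennreal b)"
      using nn_sq_proc_on_add[OF j t(1,3)] by (intro mult_left_mono) (simp_all add: nn_sq_proc_on_norm a b)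
    also have "2 * ennreal a + 2 * ennreal b = ennreal (2 * a + 2 * b)"
      using a b by (simp add: ennreal_plus ennreal_mult)
    also have "ennreal (\<kappa>\<^sup>2) * ennreal (2 * a + 2 * b) = ennreal (2 * \<kappa>\<^sup>2 * (a + b))"
      using a b by (subst ennreal_mult[symmetric]) (auto simp: algebra_simps)
    finally show ?thesis .
  qed
  have est: "nn_sq M (\<eta> s) + nn_sq \<mu> (proc_on s t' \<zeta>) \<le> ennreal q" if s: "s \<in> {t0..<t'}" for s
  proof -
    have "nn_sq M (\<eta> s) + nn_sq \<mu> (proc_on s t' \<zeta>) \<le> ennreal (4 * (t' - s)) * nn_sq \<mu> (proc_on s t' g)"
      using s t by (intro estimate fin) auto
    also have "\<dots> \<le> ennreal (4 * \<epsilon>) * ennreal (2 * \<kappa>\<^sup>2 * (a + b))"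
      using s by (intro mult_mono ennreal_leI order_trans[OF nn_sq_proc_on_mono ng]) (auto simp: \<epsilon>_def)
    also have "\<dots> = ennreal q" using \<epsilon> a b by (simp add: q_def ennreal_mult[symmetric] mult_ac)
    finally show ?thesis .
  qed
  have "ennreal a = (\<integral>\<^sup>+ r. indicator {t0<..t'} r * nn_sq M (\<eta> r) \<partial>lborel)"
    using nn_sq_proc_on(1)[OF joint_meas_combined(1) t(1,3)] a by simp
  also have "\<dots> \<le> (\<integral>\<^sup>+ r. ennreal q * indicator {t0..t'} r \<partial>lborel)"
  proof (intro nn_integral_mono)
    fix r
    have "nn_sq M (\<eta> t') = 0" using nn_sq_cong_AE[OF fin] by simp
    then have "nn_sq M (\<eta> r) \<le> ennreal q" if "r \<in> {t0<..t'}"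
      using est[of r] that by (cases "r = t'") (auto intro: order_trans[OF le_iff_add[THEN iffD2]])
    then show "indicator {t0<..t'} r * nn_sq M (\<eta> r) \<le> ennreal q * indicator {t0..t'} r"
      by (auto simp: indicator_def)
  qed
  also have "\<dots> = ennreal (q * \<epsilon>)" using t q by (simp add: nn_integral_cmult_indicator \<epsilon>_def ennreal_mult)
  finally have a_le: "a \<le> q * \<epsilon>" using q \<epsilon> by simp
  have e0: "nn_sq M (\<eta> t0) + ennreal b \<le> ennreal q" using est[of t0] t b by simp
  then have "ennreal b \<le> ennreal q" by (rule order_trans[rotated]) simp
  then have b_le: "b \<le> q" using q by simp
  have "a + b \<le> q * \<epsilon> + q" using a_le b_le by simp
  also have "\<dots> = (8 * \<kappa>\<^sup>2 * \<epsilon> * (1 + \<epsilon>)) * (a + b)" by (simp add: q_def algebra_simps)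
  also have "\<dots> \<le> 1 / 2 * (a + b)" using short a b by (intro mult_right_mono) (auto simp: \<epsilon>_def)
  finally have ab: "a = 0" "b = 0" using a b by auto
  then have "q = 0" by (simp add: q_def)
  then have "nn_sq M (\<eta> t0) = 0" using e0 ab by simp
  moreover have "\<eta> t0 \<in> borel_measurable M" using joint_meas_at[OF joint_meas_combined(1)] t by simp
  ultimately show "AE \<omega> in M. \<eta> t0 \<omega> = 0" by (intro nn_sq_eq_0_AE)
  show "nn_sq \<mu> (proc_on t0 t' \<eta>) = 0" "nn_sq \<mu> (proc_on t0 t' \<zeta>) = 0" using a b ab by auto
qed

text \<open>Backward induction over intervals of equal length: on each of them the short-time result
  also yields that \<open>\<eta>\<close> vanishes at the left end, which is the terminal condition
  for the next one.\<close>

lemma vanish: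
  assumes fin: "AE \<omega> in M. \<eta> T \<omega> = 0"
    and \<kappa>: "\<kappa> \<ge> 0" "\<And>r \<omega>. r \<in> {0..T} \<Longrightarrow> norm (g r \<omega>) \<le> \<kappa> * (norm (\<eta> r \<omega>) + norm (\<zeta> r \<omega>))"
  shows "nn_sq \<mu> (proc_on 0 T \<eta>) = 0" "nn_sq \<mu> (proc_on 0 T \<zeta>) = 0"
proof -
  \<comment> \<open>\<open>N > T\<close> gives \<open>\<epsilon> \<le> 1\<close>, and then
    \<open>32 * \<kappa>^2 * \<epsilon> \<le> 1\<close> gives \<open>8 * \<kappa>^2 * \<epsilon> *
    (1 + \<epsilon>) \<le> 16 * \<kappa>^2 * \<epsilon> \<le> 1/2\<close>.\<close>
  obtain N :: nat where N: "real N > max 1 (max T (32 * \<kappa>\<^sup>2 * T))"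
    using reals_Archimedean2 by blast
  define \<epsilon> where "\<epsilon> = T / real N"
  have N0: "real N > 0" using N by linarith
  have \<epsilon>: "\<epsilon> > 0" "\<epsilon> \<le> 1" "32 * \<kappa>\<^sup>2 * \<epsilon> \<le> 1" using N N0 T_pos by (auto simp: \<epsilon>_def field_simps)
  have short: "8 * \<kappa>\<^sup>2 * \<epsilon> * (1 + \<epsilon>) \<le> 1 / 2"
  proof -
    have "8 * \<kappa>\<^sup>2 * \<epsilon> * (1 + \<epsilon>) \<le> 8 * \<kappa>\<^sup>2 * \<epsilon> * 2" using \<epsilon> by (intro mult_left_mono) auto
    then show ?thesis using \<epsilon>(3) by (simp add: field_simps)
  qed
  have "nn_sq \<mu> (proc_on (T - real k * \<epsilon>) T \<eta>) = 0 \<and> nn_sq \<mu> (proc_on (T - real k * \<epsilon>) T \<zeta>) = 0 \<and>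
      (AE \<omega> in M. \<eta> (T - real k * \<epsilon>) \<omega> = 0)" if "k \<le> N" for k
    using that
  proof (induction k)
    case 0
    have "proc_on T T X = (\<lambda>_. 0)" for X :: "real \<Rightarrow> 'w \<Rightarrow> real^'n" by (auto simp: proc_on_def)
    then show ?case using fin by simp
  next
    case (Suc k)
    define t' where "t' = T - real k * \<epsilon>"
    define t0 where "t0 = T - real (Suc k) * \<epsilon>"
    have NT: "real N * \<epsilon> = T" using N0 by (simp add: \<epsilon>_def)
    have "0 \<le> real k * \<epsilon>" using \<epsilon> by simp
    moreover have "real (Suc k) * \<epsilon> \<le> real N * \<epsilon>" using Suc.prems \<epsilon> by (intro mult_right_mono) auto
    ultimately have t: "0 \<le> t0" "t0 < t'" "t' \<le> T" "t' - t0 = \<epsilon>"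
      using \<epsilon>(1) unfolding NT by (auto simp: t0_def t'_def distrib_right)
    have IH: "nn_sq \<mu> (proc_on t' T \<eta>) = 0" "nn_sq \<mu> (proc_on t' T \<zeta>) = 0" "AE \<omega> in M. \<eta> t' \<omega> = 0"
      using Suc by (auto simp: t'_def)
    note v = vanish_short[OF t(1-3) IH(3) \<kappa> short[folded t(4)]]
    have "nn_sq \<mu> (proc_on t0 T \<eta>) = 0" "nn_sq \<mu> (proc_on t0 T \<zeta>) = 0"
      using nn_sq_proc_on_combine[OF joint_meas_combined(1), of t0 t' T] nn_sq_proc_on_combine[OF joint_meas_combined(2), of t0 t' T]
        v IH t by auto
    then show ?case using v(3) by (simp add: t0_def)
  qed
  from this[of N] show "nn_sq \<mu> (proc_on 0 T \<eta>) = 0" "nn_sq \<mu> (proc_on 0 T \<zeta>) = 0"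
    using N0 by (auto simp: \<epsilon>_def)
qed

lemma \<eta>_\<zeta>_zero:
  assumes "AE \<omega> in M. \<eta> T \<omega> = 0"
    and "\<kappa> \<ge> 0" "\<And>r \<omega>. r \<in> {0..T} \<Longrightarrow> norm (g r \<omega>) \<le> \<kappa> * (norm (\<eta> r \<omega>) + norm (\<zeta> r \<omega>))"
  shows "AE (t, \<omega>) in restrict_space lborel {0..T} \<Otimes>\<^sub>M M. \<eta> t \<omega> = 0 \<and> \<zeta> t \<omega> = 0"
proof -
  have "nn_sq \<mu> (proc_on 0 T \<eta>) = 0" "nn_sq \<mu> (proc_on 0 T \<zeta>) = 0"
    by (rule vanish[OF assms(1,2)], rule assms(3), assumption)+
  from joint_meas_zero_AE[OF joint_meas_combined(1) this(1)] joint_meas_zero_AE[OF joint_meas_combined(2) this(2)]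
  show ?thesis by eventually_elim auto
qed

end

section \<open>Feedback form of the equilibrium controls\<close>

theorem proposition3p2:
  fixes T :: real
    and A C Q1 :: "real \<Rightarrow> real^'n^'n"
    and Bc Dc :: "real \<Rightarrow> real^'m^'n"
    and E :: "real \<Rightarrow> real^'p^'n"
    and Rc :: "real \<Rightarrow> real^'m^'m"
    and G1 :: "real^'n^'n"
    and blk :: "'m \<Rightarrow> player"
  assumes T_pos: "T > 0"
    and coeffs: "bounded_coeff T A" "bounded_coeff T Bc" "bounded_coeff T C" "bounded_coeff T Dc"
      "bounded_coeff T E" "bounded_coeff T Q1" "bounded_coeff T Rc"
    and players: "surj blk" "\<And>t. t \<in> {0..T} \<Longrightarrow> block_diagonal blk (Rc t)"
      "\<And>t. t \<in> {0..T} \<Longrightarrow> symmetric_matrix (Rc t)"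
    and A1: "\<And>t. t \<in> {0..T} \<Longrightarrow> pos_semidef (Q1 t)" "pos_semidef G1"
    and A2: "\<exists>\<delta>>0. \<forall>t\<in>{0..T}. \<forall>k. diag_block_ge blk k \<delta> (Rc t)"
  shows "\<exists>\<gamma>0>0. \<forall>\<gamma>\<ge>\<gamma>0.
    \<forall>(M :: 'w measure) W (x0 :: real^'n) us vs x y z P.
      brownian_motion M W \<longrightarrow>
      open_loop_nash M W T A Bc C Dc E Q1 Rc G1 \<gamma> x0 us vs \<longrightarrow>
      fbsde_solution M W T A Bc C Dc E Q1 Rc G1 \<gamma> x0 x y z \<longrightarrow>
      eq_process M T us
        (\<lambda>t \<omega>. - (matrix_inv (Rc t) *v (transpose (Bc t) *v y t \<omega> + transpose (Dc t) *v z t \<omega>))) \<longrightarrow>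
      eq_process M T vs (\<lambda>t \<omega>. (1 / \<gamma>\<^sup>2) *\<^sub>R (transpose (E t) *v y t \<omega>)) \<longrightarrow>
      riccati_solution T A Bc C Dc E Q1 Rc G1 \<gamma> P \<longrightarrow>
      (\<forall>t\<in>{0..T}. invertible (riccati_K (Dc t) (Rc t) (P t))) \<longrightarrow>
      eq_process M T us
        (\<lambda>t \<omega>. - (matrix_inv (Rc t) **
            (transpose (Bc t) ** P t
             + transpose (Dc t) ** matrix_inv (riccati_K (Dc t) (Rc t) (P t)) ** P t
                 ** (C t - Dc t ** matrix_inv (Rc t) ** transpose (Bc t) ** P t)) *v x t \<omega>)) \<and>
      eq_process M T vs (\<lambda>t \<omega>. (1 / \<gamma>\<^sup>2) *\<^sub>R ((transpose (E t) ** P t) *v x t \<omega>))"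
proof -
  obtain \<delta> where \<delta>: "\<delta> > 0" "\<And>t k. t \<in> {0..T} \<Longrightarrow> diag_block_ge blk k \<delta> (Rc t)"
    using A2 by blast
  obtain b where b: "\<And>t. t \<in> {0..T} \<Longrightarrow> norm (A t) \<le> b" "\<And>t. t \<in> {0..T} \<Longrightarrow> norm (Bc t) \<le> b"
    "\<And>t. t \<in> {0..T} \<Longrightarrow> norm (C t) \<le> b" "\<And>t. t \<in> {0..T} \<Longrightarrow> norm (Dc t) \<le> b"
    "\<And>t. t \<in> {0..T} \<Longrightarrow> norm (E t) \<le> b" "\<And>t. t \<in> {0..T} \<Longrightarrow> norm (Q1 t) \<le> b"
  proof -
    obtain b1 b2 b3 b4 b5 b6 where
      b: "\<forall>t\<in>{0..T}. norm (A t) \<le> b1" "\<forall>t\<in>{0..T}. norm (Bc t) \<le> b2" "\<forall>t\<in>{0..T}. norm (C t) \<le> b3"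
        "\<forall>t\<in>{0..T}. norm (Dc t) \<le> b4" "\<forall>t\<in>{0..T}. norm (E t) \<le> b5" "\<forall>t\<in>{0..T}. norm (Q1 t) \<le> b6"
      using coeffs(1-6) unfolding bounded_coeff_def bounded_iff by auto
    define b where "b = Max {b1, b2, b3, b4, b5, b6}"
    have "b1 \<le> b" "b2 \<le> b" "b3 \<le> b" "b4 \<le> b" "b5 \<le> b" "b6 \<le> b" by (simp_all add: b_def)
    with b show ?thesis by (intro that[of b]) (meson order_trans)+
  qed
  have main: "eq_process M T us
        (\<lambda>t \<omega>. - (matrix_inv (Rc t) **
            (transpose (Bc t) ** P t
             + transpose (Dc t) ** matrix_inv (riccati_K (Dc t) (Rc t) (P t)) ** P t
                 ** (C t - Dc t ** matrix_inv (Rc t) ** transpose (Bc t) ** P t)) *v x t \<omega>)) \<and>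
      eq_process M T vs (\<lambda>t \<omega>. (1 / \<gamma>\<^sup>2) *\<^sub>R ((transpose (E t) ** P t) *v x t \<omega>))"
    if \<gamma>: "\<gamma> \<ge> 1" and bm: "brownian_motion M W"
      and fbsde: "fbsde_solution M W T A Bc C Dc E Q1 Rc G1 \<gamma> x0 x y z"
      and us: "eq_process M T us
        (\<lambda>t \<omega>. - (matrix_inv (Rc t) *v (transpose (Bc t) *v y t \<omega> + transpose (Dc t) *v z t \<omega>)))"
      and vs: "eq_process M T vs (\<lambda>t \<omega>. (1 / \<gamma>\<^sup>2) *\<^sub>R (transpose (E t) *v y t \<omega>))"
      and sol: "riccati_solution T A Bc C Dc E Q1 Rc G1 \<gamma> P"
      and inv: "\<forall>t\<in>{0..T}. invertible (riccati_K (Dc t) (Rc t) (P t))"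
    for \<gamma> :: real and M :: "'w measure" and W and x0 :: "real^'n" and us vs x y z P
  proof -
    interpret ric: riccati T A C Q1 Bc Dc E Rc G1 \<gamma> b \<delta> P
    proof
      show "\<delta> * (\<xi> \<bullet> \<xi>) \<le> \<xi> \<bullet> (Rc t *v \<xi>)" if "t \<in> {0..T}" for t \<xi>
        using block_diagonal_coercive[OF players(2)[OF that] \<delta>(2)[OF that]] .
      show "transpose (Rc t) = Rc t" if "t \<in> {0..T}" for t
        using players(3)[OF that] by (simp add: symmetric_matrix_def)
      show "sym_psd (Q1 t)" if "t \<in> {0..T}" for t
        using A1(1)[OF that] by (simp add: sym_psd_def pos_semidef_def symmetric_matrix_def)
      show "sym_psd G1"
        using A1(2) by (simp add: sym_psd_def pos_semidef_def symmetric_matrix_def)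
      show "invertible (riccati_K (Dc t) (Rc t) (P t))" if "t \<in> {0..T}" for t
        using inv that by blast
    qed (fact T_pos b \<delta>(1) \<gamma> sol)+
    obtain L where L: "\<And>r. r \<in> {0..T} \<Longrightarrow> norm (ric.F r) \<le> L"
      using ric.F_bounded by blast
    obtain \<kappa> where \<kappa>: "\<kappa> \<ge> 0" "\<And>t xv yv zv. t \<in> {0..T} \<Longrightarrow>
        norm (ric.drift_Y t xv yv zv - P t *v ric.drift_X t xv yv zv + ric.F t *v xv) \<le>
        \<kappa> * (norm (yv - P t *v xv) + norm (zv - P t *v ric.diffusion_X t xv yv zv))"
      using ric.decoupled_drift_bound by blast
    have "prob_space M" using bm by (simp add: brownian_motion_def)
    then interpret prob_space M .
    interpret dec: decoupling M W T L x y
      "\<lambda>t \<omega>. ric.drift_X t (x t \<omega>) (y t \<omega>) (z t \<omega>)" "\<lambda>t \<omega>. ric.diffusion_X t (x t \<omega>) (y t \<omega>) (z t \<omega>)"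
      "\<lambda>t \<omega>. ric.drift_Y t (x t \<omega>) (y t \<omega>) (z t \<omega>)" z P ric.F
    proof
      show "has_ito_differential M W T x (\<lambda>t \<omega>. ric.drift_X t (x t \<omega>) (y t \<omega>) (z t \<omega>))
          (\<lambda>t \<omega>. ric.diffusion_X t (x t \<omega>) (y t \<omega>) (z t \<omega>))"
        and "has_ito_differential M W T y (\<lambda>t \<omega>. ric.drift_Y t (x t \<omega>) (y t \<omega>) (z t \<omega>)) z"
        and "L2_prog M W T x" "L2_prog M W T y"
        using fbsde
        unfolding fbsde_solution_def ric.drift_X_def ric.drift_Y_def ric.diffusion_X_def riccati_S_def riccati_L_def
        by blast+
    qed (fact bm T_pos ric.P_diff_set_integral ric.F_integrable L | assumption)+
    have "AE \<omega> in M. dec.\<eta> T \<omega> = 0"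
    proof -
      have "AE \<omega> in M. y T \<omega> = G1 *v x T \<omega>" using fbsde by (simp add: fbsde_solution_def)
      then show ?thesis by eventually_elim (simp add: dec.\<eta>_def ric.P_T)
    qed
    then have "AE (t, \<omega>) in restrict_space lborel {0..T} \<Otimes>\<^sub>M M. dec.\<eta> t \<omega> = 0 \<and> dec.\<zeta> t \<omega> = 0"
      by (rule dec.\<eta>_\<zeta>_zero[OF _ \<kappa>(1)]) (unfold dec.g_def dec.\<eta>_def dec.\<zeta>_def, rule \<kappa>(2))
    \<comment> \<open>The algebra is valid for times in \<open>[0, T]\<close> only, so this
      membership is carried along with the almost everywhere statements.\<close>
    moreover have "AE (t, \<omega>) in restrict_space lborel {0..T} \<Otimes>\<^sub>M M. t \<in> {0..T}"
      by (rule AE_I2) (auto simp: space_pair_measure space_restrict_space)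
    ultimately have yz: "AE (t, \<omega>) in restrict_space lborel {0..T} \<Otimes>\<^sub>M M. y t \<omega> = P t *v x t \<omega> \<and>
        z t \<omega> = matrix_inv (riccati_K (Dc t) (Rc t) (P t)) *v
          (P t *v (riccati_H (Bc t) (C t) (Dc t) (Rc t) (P t) *v x t \<omega>))"
    proof eventually_elim
      case (elim p)
      obtain t \<omega> where p: "p = (t, \<omega>)" by (cases p)
      have "y t \<omega> = P t *v x t \<omega>" "z t \<omega> = P t *v ric.diffusion_X t (x t \<omega>) (y t \<omega>) (z t \<omega>)" "t \<in> {0..T}"
        using elim by (auto simp: p dec.\<eta>_def dec.\<zeta>_def)
      then show ?case using ric.decoupled_solution by (simp add: p)
    qed
    show ?thesis
      unfolding eq_process_def
    proof
      show "AE (t, \<omega>) in restrict_space lborel {0..T} \<Otimes>\<^sub>M M. us t \<omega> = - (matrix_inv (Rc t) **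
            (transpose (Bc t) ** P t
             + transpose (Dc t) ** matrix_inv (riccati_K (Dc t) (Rc t) (P t)) ** P t
                 ** (C t - Dc t ** matrix_inv (Rc t) ** transpose (Bc t) ** P t)) *v x t \<omega>)"
        using us[unfolded eq_process_def] yz
      proof eventually_elim
        case (elim p)
        then show ?case
          by (auto simp: riccati_H_def matrix_vector_mult_add_rdistrib matrix_vector_mul_assoc matrix_mul_assoc
              split: prod.splits simp flip: matrix_vector_mul_assoc)
      qed
      show "AE (t, \<omega>) in restrict_space lborel {0..T} \<Otimes>\<^sub>M M.
          vs t \<omega> = (1 / \<gamma>\<^sup>2) *\<^sub>R ((transpose (E t) ** P t) *v x t \<omega>)"
        using vs[unfolded eq_process_def] yz
      proof eventually_elim
        case (elim p)
        then show ?case by (auto split: prod.splits simp flip: matrix_vector_mul_assoc)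
      qed
    qed
  qed
  show ?thesis
  proof (intro exI[of _ 1] conjI allI impI)
    fix \<gamma> :: real and M :: "'w measure" and W x0 us vs x y z P
    assume "1 \<le> \<gamma>" "brownian_motion M W" "fbsde_solution M W T A Bc C Dc E Q1 Rc G1 \<gamma> x0 x y z"
      "eq_process M T us
        (\<lambda>t \<omega>. - (matrix_inv (Rc t) *v (transpose (Bc t) *v y t \<omega> + transpose (Dc t) *v z t \<omega>)))"
      "eq_process M T vs (\<lambda>t \<omega>. (1 / \<gamma>\<^sup>2) *\<^sub>R (transpose (E t) *v y t \<omega>))"
      "riccati_solution T A Bc C Dc E Q1 Rc G1 \<gamma> P"
      "\<forall>t\<in>{0..T}. invertible (riccati_K (Dc t) (Rc t) (P t))"
    note * = main[OF this]
    show "eq_process M T us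
        (\<lambda>t \<omega>. - (matrix_inv (Rc t) **
            (transpose (Bc t) ** P t
             + transpose (Dc t) ** matrix_inv (riccati_K (Dc t) (Rc t) (P t)) ** P t
                 ** (C t - Dc t ** matrix_inv (Rc t) ** transpose (Bc t) ** P t)) *v x t \<omega>))"
      by (rule conjunct1[OF *])
    show "eq_process M T vs (\<lambda>t \<omega>. (1 / \<gamma>\<^sup>2) *\<^sub>R ((transpose (E t) ** P t) *v x t \<omega>))"
      by (rule conjunct2[OF *])
  qed simp
qed

end
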